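(* Let $a>0$, $-1<b\le 0$ and $a-b<3$. Then $a=A(b)$ if and only if $$D_{a,-b}(t)\ge 0\ \text{ for all } t\ge 0,\qquad\text{and}\qquad D_{a,-b}(t_b)=0\ \text{ for some } t_b>0 .$$ When this holds, every such zero $t_b>0$ has finite even order at least two (as a zero of $t\mapsto D_{a,-b}(t)$); in particular, $$\partial_t D_{a,-b}(t_b)=0,\qquad \partial_t^2 D_{a,-b}(t_b)\ge 0 .$$ At such a contact point the parameter derivatives satisfy $$\partial_a D_{a,c}(t_b)<0,\qquad \partial_c D_{a,c}(t_b)<0,\qquad c=-b .$$
   Context: A function $g\in C^\infty(0,\infty)$ is completely monotone if $(-1)^n g^{(n)}\ge 0$ on $(0,\infty)$ for every integer $n\ge 0$. A nonnegative smooth function $f$ on $(0,\infty)$ is a Bernstein function if $f'$ is completely monotone. For $a>0$, $b\in\mathbb{R}$, $x>0$: $F_{a,b}(x)=\left(1+\frac{a}{x}\right)^{x+b}$. For $-1<b\le 0$, $A(b)=\sup\{a>0: F_{a,b}\text{ is a Bernstein function}\}$ (this set is nonempty and bounded above). For $a>0$, $0\le c<1$, $a+c<3$, put $$w_{a,c}(s)=\frac1\pi\left(\frac{s}{1-s}\right)^{as+c}\sin\bigl(\pi(as+c)\bigr)\quad(0<s<1),$$ $$q_1=\frac a2+c,\qquad q_2=\frac a3+\frac c2+\frac12\left(\frac a2+c\right)^2,$$ $$D_{a,c}(t)=q_1+(q_1-q_2)t+e^{-a}\int_0^1 w_{a,c}(s)\bigl[e^{(1-s)t}-1-(1-s)t\bigr]\,ds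 .$$ The derivative $\partial_c$ at $c=0$ is understood as the right derivative. *)

theory Defs
  imports "HOL-Analysis.Analysis"
begin

text \<open>For \<open>S\<close> open, this is membership in \<open>C\<^sup>\<infinity>(S)\<close>: every iterated derivative is a
  genuine derivative at every point of \<open>S\<close>, so that \<open>deriv\<close> is never used off its domain.\<close>

definition smooth_on :: "real set \<Rightarrow> (real \<Rightarrow> real) \<Rightarrow> bool" where
  "smooth_on S f \<longleftrightarrow> (\<forall>n. \<forall>x\<in>S. (deriv ^^ n) f differentiable (at x))"

definition completely_monotone :: "(real \<Rightarrow> real) \<Rightarrow> bool" where
  "completely_monotone g \<longleftrightarrow>
     smooth_on {0<..} g \<and> (\<forall>n. \<forall>x>0. (-1) ^ n * (deriv ^^ n) g x \<ge> 0)"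

definition bernstein :: "(real \<Rightarrow> real) \<Rightarrow> bool" where
  "bernstein f \<longleftrightarrow>
     smooth_on {0<..} f \<and> (\<forall>x>0. f x \<ge> 0) \<and> completely_monotone (deriv f)"

definition F :: "real \<Rightarrow> real \<Rightarrow> real \<Rightarrow> real" where
  "F a b x = (1 + a / x) powr (x + b)"

definition A :: "real \<Rightarrow> real" where
  "A b = Sup {a. a > 0 \<and> bernstein (F a b)}"

definition w :: "real \<Rightarrow> real \<Rightarrow> real \<Rightarrow> real" where
  "w a c s = 1 / pi * (s / (1 - s)) powr (a * s + c) * sin (pi * (a * s + c))"

definition q1 :: "real \<Rightarrow> real \<Rightarrow> real" where
  "q1 a c = a / 2 + c"

definition q2 :: "real \<Rightarrow> real \<Rightarrow> real" where
  "q2 a c = a / 3 + c / 2 + 1 / 2 * (a / 2 + c)\<^sup>2"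

text \<open>The integrand is only claimed to be Lebesgue integrable for \<open>0 \<le> c\<close> and \<open>a + c < 3\<close>: as
  \<open>s \<rightarrow> 1\<close> the bracket is \<open>O((1 - s)\<^sup>2)\<close>, while \<open>w a c s\<close> is of size \<open>(1 - s) powr - (a + c)\<close>.\<close>

definition D :: "real \<Rightarrow> real \<Rightarrow> real \<Rightarrow> real" where
  "D a c t = q1 a c + (q1 a c - q2 a c) * t
     + exp (- a) * (LBINT s:{0<..<1}. w a c s * (exp ((1 - s) * t) - 1 - (1 - s) * t))"

definition has_zero_of_order :: "(real \<Rightarrow> real) \<Rightarrow> real \<Rightarrow> nat \<Rightarrow> bool" where
  "has_zero_of_order f x m \<longleftrightarrow>
     (\<exists>e>0. smooth_on (ball x e) f) \<and> (\<forall>k<m. (deriv ^^ k) f x = 0) \<and> (deriv ^^ m) f x \<noteq> 0"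

end

theory Submission
  imports Defs "HOL-Complex_Analysis.Complex_Analysis"
begin

text \<open>Write \<open>c = - b\<close> and \<open>y = x / a\<close>. Expanding \<open>F a (- c) x = (1 + 1 / y) powr (a * y - c)\<close> in powers of
\<open>1 / (1 + y)\<close> and reading the coefficients as a Borel transform gives
\<open>F a (- c) x = exp a * (1 - (\<integral>t\<ge>0. exp (- (1 + y) * t) * D(t)))\<close>, where \<open>D\<close> is an entire function of \<open>t\<close>
whose coefficients are polynomials in \<open>a\<close> and \<open>c\<close>. This entire function, \<open>Dser a c\<close>, makes
sense for all real \<open>a\<close> and \<open>c\<close>, and it agrees with \<open>D a c\<close> in the range where the latter integral
converges (lemma \<open>D_eq_Dser\<close>): the weight \<open>w\<close> is, up to a constant, the jump of \<open>F\<close> across its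
cut, and a contour integral in the variable \<open>ln (1 + 1 / y)\<close> identifies its moments with the coefficients.

The derivative of \<open>F\<close> is a positive multiple of the Laplace transform of \<open>t * exp (- t) * D(t)\<close>, so
\<open>F\<close> is a Bernstein function exactly when \<open>Dser a c\<close> is nonnegative on \<open>[0, \<infinity>)\<close> (lemma
\<open>bernstein_iff_Dser_nonneg\<close>). The problem becomes one about the first parameter \<open>a\<close> at which
\<open>Dser a c\<close> fails to be nonnegative.

The decisive point is the sign of the parameter derivatives at a zero. Taking the logarithmic
derivative of \<open>F\<close> in \<open>y\<close>, in \<open>a\<close> and in \<open>c\<close> produces three convolution identities,
\<open>t D = M - M * D\<close>, \<open>\<partial>\<^sub>a D = K - K * D\<close> and \<open>\<partial>\<^sub>c D = L - L * D\<close>, with explicit kernels, positive on \<open>(0, \<infinity>)\<close>, for which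
both \<open>M / K\<close> and \<open>M / L\<close> are strictly increasing. If \<open>D \<ge> 0\<close> on \<open>[0, t]\<close> and \<open>D(t) = 0\<close>, the first identity says
that \<open>M(t)\<close> is the integral of \<open>M(t - u) D(u)\<close>; as \<open>K(t - u) / K(t) > M(t - u) / M(t)\<close> for
\<open>0 < u < t\<close>, the integral of \<open>K(t - u) D(u)\<close> exceeds \<open>K(t)\<close>, that is, \<open>\<partial>\<^sub>a D(t) < 0\<close>; the same argument
with \<open>L\<close> gives \<open>\<partial>\<^sub>c D(t) < 0\<close> (lemma \<open>contact_inequality\<close>).

Consequently, once \<open>Dser a c\<close> is negative somewhere on \<open>[0, t]\<close> it stays so for every larger \<open>a\<close> (lemma
\<open>Dser_negative_persists\<close>), and a contact point makes it negative for every larger \<open>a\<close>. So a nonnegative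
\<open>D a c\<close> with a positive zero forces \<open>a = A b\<close>. Conversely, nonnegativity passes to the supremum \<open>A b\<close> by
continuity, and without a zero there it would survive a small increase of \<open>a\<close>: on bounded intervals by
compactness, near infinity because \<open>w\<close> is positive near \<open>s = 0\<close>, which is where the
dominant exponential comes from (lemma \<open>Dser_eventually_positive\<close>). Finally, a zero of infinite order
is excluded by Taylor's formula, since \<open>D\<close> is entire of exponential type and \<open>D(0) > 0\<close>, and the order is even because \<open>D\<close> does
not change sign.\<close>

section \<open>Exponential generating functions\<close>

text \<open>The power series with these coefficients converges in the open unit disc. The corresponding
exponential generating function is then entire and \<open>O(exp (r * t))\<close> for every \<open>r > 1\<close>, so that its Laplace
transform exists on all of \<open>(1, \<infinity>)\<close>.\<close>

definition tame :: "(nat \<Rightarrow> real) \<Rightarrow> bool" where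
  "tame f \<longleftrightarrow> (\<forall>r. 0 < r \<and> r < 1 \<longrightarrow> summable (\<lambda>n. \<bar>f n\<bar> * r ^ n))"

definition egf :: "(nat \<Rightarrow> real) \<Rightarrow> real \<Rightarrow> real" where
  "egf f t = (\<Sum>n. f n / fact n * t ^ n)"

lemma tame_mono:
  assumes "tame g" "\<And>n. \<bar>f n\<bar> \<le> g n"
  shows "tame f"
  unfolding tame_def
proof (intro allI impI)
  fix r :: real assume r: "0 < r \<and> r < 1"
  have "summable (\<lambda>n. \<bar>g n\<bar> * r ^ n)" using assms(1) r by (auto simp: tame_def)
  then show "summable (\<lambda>n. \<bar>f n\<bar> * r ^ n)"
  proof (rule summable_comparison_test'[where N = 0])
    fix n show "norm (\<bar>f n\<bar> * r ^ n) \<le> \<bar>g n\<bar> * r ^ n"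
      using assms(2)[of n] r by (simp add: abs_mult mult_right_mono)
  qed
qed

lemma tame_bound:
  assumes "tame f"
  obtains C where "C \<ge> 0" "\<And>n. \<bar>f n\<bar> \<le> C * 2 ^ n"
proof -
  have s: "summable (\<lambda>n. \<bar>f n\<bar> * (1/2) ^ n)"
    using assms[unfolded tame_def, rule_format, of "1/2"] by simp
  define C where "C = (\<Sum>n. \<bar>f n\<bar> * (1/2) ^ n)"
  have "\<bar>f n\<bar> * (1/2) ^ n \<le> C" for n
    using sum_le_suminf[OF s, of "{n}"] by (simp add: C_def)
  then have "\<bar>f n\<bar> \<le> C * 2 ^ n" for n
    by (simp add: power_divide field_simps)
  moreover have "C \<ge> 0" unfolding C_def by (rule suminf_nonneg[OF s]) simp
  ultimately show thesis using that by blast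
qed

lemma egf_summable_abs:
  assumes "tame f"
  shows "summable (\<lambda>n. \<bar>f n / fact n * t ^ n\<bar>)"
proof -
  obtain C where C: "C \<ge> 0" "\<And>n. \<bar>f n\<bar> \<le> C * 2 ^ n" using tame_bound[OF assms] by blast
  have "summable (\<lambda>n. C * (inverse (fact n) * (2 * \<bar>t\<bar>) ^ n))"
    by (intro summable_mult summable_exp)
  then show ?thesis
  proof (rule summable_comparison_test'[where N = 0])
    fix n
    have "\<bar>f n\<bar> * \<bar>t\<bar> ^ n / fact n \<le> C * 2 ^ n * \<bar>t\<bar> ^ n / fact n"
      using C by (intro divide_right_mono mult_right_mono) auto
    then show "norm \<bar>f n / fact n * t ^ n\<bar> \<le> C * (inverse (fact n) * (2 * \<bar>t\<bar>) ^ n)"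
      by (simp add: abs_mult power_abs power_mult_distrib divide_simps mult_ac)
  qed
qed

lemma egf_summable: "tame f \<Longrightarrow> summable (\<lambda>n. f n / fact n * t ^ n)"
  using egf_summable_abs[of f t] by (rule summable_rabs_cancel)

lemma egf_sums: "tame f \<Longrightarrow> (\<lambda>n. f n / fact n * t ^ n) sums egf f t"
  unfolding egf_def using egf_summable by (rule summable_sums)

text \<open>The constant \<open>2\<close> is one admissible growth rate; any number above \<open>1\<close> would do. The bound is applied to shifted
coefficient sequences, which turns it into a bound on all derivatives.\<close>

lemma egf_bound:
  assumes "\<And>n. \<bar>f n\<bar> \<le> C * 2 ^ n" "tame f"
  shows "\<bar>egf f t\<bar> \<le> C * exp (2 * \<bar>t\<bar>)"
proof -
  have s: "(\<lambda>n. C * (inverse (fact n) * (2 * \<bar>t\<bar>) ^ n)) sums (C * exp (2 * \<bar>t\<bar>))"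
    by (intro sums_mult exp_converges[where 'a=real, simplified scaleR_conv_of_real, simplified])
  have b: "\<bar>f n / fact n * t ^ n\<bar> \<le> C * (inverse (fact n) * (2 * \<bar>t\<bar>) ^ n)" for n
  proof -
    have "\<bar>f n\<bar> * \<bar>t\<bar> ^ n / fact n \<le> C * 2 ^ n * \<bar>t\<bar> ^ n / fact n"
      using assms(1) by (intro divide_right_mono mult_right_mono) auto
    then show ?thesis
      by (simp add: abs_mult power_abs power_mult_distrib divide_simps mult_ac)
  qed
  have "\<bar>egf f t\<bar> \<le> (\<Sum>n. \<bar>f n / fact n * t ^ n\<bar>)"
    unfolding egf_def by (rule summable_rabs[OF egf_summable_abs[OF assms(2)]])
  also have "\<dots> \<le> C * exp (2 * \<bar>t\<bar>)"
    using suminf_le[OF b egf_summable_abs[OF assms(2)] sums_summable[OF s]] sums_unique[OF s] by simp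
  finally show ?thesis .
qed

lemma tame_summable_signed: "tame f \<Longrightarrow> \<bar>r\<bar> < 1 \<Longrightarrow> summable (\<lambda>n. f n * r ^ n)"
proof -
  assume f: "tame f" and r: "\<bar>r\<bar> < 1"
  define s where "s = (\<bar>r\<bar> + 1) / 2"
  have s: "0 < s" "s < 1" "\<bar>r\<bar> < s" using r by (auto simp: s_def)
  have "summable (\<lambda>n. \<bar>f n\<bar> * s ^ n)" using f s by (auto simp: tame_def)
  then show "summable (\<lambda>n. f n * r ^ n)"
  proof (rule summable_comparison_test'[where N = 0])
    fix n show "norm (f n * r ^ n) \<le> \<bar>f n\<bar> * s ^ n"
      using s by (auto simp: abs_mult power_abs intro!: mult_left_mono power_mono)
  qed
qed

lemma tame_diffs:
  assumes "tame f"
  shows "tame (\<lambda>n. real (Suc n) * f (Suc n))"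
  unfolding tame_def
proof (intro allI impI)
  fix r :: real assume r: "0 < r \<and> r < 1"
  have "summable (\<lambda>n. diffs (\<lambda>n. \<bar>f n\<bar>) n * r ^ n)"
  proof (rule termdiff_converges[where K = 1])
    fix x :: real assume "norm x < 1"
    then show "summable (\<lambda>n. \<bar>f n\<bar> * x ^ n)"
      by (intro tame_summable_signed[where f="\<lambda>n. \<bar>f n\<bar>"]) (use assms in \<open>auto simp: tame_def\<close>)
  qed (use r in auto)
  then show "summable (\<lambda>n. \<bar>real (Suc n) * f (Suc n)\<bar> * r ^ n)"
    by (simp add: diffs_def abs_mult)
qed

lemma tame_Suc: "tame f \<Longrightarrow> tame (\<lambda>n. f (Suc n))"
proof -
  assume "tame f"
  then have "tame (\<lambda>n. \<bar>real (Suc n) * f (Suc n)\<bar>)" using tame_diffs by (auto simp: tame_def)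
  then show ?thesis
  proof (rule tame_mono)
    fix n show "\<bar>f (Suc n)\<bar> \<le> \<bar>real (Suc n) * f (Suc n)\<bar>"
      using mult_right_mono[of 1 "1 + real n" "\<bar>f (Suc n)\<bar>"] by (simp add: abs_mult)
  qed
qed

lemma tame_shift: "tame f \<Longrightarrow> tame (\<lambda>n. f (n + k))"
  by (induction k) (auto dest: tame_Suc)

lemma tame_index_mult:
  assumes "tame f"
  shows "tame (\<lambda>n. real n * f (n - 1))"
  unfolding tame_def
proof (intro allI impI)
  fix r :: real assume r: "0 < r \<and> r < 1"
  have "tame (\<lambda>n. f (n - 1))"
    unfolding tame_def
  proof (intro allI impI)
    fix r :: real assume r: "0 < r \<and> r < 1"
    have "summable (\<lambda>n. r * (\<bar>f n\<bar> * r ^ n))"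
      using assms r by (intro summable_mult) (auto simp: tame_def)
    then have "summable (\<lambda>n. \<bar>f (Suc n - 1)\<bar> * r ^ Suc n)" by (simp add: mult_ac)
    then show "summable (\<lambda>n. \<bar>f (n - 1)\<bar> * r ^ n)"
      by (subst summable_Suc_iff[symmetric])
  qed
  then have "tame (\<lambda>n. real (Suc n) * f (Suc n - 1))" by (rule tame_diffs)
  then have "summable (\<lambda>n. r * (\<bar>real (Suc n) * f (Suc n - 1)\<bar> * r ^ n))"
    using r by (intro summable_mult) (auto simp: tame_def)
  then have "summable (\<lambda>n. \<bar>real (Suc n) * f (Suc n - 1)\<bar> * r ^ Suc n)" by (simp add: mult_ac)
  then show "summable (\<lambda>n. \<bar>real n * f (n - 1)\<bar> * r ^ n)"
    by (subst summable_Suc_iff[symmetric])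
qed

lemma egf_has_derivative:
  assumes "tame f"
  shows "(egf f has_real_derivative egf (\<lambda>n. f (Suc n)) t) (at t)"
proof -
  have "((\<lambda>x. \<Sum>n. f n / fact n * x ^ n) has_field_derivative
         (\<Sum>n. diffs (\<lambda>n. f n / fact n) n * t ^ n)) (at t)"
    by (rule termdiffs_strong_converges_everywhere) (rule egf_summable[OF assms])
  moreover have "diffs (\<lambda>n. f n / fact n) = (\<lambda>n. f (Suc n) / fact n)"
    by (auto simp: diffs_def fun_eq_iff field_simps simp del: of_nat_Suc)
  ultimately show ?thesis unfolding egf_def[abs_def] by simp
qed

lemma egf_continuous: "tame f \<Longrightarrow> continuous_on S (egf f)"
  using egf_has_derivative by (meson DERIV_isCont continuous_at_imp_continuous_on)

lemma egf_index_mult: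
  assumes "tame f"
  shows "egf (\<lambda>n. real n * f (n - 1)) t = t * egf f t"
proof -
  have "(\<lambda>n. t * (f n / fact n * t ^ n)) sums (t * egf f t)"
    by (intro sums_mult egf_sums assms)
  then have "(\<lambda>n. real (Suc n) * f (Suc n - 1) / fact (Suc n) * t ^ Suc n) sums (t * egf f t)"
    by (simp add: field_simps del: of_nat_Suc)
  then have "(\<lambda>n. real n * f (n - 1) / fact n * t ^ n) sums (t * egf f t)"
    by (subst (asm) sums_Suc_iff) simp
  then show ?thesis by (simp only: egf_def sums_iff)
qed

lemma egf_0 [simp]: "egf f 0 = f 0"
  unfolding egf_def using powser_zero[of "\<lambda>n. f n / fact n"] by simp

text \<open>Under the Borel transform the monomial \<open>t ^ i / fact i\<close> stands for \<open>\<zeta> ^ (i + 1)\<close>, so this Beta integral says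
that convolution on \<open>[0, t]\<close> corresponds to multiplication.\<close>

lemma beta_integral:
  fixes t :: real
  assumes "t \<ge> 0"
  shows "((\<lambda>u. (t - u) ^ i / fact i * (u ^ j / fact j)) has_integral t ^ (i + j + 1) / fact (i + j + 1)) {0..t}"
proof (induction i arbitrary: j)
  case 0
  have "((\<lambda>u. u ^ j / fact j) has_integral (t ^ Suc j / fact (Suc j) - 0 ^ Suc j / fact (Suc j))) {0..t}"
  proof (rule fundamental_theorem_of_calculus[OF assms])
    fix x
    have "((\<lambda>u. u ^ Suc j / fact (Suc j)) has_real_derivative x ^ j / fact j) (at x within {0..t})"
      by (rule derivative_eq_intros refl | simp add: field_simps del: power_Suc of_nat_Suc)+
    then show "((\<lambda>u. u ^ Suc j / fact (Suc j)) has_vector_derivative x ^ j / fact j) (at x within {0..t})"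
      by (simp only: has_real_derivative_iff_has_vector_derivative)
  qed
  then show ?case by simp
next
  case (Suc i)
  have "((\<lambda>u. (t - u) ^ Suc i / fact (Suc i) * (u ^ j / fact j)
          - (t - u) ^ i / fact i * (u ^ Suc j / fact (Suc j))) has_integral
     ((t - t) ^ Suc i / fact (Suc i) * (t ^ Suc j / fact (Suc j))
      - (t - 0) ^ Suc i / fact (Suc i) * (0 ^ Suc j / fact (Suc j)))) {0..t}"
  proof (rule fundamental_theorem_of_calculus[OF assms])
    fix x
    have "((\<lambda>u. (t - u) ^ Suc i / fact (Suc i) * (u ^ Suc j / fact (Suc j))) has_real_derivative
        (t - x) ^ Suc i / fact (Suc i) * (x ^ j / fact j)
          - (t - x) ^ i / fact i * (x ^ Suc j / fact (Suc j))) (at x within {0..t})"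
      by (rule derivative_eq_intros refl | simp add: field_simps del: power_Suc of_nat_Suc)+
    then show "((\<lambda>u. (t - u) ^ Suc i / fact (Suc i) * (u ^ Suc j / fact (Suc j))) has_vector_derivative
        (t - x) ^ Suc i / fact (Suc i) * (x ^ j / fact j)
          - (t - x) ^ i / fact i * (x ^ Suc j / fact (Suc j))) (at x within {0..t})"
      by (simp only: has_real_derivative_iff_has_vector_derivative)
  qed
  from has_integral_add[OF this Suc.IH[of "Suc j"]] show ?case
    by simp
qed

text \<open>The coefficients of \<open>\<zeta> * f(\<zeta>) * g(\<zeta>)\<close>: the extra factor comes from \<open>(i + 1) + (j + 1) = (i + j + 1) + 1\<close>.\<close>

definition conv :: "(nat \<Rightarrow> real) \<Rightarrow> (nat \<Rightarrow> real) \<Rightarrow> nat \<Rightarrow> real" where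
  "conv f g n = (case n of 0 \<Rightarrow> 0 | Suc m \<Rightarrow> \<Sum>i\<le>m. f i * g (m - i))"

text \<open>The Cauchy product of the two series is integrated term by term; the binomial theorem bounds the
\<open>n\<close>-th term by \<open>C * (2 * t) ^ n / fact n\<close> uniformly on \<open>[0, t]\<close>.\<close>

lemma egf_convolution:
  assumes "tame f" "tame g" "t \<ge> 0"
  shows "((\<lambda>u. egf f (t - u) * egf g u) has_integral egf (conv f g) t) {0..t}"
proof -
  obtain C where C: "C \<ge> 0" "\<And>n. \<bar>f n\<bar> \<le> C * 2 ^ n" using tame_bound[OF assms(1)] by blast
  obtain C' where C': "C' \<ge> 0" "\<And>n. \<bar>g n\<bar> \<le> C' * 2 ^ n" using tame_bound[OF assms(2)] by blast
  define T where "T n u = (\<Sum>i\<le>n. f i / fact i * (t - u) ^ i * (g (n - i) / fact (n - i) * u ^ (n - i)))" for n u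
  define I where "I n = (\<Sum>i\<le>n. f i * g (n - i)) * t ^ Suc n / fact (Suc n)" for n
  have Tsums: "(\<lambda>n. T n u) sums (egf f (t - u) * egf g u)" for u
    unfolding T_def egf_def
    by (rule Cauchy_product_sums) (use assms egf_summable_abs in auto)
  have Tint: "(T n has_integral I n) {0..t}" for n
  proof -
    have "((\<lambda>u. \<Sum>i\<le>n. (f i * g (n - i)) * ((t - u) ^ i / fact i * (u ^ (n - i) / fact (n - i)))) has_integral
        (\<Sum>i\<le>n. (f i * g (n - i)) * (t ^ (i + (n - i) + 1) / fact (i + (n - i) + 1)))) {0..t}"
      by (intro has_integral_sum has_integral_mult_right beta_integral assms) auto
    moreover have "(\<Sum>i\<le>n. (f i * g (n - i)) * (t ^ (i + (n - i) + 1) / fact (i + (n - i) + 1))) = I n"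
      by (simp add: I_def sum_distrib_right sum_divide_distrib)
    moreover have "(\<lambda>u. \<Sum>i\<le>n. (f i * g (n - i)) * ((t - u) ^ i / fact i * (u ^ (n - i) / fact (n - i)))) = T n"
      unfolding T_def by (auto simp: fun_eq_iff intro!: sum.cong)
    ultimately show ?thesis by simp
  qed
  have Tbound: "\<bar>T n u\<bar> \<le> C * C' * (inverse (fact n) * (2 * t) ^ n)" if u: "u \<in> {0..t}" for n u
  proof -
    have "\<bar>T n u\<bar> \<le> (\<Sum>i\<le>n. \<bar>f i\<bar> / fact i * (t - u) ^ i * (\<bar>g (n - i)\<bar> / fact (n - i) * u ^ (n - i)))"
      unfolding T_def using u
      by (intro order.trans[OF sum_abs]) (auto simp: abs_mult)
    also have "\<dots> \<le> (\<Sum>i\<le>n. (C * 2 ^ i) / fact i * (t - u) ^ i * (C' * 2 ^ (n - i) / fact (n - i) * u ^ (n - i)))"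
      using u C C' by (intro sum_mono mult_mono divide_right_mono) auto
    also have "\<dots> = (\<Sum>i\<le>n. C * C' * 2 ^ n / fact n * (of_nat (n choose i) * (t - u) ^ i * u ^ (n - i)))"
    proof (rule sum.cong[OF refl])
      fix i assume "i \<in> {..n}"
      then have i: "i \<le> n" by simp
      then have "(2::real) ^ n = 2 ^ i * 2 ^ (n - i)" by (simp flip: power_add)
      then show "(C * 2 ^ i) / fact i * (t - u) ^ i * (C' * 2 ^ (n - i) / fact (n - i) * u ^ (n - i))
        = C * C' * 2 ^ n / fact n * (of_nat (n choose i) * (t - u) ^ i * u ^ (n - i))"
        using i by (simp add: binomial_fact field_simps)
    qed
    also have "\<dots> = C * C' * 2 ^ n / fact n * ((t - u) + u) ^ n"
      by (subst binomial_ring) (simp add: sum_distrib_left)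
    also have "\<dots> = C * C' * (inverse (fact n) * (2 * t) ^ n)"
      by (simp add: power_mult_distrib field_simps)
    finally show ?thesis .
  qed
  have "uniform_limit {0..t} (\<lambda>N u. \<Sum>n<N. T n u) (\<lambda>u. \<Sum>n. T n u) sequentially"
  proof (rule Weierstrass_m_test)
    show "summable (\<lambda>n. C * C' * (inverse (fact n) * (2 * t) ^ n))"
      by (intro summable_mult summable_exp)
  qed (use Tbound in auto)
  then have ul: "uniform_limit {0..t} (\<lambda>N u. \<Sum>n<N. T n u) (\<lambda>u. egf f (t - u) * egf g u) sequentially"
    using Tsums by (simp add: sums_iff)
  have ci: "continuous_on {0..t} (\<lambda>u. \<Sum>n<N. T n u)" for N
    unfolding T_def by (intro continuous_intros)
  obtain I' J where IJ: "\<And>N. ((\<lambda>u. \<Sum>n<N. T n u) has_integral I' N) {0..t}"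
    "((\<lambda>u. egf f (t - u) * egf g u) has_integral J) {0..t}" "(I' \<longlongrightarrow> J) sequentially"
    by (rule uniform_limit_integral[OF ul ci]) auto
  have "I' N = (\<Sum>n<N. I n)" for N
    using has_integral_unique[OF IJ(1)[of N] has_integral_sum[of "{..<N}" T I]] Tint by simp
  then have "I' = (\<lambda>N. \<Sum>n<N. I n)" by (rule ext)
  then have IsJ: "I sums J" using IJ(3) by (simp add: sums_def)
  then have "(\<lambda>n. conv f g (Suc n) / fact (Suc n) * t ^ Suc n) sums J"
    by (simp add: I_def[abs_def] conv_def)
  then have "(\<lambda>n. conv f g n / fact n * t ^ n) sums J"
    by (subst (asm) sums_Suc_iff) (simp add: conv_def)
  then have "egf (conv f g) t = J" by (simp only: egf_def sums_iff)
  then show ?thesis using IJ(2) by simp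
qed

text \<open>The quotient of two series increases with the argument when the quotient of their coefficients
increases with the index: symmetrising the double sum for \<open>f(t) g(v) - f(v) g(t)\<close> in \<open>i\<close> and \<open>j\<close>
leaves products \<open>(f\<^sub>i g\<^sub>j - f\<^sub>j g\<^sub>i) (t^i v^j - t^j v^i)\<close> of factors of equal sign. Strictness comes from the pair
\<open>(1, 0)\<close> alone.\<close>

lemma egf_ratio_strict_mono:
  assumes f: "tame f" and g: "tame g"
    and ratio: "\<And>i j. j \<le> i \<Longrightarrow> f j * g i \<le> f i * g j"
    and strict: "f 0 * g 1 < f 1 * g 0"
    and v: "0 \<le> v" "v < t"
  shows "egf f v * egf g t < egf f t * egf g v"
proof -
  define S where "S f N x = (\<Sum>n<N. f n / fact n * x ^ n)" for f :: "nat \<Rightarrow> real" and N x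
  define c where "c = (f 1 * g 0 - f 0 * g 1) * (t - v)"
  \<comment> \<open>The bound by the fixed positive number c has to be obtained for the partial sums, since strictness would be lost in the limit.\<close>
  have key: "c \<le> S f N t * S g N v - S f N v * S g N t" if N: "N \<ge> 2" for N
  proof -
    define h where "h i j = (f i * g j - f j * g i) * (t ^ i * v ^ j) / (fact i * fact j)" for i j
    define k where "k i j = (f i * g j - f j * g i) * (t ^ i * v ^ j - t ^ j * v ^ i) / (fact i * fact j)" for i j
    have e1: "S f N t * S g N v - S f N v * S g N t = (\<Sum>i<N. \<Sum>j<N. h i j)"
    proof -
      have "S f N v * S g N t = S g N t * S f N v" by simp
      then show ?thesis
        unfolding S_def sum_product h_def
        by (simp add: sum_subtractf[symmetric] field_simps)
    qed
    have e2: "(\<Sum>i<N. \<Sum>j<N. h i j) = (\<Sum>i<N. \<Sum>j<N. h j i)"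
      by (rule sum.swap)
    have e3: "h i j + h j i = k i j" for i j
      unfolding h_def k_def by (simp add: field_simps)
    have e4: "2 * (S f N t * S g N v - S f N v * S g N t) = (\<Sum>i<N. \<Sum>j<N. k i j)"
      using e1 e2 by (simp add: e3[symmetric] sum.distrib)
    have sgn: "t ^ j * v ^ i \<le> t ^ i * v ^ j" if "j \<le> i" for i j :: nat
    proof -
      have "v ^ (i - j) \<le> t ^ (i - j)" using v by (intro power_mono) auto
      then have "t ^ j * v ^ j * v ^ (i - j) \<le> t ^ j * v ^ j * t ^ (i - j)"
        using v by (intro mult_left_mono) auto
      moreover have "t ^ i = t ^ j * t ^ (i - j)" "v ^ i = v ^ j * v ^ (i - j)"
        using that by (simp_all flip: power_add)
      ultimately show ?thesis by (simp add: mult_ac)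
    qed
    have kpos: "k i j \<ge> 0" for i j
    proof (cases "j \<le> i")
      case True
      then show ?thesis unfolding k_def using ratio[OF True] sgn[OF True]
        by (intro divide_nonneg_pos mult_nonneg_nonneg) (auto simp: mult_ac)
    next
      case False
      then have le: "i \<le> j" by simp
      then show ?thesis unfolding k_def using ratio[OF le] sgn[OF le]
        by (intro divide_nonneg_pos mult_nonpos_nonpos) (auto simp: mult_ac)
    qed
    have "{(1,0),(0,1)} \<subseteq> {..<N} \<times> {..<N}" using N by auto
    then have "(\<Sum>(i,j)\<in>{(1,0),(0,1)}. k i j) \<le> (\<Sum>(i,j)\<in>{..<N} \<times> {..<N}. k i j)"
      using kpos by (intro sum_mono2) auto
    then have "k 1 0 + k 0 1 \<le> (\<Sum>i<N. \<Sum>j<N. k i j)"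
      by (simp add: sum.cartesian_product)
    moreover have "k 1 0 + k 0 1 = 2 * c" unfolding k_def c_def by (simp add: algebra_simps)
    ultimately have "2 * c \<le> 2 * (S f N t * S g N v - S f N v * S g N t)"
      unfolding e4 by simp
    then show ?thesis by simp
  qed
  have "(\<lambda>N. S f N t * S g N v - S f N v * S g N t) \<longlonglongrightarrow> egf f t * egf g v - egf f v * egf g t"
    unfolding S_def using egf_sums[OF f] egf_sums[OF g] by (intro tendsto_intros) (auto simp: sums_def)
  then have "c \<le> egf f t * egf g v - egf f v * egf g t"
    by (rule LIMSEQ_le_const) (use key in auto)
  moreover have "c > 0" using strict v by (simp add: c_def)
  ultimately show ?thesis by simp
qed

lemma egf_pos:
  assumes "tame f" "\<And>n. f n \<ge> 0" "f 0 > 0" "t \<ge> 0"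
  shows "egf f t > 0"
proof -
  have "f 0 / fact 0 * t ^ 0 \<le> egf f t"
    unfolding egf_def using sum_le_suminf[OF egf_summable[OF assms(1)], of "{0}" t] assms by simp
  then show ?thesis using assms by simp
qed

section \<open>Dependence on a parameter and Laplace transforms\<close>

lemma egf_jointly_continuous:
  fixes f :: "'x::topological_space \<Rightarrow> nat \<Rightarrow> real"
  assumes cont: "\<And>n. continuous_on X (\<lambda>x. f x n)"
    and bound: "\<And>x n. x \<in> X \<Longrightarrow> \<bar>f x n\<bar> \<le> M n" and M: "tame M"
  shows "continuous_on (X \<times> {0..r}) (\<lambda>(x, t). egf (f x) t)"
proof (rule uniform_limit_theorem)
  show "uniform_limit (X \<times> {0..r}) (\<lambda>N p. \<Sum>n<N. f (fst p) n / fact n * snd p ^ n)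
     (\<lambda>(x, t). egf (f x) t) sequentially"
    unfolding egf_def case_prod_beta
  proof (rule Weierstrass_m_test)
    show "summable (\<lambda>n. \<bar>M n / fact n * r ^ n\<bar>)" by (rule egf_summable_abs[OF M])
    fix n and p assume p: "p \<in> X \<times> {0..r}"
    then have b: "\<bar>f (fst p) n\<bar> \<le> M n" using bound by auto
    then have "0 \<le> M n" by linarith
    then show "norm (f (fst p) n / fact n * snd p ^ n) \<le> \<bar>M n / fact n * r ^ n\<bar>"
      using p b by (auto simp: abs_mult power_abs intro!: mult_mono divide_right_mono power_mono)
  qed
  show "\<forall>\<^sub>F N in sequentially. continuous_on (X \<times> {0..r}) (\<lambda>p. \<Sum>n<N. f (fst p) n / fact n * snd p ^ n)"
    by (intro always_eventually allI continuous_intros continuous_on_compose2[OF cont]) auto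
qed simp

lemma egf_parameter_derivative:
  fixes f :: "real \<Rightarrow> nat \<Rightarrow> real"
  assumes X: "convex X" "x \<in> X"
    and der: "\<And>n x. x \<in> X \<Longrightarrow> ((\<lambda>x. f x n) has_real_derivative f' x n) (at x within X)"
    and bound: "\<And>x n. x \<in> X \<Longrightarrow> \<bar>f x n\<bar> \<le> M n" 
    and bound': "\<And>x n. x \<in> X \<Longrightarrow> \<bar>f' x n\<bar> \<le> M n" and M: "tame M"
  shows "((\<lambda>x. egf (f x) t) has_real_derivative egf (f' x) t) (at x within X)"
proof -
  have s: "summable (\<lambda>n. \<bar>M n / fact n * t ^ n\<bar>)" by (rule egf_summable_abs[OF M])
  have ul: "uniform_limit X (\<lambda>N x. \<Sum>n<N. f' x n / fact n * t ^ n) (\<lambda>x. egf (f' x) t) sequentially"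
    unfolding egf_def
  proof (rule Weierstrass_m_test[OF _ s])
    fix n x assume "x \<in> X"
    from bound'[OF this, of n] have "\<bar>f' x n\<bar> \<le> \<bar>M n\<bar>" by linarith
    then show "norm (f' x n / fact n * t ^ n) \<le> \<bar>M n / fact n * t ^ n\<bar>"
      by (auto simp: abs_mult power_abs intro!: mult_mono divide_right_mono)
  qed
  have "tame (f x)" using bound[OF X(2)] M tame_mono by blast
  have "\<exists>g. \<forall>x\<in>X. (\<lambda>n. f x n / fact n * t ^ n) sums g x \<and> (g has_real_derivative egf (f' x) t) (at x within X)"
    using ul \<open>convex X\<close> \<open>x \<in> X\<close> egf_summable[OF \<open>tame (f x)\<close>]
    by (intro has_field_derivative_series[where f'="\<lambda>n x. f' x n / fact n * t ^ n"])
      (auto intro!: derivative_eq_intros der)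
  then obtain g where g: "\<And>x. x \<in> X \<Longrightarrow> (\<lambda>n. f x n / fact n * t ^ n) sums g x"
    "\<And>x. x \<in> X \<Longrightarrow> (g has_real_derivative egf (f' x) t) (at x within X)" by blast
  have "egf (f x) t = g x" if "x \<in> X" for x using g(1)[OF that] by (simp add: egf_def sums_iff)
  then show ?thesis
    using has_field_derivative_transform_within[OF g(2)[OF X(2)] zero_less_one X(2), of "\<lambda>x. egf (f x) t"]
    by simp
qed

text \<open>The Laplace transform of \<open>egf d\<close>, written as a series in \<open>1 / z\<close>.\<close>

definition borel_sum :: "(nat \<Rightarrow> real) \<Rightarrow> real \<Rightarrow> real" where
  "borel_sum d z = (\<Sum>n. d n * (1 / z) ^ Suc n)"

lemma borel_sum_summable:
  assumes "tame d" "z > 1"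
  shows "summable (\<lambda>n. \<bar>d n\<bar> * (1 / z) ^ Suc n)" "summable (\<lambda>n. d n * (1 / z) ^ Suc n)"
proof -
  have "summable (\<lambda>n. (1 / z) * (\<bar>d n\<bar> * (1 / z) ^ n))"
    using assms by (intro summable_mult) (auto simp: tame_def)
  then show *: "summable (\<lambda>n. \<bar>d n\<bar> * (1 / z) ^ Suc n)" by (simp add: mult_ac)
  show "summable (\<lambda>n. d n * (1 / z) ^ Suc n)"
    using * by (rule summable_comparison_test'[where N=0]) (use assms in \<open>simp add: abs_mult\<close>)
qed

text \<open>Differentiating the Laplace transform multiplies the original by \<open>- t\<close>, which on coefficients is
\<open>d \<mapsto> (n * d\<^sub>n\<^sub>-\<^sub>1)\<^sub>n\<close> (compare \<open>egf_index_mult\<close>).\<close>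

lemma borel_sum_has_derivative:
  assumes d: "tame d" and z: "z > 1"
  shows "(borel_sum d has_real_derivative - borel_sum (\<lambda>n. real n * d (n - 1)) z) (at z)"
proof -
  \<comment> \<open>The sum is an ordinary power series in 1 / z once the coefficients are shifted by one.\<close>
  define e where "e n = (case n of 0 \<Rightarrow> 0 | Suc m \<Rightarrow> d m)" for n
  have es: "(\<lambda>n. e n * (1 / z) ^ n) sums borel_sum d z" if "z > 1" for z
  proof -
    have "(\<lambda>n. e (Suc n) * (1 / z) ^ Suc n) sums borel_sum d z"
      unfolding borel_sum_def e_def using borel_sum_summable(2)[OF d that] by (simp add: summable_sums)
    then show ?thesis by (subst (asm) sums_Suc_iff) (simp add: e_def)
  qed
  have te: "tame e"
    unfolding tame_def
  proof (intro allI impI)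
    fix r :: real assume r: "0 < r \<and> r < 1"
    have "summable (\<lambda>n. \<bar>e (Suc n)\<bar> * r ^ Suc n)"
      using borel_sum_summable(1)[OF d, of "1 / r"] r by (simp add: e_def)
    then show "summable (\<lambda>n. \<bar>e n\<bar> * r ^ n)" by (subst summable_Suc_iff[symmetric])
  qed
  have "((\<lambda>x. \<Sum>n. e n * x ^ n) has_real_derivative (\<Sum>n. diffs e n * (1 / z) ^ n)) (at (1 / z))"
    by (rule termdiffs_strong'[where K = 1]) (use te z tame_summable_signed in auto)
  moreover have "((\<lambda>z. 1 / z) has_real_derivative - (1 / z)\<^sup>2) (at z)"
    using z by (auto intro!: derivative_eq_intros simp: field_simps power2_eq_square)
  ultimately have "((\<lambda>z. \<Sum>n. e n * (1 / z) ^ n) has_real_derivative 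
      (\<Sum>n. diffs e n * (1 / z) ^ n) * (- (1 / z)\<^sup>2)) (at z)"
    by (rule DERIV_chain2)
  then have *: "(borel_sum d has_real_derivative 
      (\<Sum>n. diffs e n * (1 / z) ^ n) * (- (1 / z)\<^sup>2)) (at z)"
    by (rule has_field_derivative_transform_within_open[where S = "{1<..}"])
      (use z es in \<open>auto simp: sums_iff\<close>)
  have "(\<lambda>n. diffs e n * (1 / z) ^ n) sums (\<Sum>n. diffs e n * (1 / z) ^ n)"
    by (intro summable_sums termdiff_converges[where K = 1]) (use te z tame_summable_signed in auto)
  then have "(\<lambda>n. (1/z)\<^sup>2 * (diffs e n * (1 / z) ^ n)) sums ((1/z)\<^sup>2 * (\<Sum>n. diffs e n * (1 / z) ^ n))"
    by (rule sums_mult)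
  then have "(\<lambda>n. real (Suc n) * d (Suc n - 1) * (1 / z) ^ Suc (Suc n)) sums ((1/z)\<^sup>2 * (\<Sum>n. diffs e n * (1 / z) ^ n))"
    by (simp add: diffs_def e_def power2_eq_square mult_ac)
  then have "(\<lambda>n. real n * d (n - 1) * (1 / z) ^ Suc n) sums ((1/z)\<^sup>2 * (\<Sum>n. diffs e n * (1 / z) ^ n))"
    by (subst (asm) sums_Suc_iff) simp
  then have "borel_sum (\<lambda>n. real n * d (n - 1)) z = (1/z)\<^sup>2 * (\<Sum>n. diffs e n * (1 / z) ^ n)"
    by (simp add: borel_sum_def sums_iff)
  then show ?thesis using * by (simp add: mult_ac)
qed

lemma monomial_laplace:
  fixes z :: real
  assumes z: "z > 0"
  shows "has_bochner_integral lborel (\<lambda>t. indicator {0..} t * (t ^ n / fact n * exp (- z * t))) ((1 / z) ^ Suc n)"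
proof -
  \<comment> \<open>The antiderivative that repeated partial integration produces.\<close>
  define G where "G n t = - exp (- z * t) * (\<Sum>k\<le>n. t ^ k / fact k * (1 / z) ^ (Suc n - k))" for n and t :: real
  have der: "(G n has_real_derivative t ^ n / fact n * exp (- z * t)) (at t)" for n t
  proof (induction n)
    case 0
    show ?case unfolding G_def using z by (auto intro!: derivative_eq_intros simp: field_simps)
  next
    case (Suc n)
    have e: "G (Suc n) = (\<lambda>t. G n t * (1 / z) - exp (- z * t) * (t ^ Suc n / fact (Suc n) * (1 / z)))"
    proof
      fix t
      have "(\<Sum>k\<le>n. t ^ k / fact k * (1 / z) ^ (Suc (Suc n) - k)) = (\<Sum>k\<le>n. t ^ k / fact k * (1 / z) ^ (Suc n - k)) * (1 / z)"
        unfolding sum_distrib_right by (intro sum.cong refl) (simp add: Suc_diff_le)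
      then show "G (Suc n) t = G n t * (1 / z) - exp (- z * t) * (t ^ Suc n / fact (Suc n) * (1 / z))"
        unfolding G_def by (simp add: algebra_simps)
    qed
    have d2: "((\<lambda>t. t ^ Suc n / fact (Suc n)) has_real_derivative t ^ n / fact n) (at t)"
      by (rule derivative_eq_intros refl | simp add: field_simps del: power_Suc of_nat_Suc)+
    have d3: "((\<lambda>t. exp (- z * t)) has_real_derivative - z * exp (- z * t)) (at t)"
      by (auto intro!: derivative_eq_intros)
    show ?case unfolding e
      by (rule DERIV_cong[OF DERIV_diff[OF DERIV_mult[OF Suc DERIV_const] DERIV_mult[OF d3 DERIV_mult[OF d2 DERIV_const]]]])
        (use z in \<open>simp add: field_simps del: power_Suc fact_Suc\<close>)
  qed
  have lim: "(G n \<longlongrightarrow> 0) at_top"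
  proof -
    have "((\<lambda>t. - (\<Sum>k\<le>n. (t ^ k * exp (- z * t)) / fact k * (1 / z) ^ (Suc n - k))) \<longlongrightarrow>
       - (\<Sum>k\<le>n. 0 / fact k * (1 / z) ^ (Suc n - k))) at_top"
    proof (intro tendsto_intros)
      fix k :: nat
      have "((\<lambda>t. (z * t) ^ k / exp (z * t)) \<longlongrightarrow> 0) at_top"
        by (rule filterlim_compose[OF tendsto_power_div_exp_0])
          (use z in \<open>simp add: filterlim_tendsto_pos_mult_at_top[OF tendsto_const] filterlim_ident\<close>)
      then have "((\<lambda>t. (1 / z) ^ k * ((z * t) ^ k / exp (z * t))) \<longlongrightarrow> (1 / z) ^ k * 0) at_top"
        by (intro tendsto_intros)
      then show "((\<lambda>t. t ^ k * exp (- z * t)) \<longlongrightarrow> 0) at_top"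
        using z by (simp add: power_mult_distrib exp_minus field_simps)
    qed auto
    then show ?thesis unfolding G_def by (simp add: sum_distrib_left sum_negf mult_ac)
  qed
  have "(\<integral>\<^sup>+t. ennreal (t ^ n / fact n * exp (- z * t)) * indicator {0..} t \<partial>lborel) = ennreal (0 - G n 0)"
    by (rule nn_integral_FTC_atLeast[where F = "G n"]) (use der lim in auto)
  also have "0 - G n 0 = (1 / z) ^ Suc n"
  proof -
    have "(\<Sum>k\<le>n. 0 ^ k / fact k * (1 / z) ^ (Suc n - k)) = (\<Sum>k\<in>{0}. 0 ^ k / fact k * (1 / z) ^ (Suc n - k))"
      by (rule sum.mono_neutral_right) auto
    then show ?thesis by (simp add: G_def)
  qed
  finally have "(\<integral>\<^sup>+t. ennreal (indicator {0..} t * (t ^ n / fact n * exp (- z * t))) \<partial>lborel) = ennreal ((1 / z) ^ Suc n)"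
    by (metis (no_types, lifting) ennreal_indicator ennreal_mult' indicator_pos_le mult.commute nn_integral_cong)
  then show ?thesis
    by (intro has_bochner_integral_nn_integral) (use z in \<open>auto split: split_indicator\<close>)
qed

lemma laplace_egf:
  assumes d: "tame d" and z: "z > 1"
  shows "has_bochner_integral lborel (\<lambda>t. indicator {0..} t * (exp (- z * t) * egf d t)) (borel_sum d z)"
proof -
  define f where "f n t = indicator {0..} t * (d n * (t ^ n / fact n * exp (- z * t)))" for n and t :: real
  have m: "has_bochner_integral lborel (\<lambda>t. indicator {0..} t * (t ^ n / fact n * exp (- z * t))) ((1 / z) ^ Suc n)" for n
    using monomial_laplace z by simp
  have hf: "has_bochner_integral lborel (f n) (d n * (1 / z) ^ Suc n)" for n
    using has_bochner_integral_mult_right[OF m, of "d n" n] unfolding f_def by (simp add: mult_ac)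
  have hn: "has_bochner_integral lborel (\<lambda>t. norm (f n t)) (\<bar>d n\<bar> * (1 / z) ^ Suc n)" for n
  proof -
    have "(\<lambda>t. norm (f n t)) = (\<lambda>t. \<bar>d n\<bar> * (indicator {0..} t * (t ^ n / fact n * exp (- z * t))))"
      unfolding f_def by (auto simp: fun_eq_iff abs_mult split: split_indicator)
    then show ?thesis using has_bochner_integral_mult_right[OF m, of "\<bar>d n\<bar>" n] by simp
  qed
  have fs: "(\<lambda>n. f n t) sums (indicator {0..} t * (exp (- z * t) * egf d t))" for t
  proof -
    have "(\<lambda>n. indicator {0..} t * exp (- z * t) * (d n / fact n * t ^ n)) sums (indicator {0..} t * exp (- z * t) * egf d t)"
      by (intro sums_mult egf_sums d)
    then show ?thesis unfolding f_def by (simp add: mult_ac)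
  qed
  have abs: "summable (\<lambda>n. norm (f n t))" for t
  proof -
    have "summable (\<lambda>n. indicator {0..} t * exp (- z * t) * \<bar>d n / fact n * t ^ n\<bar>)"
      by (intro summable_mult egf_summable_abs d)
    then show ?thesis unfolding f_def by (simp add: abs_mult mult_ac)
  qed
  have A1: "\<And>n. integrable lborel (f n)" using hf has_bochner_integral_iff by blast
  have A2: "AE t in lborel. summable (\<lambda>n. norm (f n t))" using abs by simp
  have A3: "summable (\<lambda>n. LINT t|lborel. norm (f n t))"
    using borel_sum_summable(1)[OF d z] hn by (simp add: has_bochner_integral_iff)
  have eq: "(\<Sum>n. f n t) = indicator {0..} t * (exp (- z * t) * egf d t)" for t
    using fs by (simp add: sums_iff)
  have "integrable lborel (\<lambda>t. \<Sum>n. f n t)" by (rule integrable_suminf[OF A1 A2 A3])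
  moreover have "(LINT t|lborel. (\<Sum>n. f n t)) = borel_sum d z"
    using integral_suminf[OF A1 A2 A3] hf by (simp add: borel_sum_def has_bochner_integral_iff)
  ultimately show ?thesis by (simp add: has_bochner_integral_iff eq)
qed

section \<open>The coefficients of the exponential of a power series\<close>

text \<open>The coefficients of \<open>H = exp (- (\<Sum>k. q k * \<zeta> ^ (k + 1) / (k + 1)))\<close>, computed from the differential
equation \<open>H' = - q H\<close>. The recursion exhibits them as polynomials in the \<open>q k\<close>.\<close>

fun exp_coeff :: "(nat \<Rightarrow> real) \<Rightarrow> nat \<Rightarrow> real" where
  "exp_coeff q 0 = 1"
| "exp_coeff q (Suc n) = - (\<Sum>k\<le>n. q k * exp_coeff q (n - k)) / real (Suc n)"

lemma binomial_le_power: "real ((n + N) choose N) \<le> real (Suc n) ^ N"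
proof (induction N)
  case (Suc N)
  have "real (Suc N) * real ((n + Suc N) choose Suc N) = real (n + Suc N) * real ((n + N) choose N)"
    by (metis Suc_times_binomial_eq add_Suc_right mult.commute of_nat_mult)
  also have "\<dots> \<le> (real (Suc N) * real (Suc n)) * real (Suc n) ^ N"
    using Suc by (intro mult_mono) (auto simp: algebra_simps)
  finally have "real (Suc N) * real ((n + Suc N) choose Suc N) \<le> real (Suc N) * real (Suc n) ^ Suc N"
    by (simp only: power_Suc mult_ac)
  then show ?case by (simp del: of_nat_Suc power_Suc binomial_Suc_Suc)
qed simp

text \<open>The right-hand side is the coefficient of \<open>(1 - \<zeta>) powr (- (N + 1))\<close>, hence of radius of convergence one. Comparison
with the constant sequence \<open>q = N\<close> gives \<open>(1 - \<zeta>) powr (- N)\<close>; the larger exponent makes the induction close with one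
application of the hockey-stick identity.\<close>

lemma exp_coeff_bound:
  assumes q: "\<And>k. \<bar>q k\<bar> \<le> real N"
  shows "\<bar>exp_coeff q n\<bar> \<le> real ((n + N) choose N)"
proof (induction n rule: less_induct)
  case (less n)
  show ?case
  proof (cases n)
    case (Suc m)
    have hockey: "(\<Sum>k\<le>m. ((m - k) + N) choose N) = (m + N + 1) choose (N + 1)"
    proof -
      have "(\<Sum>k\<le>m. ((m - k) + N) choose N) = (\<Sum>k\<le>m. (k + N) choose N)"
        by (rule sum.reindex_bij_witness[of _ "\<lambda>k. m - k" "\<lambda>k. m - k"]) auto
      also have "\<dots> = (\<Sum>k\<le>m. (N + k) choose N)" by (simp add: add.commute)
      also have "\<dots> = (m + N + 1) choose (N + 1)"
        by (induction m) (auto simp: add.commute)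
      finally show ?thesis .
    qed
    have b: "\<bar>\<Sum>k\<le>m. q k * exp_coeff q (m - k)\<bar> \<le> real N * real ((m + N + 1) choose (N + 1))"
    proof -
      have "\<bar>\<Sum>k\<le>m. q k * exp_coeff q (m - k)\<bar> \<le> (\<Sum>k\<le>m. real N * real (((m - k) + N) choose N))"
      proof (intro order.trans[OF sum_abs] sum_mono)
        fix k assume "k \<in> {..m}"
        then have "m - k < n" using Suc by auto
        then show "\<bar>q k * exp_coeff q (m - k)\<bar> \<le> real N * real (((m - k) + N) choose N)"
          unfolding abs_mult by (intro mult_mono q less.IH) auto
      qed
      also have "\<dots> = real N * real (\<Sum>k\<le>m. ((m - k) + N) choose N)"
        by (simp add: sum_distrib_left)
      finally show ?thesis by (simp only: hockey)
    qed
    have absorb: "real (N + 1) * real ((m + N + 1) choose (N + 1)) = real (m + 1) * real ((m + 1 + N) choose N)"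
    proof -
      have "Suc N * ((m + N + 1) choose Suc N) = ((m + N + 1) - N) * ((m + N + 1) choose N)"
        using binomial_absorb_comp[of "m + N + 1" N] binomial_absorption[of N "m + N + 1"] by simp
      then have "(N + 1) * ((m + N + 1) choose (N + 1)) = (m + 1) * ((m + 1 + N) choose N)"
        by (simp add: add_ac)
      then show ?thesis by (metis of_nat_mult)
    qed
    have "real N * real ((m + N + 1) choose (N + 1)) \<le> real (m + 1) * real ((m + 1 + N) choose N)"
      unfolding absorb[symmetric] by (intro mult_right_mono) auto
    with b have "\<bar>\<Sum>k\<le>m. q k * exp_coeff q (m - k)\<bar> \<le> real (Suc m) * real ((Suc m + N) choose N)"
      by simp
    then have "\<bar>\<Sum>k\<le>m. q k * exp_coeff q (m - k)\<bar> / real (Suc m) \<le> real ((Suc m + N) choose N)"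
      by (subst pos_divide_le_eq) (simp_all add: mult.commute)
    then show ?thesis unfolding Suc exp_coeff.simps by simp
  qed simp
qed

lemma exp_coeff_power_bound:
  assumes q: "\<And>k. \<bar>q k\<bar> \<le> real N"
  shows "\<bar>exp_coeff q n\<bar> \<le> real (Suc n) ^ N"
  using exp_coeff_bound[OF q] binomial_le_power by (rule order.trans)

lemma tame_power: "tame (\<lambda>n. real (Suc n) ^ N)"
proof (induction N)
  case 0
  have "summable (\<lambda>n. r ^ n)" if "0 < r \<and> r < 1" for r :: real
    using that by (intro summable_geometric) auto
  then show ?case by (simp add: tame_def)
next
  case (Suc N)
  have "tame (\<lambda>n. real (Suc n) * real (Suc (Suc n - 1)) ^ N)"
    using tame_Suc[OF tame_index_mult[OF Suc]] .
  then show ?case by simp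
qed

text \<open>Along a path with \<open>\<partial>\<^sub>s q\<^sub>k = (k + 1) \<kappa>\<^sub>k\<close> the series \<open>H\<close> satisfies \<open>\<partial>\<^sub>s H = - \<zeta> \<kappa> H\<close>. The claimed derivative is the
coefficient of that product; it obeys the differentiated recursion because
\<open>q (\<zeta> \<kappa> H) = \<zeta> \<kappa> (q H) = - \<zeta> \<kappa> H'\<close>, an identity that is read off from formal power series.\<close>

lemma exp_coeff_derivative:
  fixes q :: "real \<Rightarrow> nat \<Rightarrow> real" and \<kappa> :: "nat \<Rightarrow> real"
  assumes q: "\<And>k. ((\<lambda>s. q s k) has_real_derivative real (Suc k) * \<kappa> k) (at s within X)"
  shows "((\<lambda>s. exp_coeff (q s) n) has_real_derivative
           (case n of 0 \<Rightarrow> 0 | Suc m \<Rightarrow> - (\<Sum>k\<le>m. \<kappa> k * exp_coeff (q s) (m - k)))) (at s within X)"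
proof (induction n rule: less_induct)
  case (less n)
  define H where "H = Abs_fps (exp_coeff (q s))"
  define Q where "Q = Abs_fps (q s)"
  define K where "K = Abs_fps \<kappa>"
  define h' where "h' n = (case n of 0 \<Rightarrow> 0 | Suc m \<Rightarrow> - (\<Sum>k\<le>m. \<kappa> k * exp_coeff (q s) (m - k)))" for n
  have ode: "fps_deriv H = - (Q * H)"
  proof (rule fps_ext)
    fix n
    show "fps_nth (fps_deriv H) n = fps_nth (- (Q * H)) n"
      by (simp add: H_def Q_def fps_mult_nth atLeast0AtMost field_simps del: of_nat_Suc)
  qed
  have h': "h' n = fps_nth (- (fps_X * (K * H))) n" for n
  proof (cases n)
    case (Suc m)
    have "fps_nth (- (fps_X * (K * H))) (Suc m) = - fps_nth (K * H) m" by simp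
    then show ?thesis by (simp add: Suc h'_def K_def H_def fps_mult_nth[of "Abs_fps _"] atLeast0AtMost)
  qed (simp add: h'_def)
  show ?case
  proof (cases n)
    case 0
    then show ?thesis by simp
  next
    case (Suc m)
    have IH: "((\<lambda>s. exp_coeff (q s) (m - k)) has_real_derivative h' (m - k)) (at s within X)" for k
      unfolding h'_def by (rule less.IH) (use Suc in auto)
    have "((\<lambda>s. \<Sum>k\<le>m. q s k * exp_coeff (q s) (m - k)) has_real_derivative
        (\<Sum>k\<le>m. real (Suc k) * \<kappa> k * exp_coeff (q s) (m - k) + h' (m - k) * q s k)) (at s within X)"
      by (intro DERIV_sum DERIV_mult q IH)
    then have d: "((\<lambda>s. exp_coeff (q s) n) has_real_derivative
        - (\<Sum>k\<le>m. real (Suc k) * \<kappa> k * exp_coeff (q s) (m - k) + h' (m - k) * q s k) / real (Suc m)) (at s within X)"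
      unfolding Suc exp_coeff.simps by (intro DERIV_minus DERIV_cdivide)
    have "(\<Sum>k\<le>m. h' (m - k) * q s k) = fps_nth (Q * (- (fps_X * (K * H)))) m"
      by (subst fps_mult_nth) (simp add: Q_def h' atLeast0AtMost mult.commute)
    also have "Q * (- (fps_X * (K * H))) = K * (fps_X * fps_deriv H)"
      unfolding ode by (simp add: algebra_simps)
    also have "fps_nth \<dots> m = (\<Sum>k\<le>m. \<kappa> k * (real (m - k) * exp_coeff (q s) (m - k)))"
    proof -
      have "fps_nth (fps_X * fps_deriv H) j = real j * exp_coeff (q s) j" for j
        by (cases j) (simp_all add: H_def)
      then show ?thesis unfolding fps_mult_nth[of K] by (simp only: K_def atLeast0AtMost fps_nth_Abs_fps)
    qed
    finally have e: "(\<Sum>k\<le>m. h' (m - k) * q s k) = (\<Sum>k\<le>m. \<kappa> k * (real (m - k) * exp_coeff (q s) (m - k)))" .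
    have "(\<Sum>k\<le>m. real (Suc k) * \<kappa> k * exp_coeff (q s) (m - k) + h' (m - k) * q s k)
      = (\<Sum>k\<le>m. real (Suc k) * \<kappa> k * exp_coeff (q s) (m - k) + \<kappa> k * (real (m - k) * exp_coeff (q s) (m - k)))"
      unfolding sum.distrib e ..
    also have "\<dots> = (\<Sum>k\<le>m. real (Suc m) * (\<kappa> k * exp_coeff (q s) (m - k)))"
    proof (rule sum.cong[OF refl])
      fix k assume "k \<in> {..m}"
      then have "real (m - k) = real m - real k" by (simp add: of_nat_diff)
      then show "real (Suc k) * \<kappa> k * exp_coeff (q s) (m - k) + \<kappa> k * (real (m - k) * exp_coeff (q s) (m - k))
        = real (Suc m) * (\<kappa> k * exp_coeff (q s) (m - k))"
        by (simp add: algebra_simps)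
    qed
    also have "\<dots> = real (Suc m) * (\<Sum>k\<le>m. \<kappa> k * exp_coeff (q s) (m - k))"
      by (simp add: sum_distrib_left)
    finally show ?thesis using d by (simp add: Suc del: exp_coeff.simps of_nat_Suc)
  qed
qed

section \<open>The entire function attached to F\<close>

text \<open>In the variable \<open>\<zeta> = 1 / (1 + y)\<close> the derivative of \<open>a - ln (F a (- c) (a * y))\<close> is the power series with these
coefficients.\<close>

definition log_coeff :: "real \<Rightarrow> real \<Rightarrow> nat \<Rightarrow> real" where
  "log_coeff a c k = a / real (k + 2) + c"

text \<open>The Borel transform of \<open>1 - exp (- a) * F a (- c) (a * y)\<close>: the constant term of the exponential is dropped, and the
coefficient of \<open>\<zeta> ^ (n + 1)\<close> becomes that of \<open>t ^ n / fact n\<close>. This is the entire continuation of \<open>D\<close> to all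
parameters; the parameters beyond \<open>a + c < 3\<close> are needed because \<open>A b\<close> is a supremum over all \<open>a > 0\<close>.\<close>

definition dcoeff :: "real \<Rightarrow> real \<Rightarrow> nat \<Rightarrow> real" where
  "dcoeff a c n = - exp_coeff (log_coeff a c) (Suc n)"

definition Dser :: "real \<Rightarrow> real \<Rightarrow> real \<Rightarrow> real" where
  "Dser a c = egf (dcoeff a c)"

lemma log_coeff_bound: "\<bar>log_coeff a c k\<bar> \<le> \<bar>a\<bar> + \<bar>c\<bar>"
proof -
  have "\<bar>a\<bar> / real (k + 2) \<le> \<bar>a\<bar>" by (simp add: divide_le_eq mult_left_le algebra_simps)
  moreover have "\<bar>log_coeff a c k\<bar> \<le> \<bar>a\<bar> / real (k + 2) + \<bar>c\<bar>"
    unfolding log_coeff_def by (rule order.trans[OF abs_triangle_ineq]) simp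
  ultimately show ?thesis by linarith
qed

lemma dcoeff_bound:
  assumes "\<bar>a\<bar> + \<bar>c\<bar> \<le> real N"
  shows "\<bar>dcoeff a c n\<bar> \<le> real (Suc (Suc n)) ^ N"
  unfolding dcoeff_def abs_minus_cancel
  by (rule exp_coeff_power_bound) (use log_coeff_bound[of a c] assms in \<open>meson order_trans\<close>)

lemma tame_dcoeff: "tame (dcoeff a c)"
proof -
  obtain N where "\<bar>a\<bar> + \<bar>c\<bar> \<le> real N" using real_arch_simple by blast
  from dcoeff_bound[OF this] tame_Suc[OF tame_power[of N]] show ?thesis by (rule tame_mono[rotated])
qed

lemma tame_bounded: "(\<And>n. \<bar>f n\<bar> \<le> B) \<Longrightarrow> tame f"
proof -
  assume b: "\<And>n. \<bar>f n\<bar> \<le> B"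
  obtain N where N: "B \<le> real N" using real_arch_simple by blast
  have "tame (\<lambda>n. real N * real (Suc n) ^ 0)"
    unfolding tame_def 
  proof (intro allI impI)
    fix r :: real assume "0 < r \<and> r < 1"
    then show "summable (\<lambda>n. \<bar>real N * real (Suc n) ^ 0\<bar> * r ^ n)"
      by (auto intro!: summable_mult summable_geometric)
  qed
  then show ?thesis by (rule tame_mono) (use b N order_trans in auto)
qed

lemma conv_dcoeff:
  "conv g (dcoeff a c) n = g n - (\<Sum>k\<le>n. g k * exp_coeff (log_coeff a c) (n - k))"
proof (cases n)
  case 0
  then show ?thesis by (simp add: conv_def)
next
  case (Suc m)
  have "(\<Sum>k\<le>m. g k * dcoeff a c (m - k)) = - (\<Sum>k\<le>m. g k * exp_coeff (log_coeff a c) (n - k))"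
    unfolding sum_negf[symmetric] dcoeff_def by (intro sum.cong refl) (auto simp: Suc Suc_diff_le)
  then show ?thesis by (simp add: conv_def Suc)
qed

lemma tame_conv:
  assumes "tame f" "tame g"
  shows "tame (conv f g)"
  unfolding tame_def
proof (intro allI impI)
  fix r :: real assume r: "0 < r \<and> r < 1"
  have "summable (\<lambda>n. \<Sum>i\<le>n. (\<bar>f i\<bar> * r ^ i) * (\<bar>g (n - i)\<bar> * r ^ (n - i)))"
    by (rule summable_Cauchy_product) (use assms r in \<open>auto simp: tame_def abs_mult\<close>)
  then have "summable (\<lambda>n. r * (\<Sum>i\<le>n. (\<bar>f i\<bar> * r ^ i) * (\<bar>g (n - i)\<bar> * r ^ (n - i))))"
    by (rule summable_mult)
  then have "summable (\<lambda>n. \<bar>conv f g (Suc n)\<bar> * r ^ Suc n)"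
  proof (rule summable_comparison_test'[where N = 0])
    fix n
    have "\<bar>conv f g (Suc n)\<bar> * r ^ n \<le> (\<Sum>i\<le>n. \<bar>f i\<bar> * \<bar>g (n - i)\<bar>) * r ^ n"
      unfolding conv_def using r
      by (intro mult_right_mono) (auto simp: abs_mult intro!: order.trans[OF sum_abs])
    also have "\<dots> = (\<Sum>i\<le>n. (\<bar>f i\<bar> * r ^ i) * (\<bar>g (n - i)\<bar> * r ^ (n - i)))"
      unfolding sum_distrib_right
    proof (rule sum.cong[OF refl])
      fix i assume "i \<in> {..n}"
      then have "r ^ n = r ^ i * r ^ (n - i)" by (simp flip: power_add)
      then show "\<bar>f i\<bar> * \<bar>g (n - i)\<bar> * r ^ n = (\<bar>f i\<bar> * r ^ i) * (\<bar>g (n - i)\<bar> * r ^ (n - i))" by simp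
    qed
    finally show "norm (\<bar>conv f g (Suc n)\<bar> * r ^ Suc n) \<le> r * (\<Sum>i\<le>n. (\<bar>f i\<bar> * r ^ i) * (\<bar>g (n - i)\<bar> * r ^ (n - i)))"
      using r by (simp add: abs_mult mult.assoc mult_left_mono mult.left_commute)
  qed
  then show "summable (\<lambda>n. \<bar>conv f g n\<bar> * r ^ n)" by (subst summable_Suc_iff[symmetric])
qed

lemma egf_diff: "tame f \<Longrightarrow> tame g \<Longrightarrow> egf (\<lambda>n. f n - g n) t = egf f t - egf g t"
proof -
  assume "tame f" "tame g"
  then have "(\<lambda>n. f n / fact n * t ^ n - g n / fact n * t ^ n) sums (egf f t - egf g t)"
    by (intro sums_diff egf_sums)
  then have "(\<lambda>n. (f n - g n) / fact n * t ^ n) sums (egf f t - egf g t)"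
    by (simp add: left_diff_distrib diff_divide_distrib)
  then show ?thesis by (simp only: egf_def sums_iff)
qed

lemma has_integral_conv_Dser:
  assumes "tame g" "t \<ge> 0"
  shows "((\<lambda>u. egf g (t - u) * Dser a c u) has_integral egf (conv g (dcoeff a c)) t) {0..t}"
  unfolding Dser_def by (rule egf_convolution) (use assms tame_dcoeff in auto)

text \<open>The kernel \<open>M\<close> of the convolution identity \<open>t D = M - M * D\<close>, which expresses the logarithmic derivative of \<open>F\<close> in
the Laplace variable; explicitly \<open>M(t) = a * (exp t - 1 - t) / t + c * (exp t - 1)\<close>.\<close>

definition vcoeff :: "real \<Rightarrow> real \<Rightarrow> nat \<Rightarrow> real" where
  "vcoeff a c n = (case n of 0 \<Rightarrow> 0 | Suc k \<Rightarrow> log_coeff a c k)"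

lemma tame_vcoeff: "tame (vcoeff a c)"
  by (rule tame_bounded[where B = "\<bar>a\<bar> + \<bar>c\<bar>"])
    (auto simp: vcoeff_def log_coeff_bound split: nat.split)

text \<open>On coefficients this is exactly the recursion defining \<open>exp_coeff\<close>.\<close>

lemma Dser_volterra:
  assumes "t \<ge> 0"
  shows "((\<lambda>u. egf (vcoeff a c) (t - u) * Dser a c u) has_integral egf (vcoeff a c) t - t * Dser a c t) {0..t}"
proof -
  have "conv (vcoeff a c) (dcoeff a c) n = vcoeff a c n - real n * dcoeff a c (n - 1)" for n
  proof (cases n)
    case 0
    then show ?thesis by (simp add: conv_def vcoeff_def)
  next
    case (Suc m)
    have "(\<Sum>k\<le>Suc m. vcoeff a c k * exp_coeff (log_coeff a c) (Suc m - k)) 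
      = (\<Sum>k\<le>m. log_coeff a c k * exp_coeff (log_coeff a c) (m - k))"
      by (subst sum.atMost_Suc_shift) (simp add: vcoeff_def)
    also have "\<dots> = real (Suc m) * dcoeff a c m"
      unfolding dcoeff_def by simp
    finally show ?thesis unfolding conv_dcoeff by (simp add: Suc)
  qed
  then have "conv (vcoeff a c) (dcoeff a c) = (\<lambda>n. vcoeff a c n - real n * dcoeff a c (n - 1))"
    by (rule ext)
  then have "egf (conv (vcoeff a c) (dcoeff a c)) t = egf (vcoeff a c) t - t * Dser a c t"
    by (simp only: egf_diff[OF tame_vcoeff tame_index_mult[OF tame_dcoeff]] egf_index_mult[OF tame_dcoeff] Dser_def)
  then show ?thesis using has_integral_conv_Dser[OF tame_vcoeff assms, of a c a c] by simp
qed

text \<open>With \<open>M\<close> the kernel of \<open>Dser_volterra\<close>, at a zero \<open>t\<close> one has \<open>M(t) = (M * D)(t)\<close>. Since \<open>M / g\<close> is strictly increasing,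
\<open>M(t) g(t - u) - g(t) M(t - u)\<close> is positive for \<open>0 < u < t\<close>; integrating it against \<open>D \<ge> 0\<close>, which is positive near
\<open>0\<close>, gives \<open>M(t) * ((g * D)(t) - g(t)) > 0\<close>.\<close>

lemma contact_inequality:
  assumes ac: "a > 0" "c \<ge> 0" and t: "t > 0"
    and nonneg: "\<And>u. 0 \<le> u \<Longrightarrow> u \<le> t \<Longrightarrow> Dser a c u \<ge> 0" and zero: "Dser a c t = 0"
    and g: "tame g" "\<And>n. g n > 0"
    and ratio: "\<And>i j. j \<le> i \<Longrightarrow> vcoeff a c j * g i \<le> vcoeff a c i * g j"
  shows "egf g t < egf (conv g (dcoeff a c)) t"
proof -
  let ?m = "egf (vcoeff a c)" and ?g = "egf g" and ?D = "Dser a c"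
  have gpos: "?g v > 0" if "v \<ge> 0" for v using egf_pos[OF g(1)] g(2) that by (simp add: less_imp_le)
  have v0: "vcoeff a c 0 = 0" and v1: "vcoeff a c 1 > 0"
    using ac by (auto simp: vcoeff_def log_coeff_def add_pos_nonneg)
  have cross: "?m v * ?g t < ?m t * ?g v" if "0 \<le> v" "v < t" for v
    by (rule egf_ratio_strict_mono[OF tame_vcoeff g(1) ratio _ that]) (use v0 v1 g in auto)
  have mt: "?m t > 0"
    using cross[of 0] v0 gpos[of 0] t by (simp add: zero_less_mult_iff)
  define h where "h u = (?m t * ?g (t - u) - ?g t * ?m (t - u)) * ?D u" for u
  have h_int: "(h has_integral (?m t * egf (conv g (dcoeff a c)) t - ?g t * (?m t - t * ?D t))) {0..t}"
  proof -
    have "((\<lambda>u. ?m t * (?g (t - u) * ?D u) - ?g t * (?m (t - u) * ?D u)) has_integral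
        (?m t * egf (conv g (dcoeff a c)) t - ?g t * (?m t - t * ?D t))) {0..t}"
      using t by (intro has_integral_diff has_integral_mult_right Dser_volterra has_integral_conv_Dser g) auto
    then show ?thesis unfolding h_def by (simp add: algebra_simps)
  qed
  have h_nonneg: "h u \<ge> 0" if "u \<in> {0..t}" for u
  proof (cases "u = 0")
    case False
    then show ?thesis unfolding h_def using that nonneg[of u] cross[of "t - u"]
      by (intro mult_nonneg_nonneg) (auto simp: mult.commute)
  qed (simp add: h_def)
  have D0: "?D 0 > 0" unfolding Dser_def using ac
    by (simp add: dcoeff_def log_coeff_def add_pos_nonneg)
  have D_cont: "continuous_on UNIV ?D" unfolding Dser_def by (rule egf_continuous[OF tame_dcoeff])
  have "\<exists>s. 0 < s \<and> s < t \<and> ?D s > 0"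
  proof -
    have "isCont ?D 0" using D_cont by (simp add: continuous_on_eq_continuous_at)
    then have "(?D \<longlongrightarrow> ?D 0) (at_right 0)" unfolding isCont_def by (rule filterlim_at_split[THEN iffD1, THEN conjunct2])
    then have "\<forall>\<^sub>F s in at_right 0. ?D s > 0" using D0 by (rule order_tendstoD)
    moreover have "\<forall>\<^sub>F s in at_right 0. s \<in> {0<..<t}" using t by (rule eventually_at_right_real)
    ultimately have "\<forall>\<^sub>F s in at_right 0. 0 < s \<and> s < t \<and> ?D s > 0" by eventually_elim auto
    then show ?thesis by (rule eventually_happens'[rotated]) simp
  qed
  then obtain s where s: "0 < s" "s < t" "?D s > 0" by blast
  have hs: "h s > 0" unfolding h_def using s cross[of "t - s"] by (intro mult_pos_pos) (auto simp: mult.commute)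
  have h_cont: "continuous_on {0..t} h"
    unfolding h_def
    by (intro continuous_intros continuous_on_subset[OF D_cont] continuous_on_compose2[OF egf_continuous[OF g(1), of UNIV]]
        continuous_on_compose2[OF egf_continuous[OF tame_vcoeff, of UNIV]]) auto
  let ?I = "?m t * egf (conv g (dcoeff a c)) t - ?g t * (?m t - t * ?D t)"
  have "?I \<noteq> 0"
  proof
    assume "?I = 0"
    then have "h s = 0"
      using h_int has_integral_0_cbox_imp_0[of 0 t h s] h_cont h_nonneg s by (auto simp: box_real)
    then show False using hs by simp
  qed
  moreover have "?I \<ge> 0" using has_integral_nonneg[OF h_int] h_nonneg by auto
  ultimately have "0 < ?I" by simp
  then have "0 < ?m t * (egf (conv g (dcoeff a c)) t - ?g t)"
    using zero by (simp add: algebra_simps)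
  then show ?thesis using mt by (simp add: zero_less_mult_iff)
qed

section \<open>Derivatives in the parameters\<close>

text \<open>The coefficients of \<open>\<kappa> * H\<close>, that is, of \<open>\<kappa> - \<kappa> * D\<close> in the convolution sense (lemma \<open>egf_dcoeff_deriv\<close>); by
\<open>exp_coeff_derivative\<close> these are the parameter derivatives of \<open>dcoeff\<close>.\<close>

definition dcoeff_deriv :: "(nat \<Rightarrow> real) \<Rightarrow> real \<Rightarrow> real \<Rightarrow> nat \<Rightarrow> real" where
  "dcoeff_deriv \<kappa> a c n = (\<Sum>k\<le>n. \<kappa> k * exp_coeff (log_coeff a c) (n - k))"

lemma dcoeff_deriv_bound:
  assumes "\<bar>a\<bar> + \<bar>c\<bar> \<le> real N" and \<kappa>: "\<And>k. \<bar>\<kappa> k\<bar> \<le> 1"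
  shows "\<bar>dcoeff_deriv \<kappa> a c n\<bar> \<le> real (Suc n) ^ Suc N"
proof -
  have b: "\<bar>exp_coeff (log_coeff a c) m\<bar> \<le> real (Suc m) ^ N" for m
    by (rule exp_coeff_power_bound) (use log_coeff_bound[of a c] assms in \<open>meson order_trans\<close>)
  have "\<bar>dcoeff_deriv \<kappa> a c n\<bar> \<le> (\<Sum>k\<le>n. real (Suc n) ^ N)"
    unfolding dcoeff_deriv_def
  proof (intro order.trans[OF sum_abs] sum_mono)
    fix k assume "k \<in> {..n}"
    have "\<bar>\<kappa> k * exp_coeff (log_coeff a c) (n - k)\<bar> \<le> 1 * real (Suc (n - k)) ^ N"
      unfolding abs_mult by (intro mult_mono \<kappa> b) auto
    also have "\<dots> \<le> real (Suc n) ^ N" by (auto intro!: power_mono)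
    finally show "\<bar>\<kappa> k * exp_coeff (log_coeff a c) (n - k)\<bar> \<le> real (Suc n) ^ N" .
  qed
  then show ?thesis by simp
qed

text \<open>Stated along an arbitrary path in the parameter plane so that the derivatives in \<open>a\<close> and in \<open>c\<close> are both instances.\<close>

lemma Dser_has_derivative:
  fixes \<alpha> \<gamma> :: "real \<Rightarrow> real"
  assumes q: "\<And>s k. ((\<lambda>s. log_coeff (\<alpha> s) (\<gamma> s) k) has_real_derivative real (Suc k) * \<kappa> k) (at s)"
    and \<kappa>: "\<And>k. \<bar>\<kappa> k\<bar> \<le> 1"
    and cont: "continuous_on UNIV \<alpha>" "continuous_on UNIV \<gamma>"
  shows "((\<lambda>s. Dser (\<alpha> s) (\<gamma> s) t) has_real_derivative egf (dcoeff_deriv \<kappa> (\<alpha> s) (\<gamma> s)) t) (at s)"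
proof -
  let ?X = "{s - 1..s + 1}"
  have "compact ((\<lambda>s. \<bar>\<alpha> s\<bar> + \<bar>\<gamma> s\<bar>) ` ?X)"
    by (intro compact_continuous_image continuous_intros continuous_on_subset[OF cont(1)] continuous_on_subset[OF cont(2)]) auto
  then have "bounded ((\<lambda>s. \<bar>\<alpha> s\<bar> + \<bar>\<gamma> s\<bar>) ` ?X)" by (rule compact_imp_bounded)
  then obtain B where B: "\<And>x. x \<in> ?X \<Longrightarrow> \<bar>\<bar>\<alpha> x\<bar> + \<bar>\<gamma> x\<bar>\<bar> \<le> B"
    unfolding bounded_real by blast
  obtain N where "B \<le> real N" using real_arch_simple by blast
  with B have N: "\<bar>\<alpha> x\<bar> + \<bar>\<gamma> x\<bar> \<le> real N" if "x \<in> ?X" for x using B[OF that] by linarith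
  have "((\<lambda>s. egf (dcoeff (\<alpha> s) (\<gamma> s)) t) has_real_derivative egf (dcoeff_deriv \<kappa> (\<alpha> s) (\<gamma> s)) t) (at s within ?X)"
  proof (rule egf_parameter_derivative[where M = "\<lambda>n. real (Suc (Suc n)) ^ Suc N"])
    fix n x assume x: "x \<in> ?X"
    have "((\<lambda>s. exp_coeff (log_coeff (\<alpha> s) (\<gamma> s)) (Suc n)) has_real_derivative
           (case Suc n of 0 \<Rightarrow> 0 | Suc m \<Rightarrow> - (\<Sum>k\<le>m. \<kappa> k * exp_coeff (log_coeff (\<alpha> x) (\<gamma> x)) (m - k)))) (at x within ?X)"
      by (rule exp_coeff_derivative) (rule has_field_derivative_at_within[OF q])
    then show "((\<lambda>x. dcoeff (\<alpha> x) (\<gamma> x) n) has_real_derivative dcoeff_deriv \<kappa> (\<alpha> x) (\<gamma> x) n) (at x within ?X)"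
      unfolding dcoeff_def dcoeff_deriv_def using DERIV_minus by fastforce
    have "\<bar>dcoeff (\<alpha> x) (\<gamma> x) n\<bar> \<le> real (Suc (Suc n)) ^ N" by (rule dcoeff_bound[OF N[OF x]])
    also have "\<dots> \<le> real (Suc (Suc n)) ^ Suc N" by (rule power_increasing) auto
    finally show "\<bar>dcoeff (\<alpha> x) (\<gamma> x) n\<bar> \<le> real (Suc (Suc n)) ^ Suc N" .
    have "\<bar>dcoeff_deriv \<kappa> (\<alpha> x) (\<gamma> x) n\<bar> \<le> real (Suc n) ^ Suc N" by (rule dcoeff_deriv_bound[OF N[OF x] \<kappa>])
    also have "\<dots> \<le> real (Suc (Suc n)) ^ Suc N" by (rule power_mono) auto
    finally show "\<bar>dcoeff_deriv \<kappa> (\<alpha> x) (\<gamma> x) n\<bar> \<le> real (Suc (Suc n)) ^ Suc N" .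
  qed (use tame_Suc[OF tame_power[of "Suc N"]] in auto)
  moreover have "at s within ?X = at s" by (rule at_within_interior) (simp add: interior_atLeastAtMost_real)
  ultimately show ?thesis by (simp add: Dser_def)
qed

lemma egf_dcoeff_deriv:
  assumes "tame \<kappa>"
  shows "egf (dcoeff_deriv \<kappa> a c) t = egf \<kappa> t - egf (conv \<kappa> (dcoeff a c)) t"
proof -
  have "dcoeff_deriv \<kappa> a c = (\<lambda>n. \<kappa> n - conv \<kappa> (dcoeff a c) n)"
    by (auto simp: fun_eq_iff dcoeff_deriv_def conv_dcoeff)
  then show ?thesis by (simp add: egf_diff assms tame_conv tame_dcoeff)
qed

text \<open>The kernels of \<open>\<partial>\<^sub>a\<close> and \<open>\<partial>\<^sub>c\<close>: the transforms \<open>1 - y * ln (1 + 1 / y)\<close> and \<open>ln (1 + 1 / y)\<close>, expanded in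
\<open>\<zeta> = 1 / (1 + y)\<close>.\<close>

definition acoeff :: "nat \<Rightarrow> real" where "acoeff k = 1 / (real (Suc k) * real (k + 2))"
definition ccoeff :: "nat \<Rightarrow> real" where "ccoeff k = 1 / real (Suc k)"

lemma acoeff_bound: "\<bar>acoeff k\<bar> \<le> 1"
proof -
  have "1 * 1 \<le> real (Suc k) * real (k + 2)" by (rule mult_mono) auto
  then show ?thesis by (simp add: acoeff_def del: of_nat_Suc of_nat_add)
qed

lemma ccoeff_bound: "\<bar>ccoeff k\<bar> \<le> 1"
  by (simp add: ccoeff_def)

lemma Dser_deriv_a: "((\<lambda>a. Dser a c t) has_real_derivative egf (dcoeff_deriv acoeff a c) t) (at a)"
proof (rule Dser_has_derivative[where \<alpha> = "\<lambda>a. a" and \<gamma> = "\<lambda>_. c"])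
  show "((\<lambda>s. log_coeff s c k) has_real_derivative real (Suc k) * acoeff k) (at s)" for s k
    unfolding log_coeff_def acoeff_def by (auto intro!: derivative_eq_intros)
qed (auto simp: acoeff_bound)

lemma Dser_deriv_c: "((\<lambda>c. Dser a c t) has_real_derivative egf (dcoeff_deriv ccoeff a c) t) (at c)"
proof (rule Dser_has_derivative[where \<alpha> = "\<lambda>_. a" and \<gamma> = "\<lambda>c. c"])
  show "((\<lambda>s. log_coeff a s k) has_real_derivative real (Suc k) * ccoeff k) (at s)" for s k
    unfolding log_coeff_def ccoeff_def by (auto intro!: derivative_eq_intros)
qed (auto simp: ccoeff_bound)

lemma contact_deriv_a:
  assumes "a > 0" "c \<ge> 0" "t > 0"
    "\<And>u. 0 \<le> u \<Longrightarrow> u \<le> t \<Longrightarrow> Dser a c u \<ge> 0" "Dser a c t = 0"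
  shows "egf (dcoeff_deriv acoeff a c) t < 0"
proof -
  have g: "tame acoeff" by (rule tame_bounded[OF acoeff_bound])
  have "egf acoeff t < egf (conv acoeff (dcoeff a c)) t"
  proof (rule contact_inequality[OF assms g])
    show "acoeff n > 0" for n by (simp add: acoeff_def)
    fix i j :: nat assume ij: "j \<le> i"
    show "vcoeff a c j * acoeff i \<le> vcoeff a c i * acoeff j"
    proof (cases j)
      case 0
      then show ?thesis using assms(1,2) by (auto simp: vcoeff_def acoeff_def log_coeff_def split: nat.split)
    next
      case (Suc j')
      then obtain i' where i': "i = Suc i'" using ij by (cases i) auto
      \<comment> \<open>The quotient of the coefficients is visibly increasing in k.\<close>
      have e: "vcoeff a c (Suc k) / acoeff (Suc k) = a * (real k + 3) + c * ((real k + 2) * (real k + 3))" for k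
        unfolding vcoeff_def acoeff_def log_coeff_def by (simp add: field_simps)
      have "vcoeff a c j / acoeff j \<le> vcoeff a c i / acoeff i"
        unfolding Suc i' e using ij Suc i' assms(1,2) by (intro add_mono mult_left_mono mult_mono) auto
      then show ?thesis by (simp add: acoeff_def field_simps del: of_nat_Suc of_nat_add)
    qed
  qed
  then show ?thesis by (simp add: egf_dcoeff_deriv[OF g])
qed

lemma contact_deriv_c:
  assumes "a > 0" "c \<ge> 0" "t > 0"
    "\<And>u. 0 \<le> u \<Longrightarrow> u \<le> t \<Longrightarrow> Dser a c u \<ge> 0" "Dser a c t = 0"
  shows "egf (dcoeff_deriv ccoeff a c) t < 0"
proof -
  have g: "tame ccoeff" by (rule tame_bounded[OF ccoeff_bound])
  have "egf ccoeff t < egf (conv ccoeff (dcoeff a c)) t"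
  proof (rule contact_inequality[OF assms g])
    show "ccoeff n > 0" for n by (simp add: ccoeff_def)
    fix i j :: nat assume ij: "j \<le> i"
    show "vcoeff a c j * ccoeff i \<le> vcoeff a c i * ccoeff j"
    proof (cases j)
      case 0
      then show ?thesis using assms(1,2) by (auto simp: vcoeff_def ccoeff_def log_coeff_def split: nat.split)
    next
      case (Suc j')
      then obtain i' where i': "i = Suc i'" using ij by (cases i) auto
      have e: "vcoeff a c (Suc k) / ccoeff (Suc k) = a + c * (real k + 2)" for k
        unfolding vcoeff_def ccoeff_def log_coeff_def by (simp add: field_simps)
      have "vcoeff a c j / ccoeff j \<le> vcoeff a c i / ccoeff i"
        unfolding Suc i' e using ij Suc i' assms(1,2) by (intro add_mono mult_left_mono mult_mono) auto
      then show ?thesis by (simp add: ccoeff_def field_simps del: of_nat_Suc of_nat_add)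
    qed
  qed
  then show ?thesis by (simp add: egf_dcoeff_deriv[OF g])
qed

lemma exp_coeff_continuous_a: "continuous_on X (\<lambda>a. exp_coeff (log_coeff a c) n)"
proof (induction n rule: less_induct)
  case (less n)
  show ?case
  proof (cases n)
    case (Suc m)
    show ?thesis unfolding Suc exp_coeff.simps log_coeff_def[abs_def]
      by (intro continuous_intros less.IH[unfolded log_coeff_def[abs_def]]) (auto simp: Suc)
  qed simp
qed

lemma Dser_jointly_continuous:
  "continuous_on ({l..h} \<times> {0..r}) (\<lambda>(a, t). Dser a c t)" (is ?D)
  "continuous_on ({l..h} \<times> {0..r}) (\<lambda>(a, t). egf (dcoeff_deriv acoeff a c) t)" (is ?E)
proof -
  obtain N where N': "\<bar>l\<bar> + \<bar>h\<bar> + \<bar>c\<bar> \<le> real N" using real_arch_simple by blast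
  have N: "\<bar>a\<bar> + \<bar>c\<bar> \<le> real N" if "a \<in> {l..h}" for a using that N' by auto
  show ?D unfolding Dser_def
  proof (rule egf_jointly_continuous)
    show "continuous_on {l..h} (\<lambda>a. dcoeff a c n)" for n
      unfolding dcoeff_def by (intro continuous_intros exp_coeff_continuous_a)
    show "\<bar>dcoeff a c n\<bar> \<le> real (Suc (Suc n)) ^ N" if "a \<in> {l..h}" for a n
      by (rule dcoeff_bound[OF N[OF that]])
  qed (rule tame_Suc[OF tame_power])
  show ?E
  proof (rule egf_jointly_continuous)
    show "continuous_on {l..h} (\<lambda>a. dcoeff_deriv acoeff a c n)" for n
      unfolding dcoeff_deriv_def by (intro continuous_intros exp_coeff_continuous_a)
    show "\<bar>dcoeff_deriv acoeff a c n\<bar> \<le> real (Suc n) ^ Suc N" if "a \<in> {l..h}" for a n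
      by (rule dcoeff_deriv_bound[OF N[OF that] acoeff_bound])
  qed (rule tame_power)
qed

lemma Dser_0: "Dser a c 0 = q1 a c"
  by (simp add: Dser_def dcoeff_def log_coeff_def q1_def)

text \<open>Otherwise let \<open>m\<close> be the least parameter in \<open>[a0, a1]\<close> for which \<open>Dser m c\<close> is nonnegative on \<open>[0, t0]\<close>. For parameters
increasing to \<open>m\<close> there are points where the function is negative, and they accumulate at a zero \<open>T\<close> of \<open>Dser m c\<close>. The
derivative in \<open>a\<close> is negative near that contact point, so the function was even larger for the smaller
parameters, a contradiction. Working on the fixed interval \<open>[0, t0]\<close> keeps everything compact.\<close>

lemma Dser_negative_persists:
  assumes a: "0 < a0" "a0 \<le> a1" and c: "c \<ge> 0" and t0: "t0 \<ge> 0" and neg: "Dser a0 c t0 < 0"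
  shows "\<exists>t\<in>{0..t0}. Dser a1 c t < 0"
proof (rule ccontr)
  assume "\<not> ?thesis"
  then have a1: "\<And>t. t \<in> {0..t0} \<Longrightarrow> Dser a1 c t \<ge> 0" by (meson not_less)
  define Z where "Z = {a0..a1} \<inter> (\<Inter>t\<in>{0..t0}. {a. 0 \<le> Dser a c t})"
  have "closed {a. 0 \<le> Dser a c t}" for t
  proof (rule closed_Collect_le)
    show "continuous_on UNIV (\<lambda>a. Dser a c t)"
      by (rule continuous_at_imp_continuous_on) (blast intro: DERIV_isCont Dser_deriv_a)
  qed simp
  then have "compact Z" unfolding Z_def by (intro compact_Int_closed closed_INT) auto
  moreover have "a1 \<in> Z" using a a1 by (auto simp: Z_def)
  ultimately have "\<exists>m\<in>Z. \<forall>z\<in>Z. m \<le> z" by (intro compact_attains_inf) auto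
  then obtain m where m: "m \<in> Z" "\<And>z. z \<in> Z \<Longrightarrow> m \<le> z" by blast
  have mge: "Dser m c t \<ge> 0" if "t \<in> {0..t0}" for t using m that by (auto simp: Z_def)
  have "a0 \<noteq> m" using mge[of t0] neg t0 by auto
  then have m0: "a0 < m" using m(1) by (auto simp: Z_def)
  have m1: "m \<le> a1" using m by (auto simp: Z_def)
  \<comment> \<open>A sequence of parameters in [a0, m) tending to m; each of them lies outside Z because m is its minimum.\<close>
  define s where "s n = m - (m - a0) / real (Suc n)" for n
  have s: "a0 \<le> s n" "s n < m" for n
  proof -
    have "(m - a0) / real (Suc n) \<le> (m - a0) / 1" using m0 by (intro divide_left_mono) auto
    then show "a0 \<le> s n" by (simp add: s_def)
    show "s n < m" using m0 by (simp add: s_def)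
  qed
  have "\<exists>t\<in>{0..t0}. Dser (s n) c t < 0" for n
  proof -
    have "s n \<notin> Z" using m(2)[of "s n"] s[of n] by auto
    then show ?thesis using s[of n] m1 by (auto simp: Z_def not_le)
  qed
  then obtain \<tau> where \<tau>: "\<And>n. \<tau> n \<in> {0..t0}" "\<And>n. Dser (s n) c (\<tau> n) < 0" by metis
  obtain T r where T: "T \<in> {0..t0}" "strict_mono r" "(\<tau> \<circ> r) \<longlonglongrightarrow> T"
    using compact_Icc[of 0 t0] \<tau>(1) unfolding compact_def by metis
  have "s \<longlonglongrightarrow> m - 0"
    unfolding s_def by (intro tendsto_diff tendsto_const LIMSEQ_Suc[OF lim_const_over_n])
  then have sr: "(s \<circ> r) \<longlonglongrightarrow> m" using LIMSEQ_subseq_LIMSEQ T(2) by fastforce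
  let ?P = "\<lambda>n. ((s \<circ> r) n, (\<tau> \<circ> r) n)"
  have P: "?P \<longlonglongrightarrow> (m, T)" by (rule tendsto_Pair[OF sr T(3)])
  have Pin: "?P n \<in> {a0..a1} \<times> {0..t0}" for n using s[of "r n"] \<tau>(1)[of "r n"] m1 by auto
  have mT: "(m, T) \<in> {a0..a1} \<times> {0..t0}" using m0 m1 T by auto
  have "(\<lambda>n. (\<lambda>(a, t). Dser a c t) (?P n)) \<longlonglongrightarrow> (\<lambda>(a, t). Dser a c t) (m, T)"
    by (rule continuous_on_tendsto_compose[OF Dser_jointly_continuous(1) P mT]) (use Pin in auto)
  then have "Dser m c T \<le> 0"
    by (intro LIMSEQ_le_const2[of _ "Dser m c T" 0]) (use \<tau>(2) in \<open>auto intro!: exI[of _ 0] less_imp_le\<close>)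
  then have zero: "Dser m c T = 0" using mge[OF T(1)] by simp
  have "T \<noteq> 0" using zero a m0 c by (auto simp: Dser_0 q1_def)
  then have "egf (dcoeff_deriv acoeff m c) T < 0"
    using T(1) m0 a c zero mge by (intro contact_deriv_a) auto
  moreover have "\<forall>e>0. \<exists>d>0. \<forall>p\<in>{a0..a1} \<times> {0..t0}. dist p (m, T) < d \<longrightarrow>
     dist ((\<lambda>(a, t). egf (dcoeff_deriv acoeff a c) t) p) (egf (dcoeff_deriv acoeff m c) T) < e"
    using Dser_jointly_continuous(2)[of a0 a1 t0 c, unfolded continuous_on_iff, rule_format, OF mT] by auto
  ultimately have "\<exists>d>0. \<forall>p\<in>{a0..a1} \<times> {0..t0}. dist p (m, T) < d \<longrightarrow>
     dist ((\<lambda>(a, t). egf (dcoeff_deriv acoeff a c) t) p) (egf (dcoeff_deriv acoeff m c) T) < - egf (dcoeff_deriv acoeff m c) T"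
    by (meson neg_0_less_iff_less)
  then obtain d where d: "d > 0" "\<And>p. p \<in> {a0..a1} \<times> {0..t0} \<Longrightarrow> dist p (m, T) < d \<Longrightarrow>
     dist ((\<lambda>(a, t). egf (dcoeff_deriv acoeff a c) t) p) (egf (dcoeff_deriv acoeff m c) T) < - egf (dcoeff_deriv acoeff m c) T"
    by blast
  obtain n where n: "dist (?P n) (m, T) < d"
    using P d(1) unfolding lim_sequentially by blast
  define x y where "x = s (r n)" and "y = \<tau> (r n)"
  have xy: "a0 \<le> x" "x < m" "y \<in> {0..t0}" "Dser x c y < 0" "dist (x, y) (m, T) < d"
    using s \<tau> n by (auto simp: x_def y_def)
  obtain z where z: "x < z" "z < m" "Dser m c y - Dser x c y = (m - x) * egf (dcoeff_deriv acoeff z c) y"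
    using MVT2[OF xy(2), of "\<lambda>a. Dser a c y" "\<lambda>a. egf (dcoeff_deriv acoeff a c) y"] Dser_deriv_a by blast
  have "dist (z, y) (m, T) \<le> dist (x, y) (m, T)"
    unfolding dist_Pair_Pair using z by (intro real_sqrt_le_mono add_right_mono power_mono) (auto simp: dist_real_def)
  then have "dist (z, y) (m, T) < d" using xy by simp
  then have "egf (dcoeff_deriv acoeff z c) y < 0"
    using d(2)[of "(z, y)"] z xy m1 by (auto simp: dist_real_def)
  then have "(m - x) * egf (dcoeff_deriv acoeff z c) y < 0" using xy(2) by (intro mult_pos_neg) auto
  then have "Dser m c y < Dser x c y" using z(3) by linarith
  then show False using xy mge[of y] by simp
qed

lemma Dser_negative_after_contact:
  assumes a: "0 < a0" "a0 < a1" and c: "c \<ge> 0" and t0: "t0 > 0"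
    and "\<And>u. 0 \<le> u \<Longrightarrow> u \<le> t0 \<Longrightarrow> Dser a0 c u \<ge> 0" and "Dser a0 c t0 = 0"
  shows "\<exists>t\<in>{0..t0}. Dser a1 c t < 0"
proof -
  have "egf (dcoeff_deriv acoeff a0 c) t0 < 0" by (rule contact_deriv_a) (use assms in auto)
  then obtain d where d: "d > 0" "\<And>h. 0 < h \<Longrightarrow> h < d \<Longrightarrow> Dser (a0 + h) c t0 < Dser a0 c t0"
    using DERIV_neg_dec_right[OF Dser_deriv_a] by blast
  define h where "h = min (d / 2) (a1 - a0)"
  have "0 < h" "h < d" "a0 + h \<le> a1" using d a by (auto simp: h_def)
  with d(2)[of h] assms show ?thesis
    by (intro Dser_negative_persists[of "a0 + h"]) auto
qed

section \<open>F as a Laplace transform\<close>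

text \<open>The product of the series with \<open>exp P\<close>, where \<open>P\<close> is the series in the exponent, has derivative zero by the
recursion and equals one at the origin. The complex version serves the contour integral below.\<close>

lemma exp_coeff_sums:
  fixes z :: complex
  assumes q: "tame q" and h: "tame (exp_coeff q)" and z: "norm z < 1"
  shows "(\<lambda>n. of_real (exp_coeff q n) * z ^ n) sums
           exp (- (\<Sum>k. of_real (q k / real (Suc k)) * z ^ Suc k))"
proof -
  have csum: "summable (\<lambda>n. norm (complex_of_real (f n) * z ^ n))" if "tame f" "norm z < 1" for f and z :: complex
  proof (cases "z = 0")
    case True
    have "summable (\<lambda>n. \<bar>f n\<bar> * 0 ^ n)" by (rule tame_summable_signed[where f = "\<lambda>n. \<bar>f n\<bar>"]) (use that in \<open>auto simp: tame_def\<close>)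
    then show ?thesis by (simp add: norm_mult norm_power True)
  qed (use that in \<open>auto simp: tame_def norm_mult norm_power\<close>)
  have csum': "summable (\<lambda>n. complex_of_real (f n) * z ^ n)" if "tame f" "norm z < 1" for f and z :: complex
    using csum[OF that] by (rule summable_norm_cancel)
  define p where "p n = (case n of 0 \<Rightarrow> 0 | Suc k \<Rightarrow> q k / real (Suc k))" for n
  have p: "tame p"
    unfolding tame_def
  proof (intro allI impI)
    fix r :: real assume r: "0 < r \<and> r < 1"
    have "summable (\<lambda>n. r * (\<bar>q n\<bar> * r ^ n))" using q r by (intro summable_mult) (auto simp: tame_def)
    then have "summable (\<lambda>n. \<bar>p (Suc n)\<bar> * r ^ Suc n)"
    proof (rule summable_comparison_test'[where N = 0])
      fix n
      have "\<bar>q n\<bar> / real (Suc n) \<le> \<bar>q n\<bar>" by (simp add: divide_le_eq mult_left_le algebra_simps)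
      then have "r ^ Suc n * (\<bar>q n\<bar> / real (Suc n)) \<le> r ^ Suc n * \<bar>q n\<bar>"
        using r by (intro mult_left_mono) auto
      then show "norm (\<bar>p (Suc n)\<bar> * r ^ Suc n) \<le> r * (\<bar>q n\<bar> * r ^ n)"
        using r by (simp add: p_def abs_mult mult_ac)
    qed
    then show "summable (\<lambda>n. \<bar>p n\<bar> * r ^ n)" by (subst summable_Suc_iff[symmetric])
  qed
  define S where "S z = (\<Sum>n. complex_of_real (exp_coeff q n) * z ^ n)" for z
  define P where "P z = (\<Sum>n. complex_of_real (p n) * z ^ n)" for z
  define Q where "Q z = (\<Sum>n. complex_of_real (q n) * z ^ n)" for z
  have S': "(S has_field_derivative - (Q z * S z)) (at z)" if z: "norm z < 1" for z
  proof -
    have "(S has_field_derivative (\<Sum>n. diffs (\<lambda>n. complex_of_real (exp_coeff q n)) n * z ^ n)) (at z)"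
      unfolding S_def by (rule termdiffs_strong'[where K = 1]) (use csum'[OF h] z in auto)
    moreover have "(\<lambda>n. diffs (\<lambda>n. complex_of_real (exp_coeff q n)) n * z ^ n) sums - (Q z * S z)"
    proof -
      have "(\<lambda>n. - (\<Sum>i\<le>n. (complex_of_real (q i) * z ^ i) * (complex_of_real (exp_coeff q (n - i)) * z ^ (n - i)))) sums - (Q z * S z)"
        unfolding Q_def S_def by (intro sums_minus Cauchy_product_sums csum q h z)
      moreover have "- (\<Sum>i\<le>n. (complex_of_real (q i) * z ^ i) * (complex_of_real (exp_coeff q (n - i)) * z ^ (n - i)))
         = diffs (\<lambda>n. complex_of_real (exp_coeff q n)) n * z ^ n" for n
      proof -
        have "(\<Sum>i\<le>n. (complex_of_real (q i) * z ^ i) * (complex_of_real (exp_coeff q (n - i)) * z ^ (n - i)))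
          = (\<Sum>i\<le>n. complex_of_real (q i * exp_coeff q (n - i)) * z ^ n)"
          by (intro sum.cong refl) (simp add: mult_ac flip: power_add)
        also have "\<dots> = complex_of_real (\<Sum>i\<le>n. q i * exp_coeff q (n - i)) * z ^ n"
          by (simp add: sum_distrib_right)
        also have "(\<Sum>i\<le>n. q i * exp_coeff q (n - i)) = - (real (Suc n) * exp_coeff q (Suc n))" by simp
        finally show ?thesis by (simp add: diffs_def del: exp_coeff.simps of_nat_Suc)
      qed
      ultimately show ?thesis by simp
    qed
    ultimately show ?thesis by (simp add: sums_iff)
  qed
  have P': "(P has_field_derivative Q z) (at z)" if z: "norm z < 1" for z
  proof -
    have "(P has_field_derivative (\<Sum>n. diffs (\<lambda>n. complex_of_real (p n)) n * z ^ n)) (at z)"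
      unfolding P_def by (rule termdiffs_strong'[where K = 1]) (use csum'[OF p] z in auto)
    moreover have "diffs (\<lambda>n. complex_of_real (p n)) = (\<lambda>n. complex_of_real (q n))"
    proof
      fix n
      have "real (Suc n) * p (Suc n) = q n" by (simp add: p_def)
      then have "complex_of_real (real (Suc n)) * complex_of_real (p (Suc n)) = complex_of_real (q n)"
        by (metis of_real_mult)
      then show "diffs (\<lambda>n. complex_of_real (p n)) n = complex_of_real (q n)"
        by (simp only: diffs_def of_real_of_nat_eq)
    qed
    ultimately show ?thesis by (simp add: Q_def)
  qed
  have "\<exists>k. \<forall>z\<in>ball 0 1. S z * exp (P z) = k"
  proof (rule has_field_derivative_zero_constant)
    fix z :: complex assume "z \<in> ball 0 1"
    then have z: "norm z < 1" by simp
    show "((\<lambda>z. S z * exp (P z)) has_field_derivative 0) (at z within ball 0 1)"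
      by (rule has_field_derivative_at_within,
          rule DERIV_cong[OF DERIV_mult[OF S'[OF z] DERIV_chain2[OF DERIV_exp P'[OF z]]]]) simp
  qed simp
  then obtain k where k: "\<And>z. norm z < 1 \<Longrightarrow> S z * exp (P z) = k" by auto
  have "k = 1" using k[of 0] powser_zero[of "\<lambda>n. complex_of_real (exp_coeff q n)"]
      powser_zero[of "\<lambda>n. complex_of_real (p n)"]
    unfolding S_def P_def by (simp add: p_def)
  then have "S z = exp (- P z)" using k[OF z] by (simp add: exp_minus field_simps)
  moreover have "P z = (\<Sum>k. of_real (q k / real (Suc k)) * z ^ Suc k)"
  proof -
    have "(\<lambda>n. complex_of_real (p n) * z ^ n) sums P z"
      unfolding P_def using csum'[OF p z] by (rule summable_sums)
    then have "(\<lambda>n. complex_of_real (p (Suc n)) * z ^ Suc n) sums P z"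
      by (subst sums_Suc_iff) (simp add: p_def)
    then show ?thesis by (simp add: p_def sums_iff del: of_nat_Suc power_Suc)
  qed
  moreover have "(\<lambda>n. of_real (exp_coeff q n) * z ^ n) sums S z"
    unfolding S_def using csum'[OF h z] by (rule summable_sums)
  ultimately show ?thesis by simp
qed

lemma tame_log_coeff: "tame (log_coeff a c)"
  by (rule tame_bounded[OF log_coeff_bound])

lemma tame_exp_coeff: "tame (exp_coeff (log_coeff a c))"
proof -
  obtain N where N: "\<bar>a\<bar> + \<bar>c\<bar> \<le> real N" using real_arch_simple by blast
  have "\<bar>exp_coeff (log_coeff a c) m\<bar> \<le> real (Suc m) ^ N" for m
    by (rule exp_coeff_power_bound) (use log_coeff_bound[of a c] N in \<open>meson order_trans\<close>)
  with tame_power[of N] show ?thesis by (rule tame_mono)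
qed

lemma Ln_1_minus_sums:
  fixes z :: complex
  assumes "norm z < 1"
  shows "(\<lambda>k. z ^ Suc k / of_nat (Suc k)) sums (- Ln (1 - z))"
proof -
  have "(\<lambda>n. - (- ((- (- z)) ^ n) / of_nat n)) sums (- Ln (1 + - z))"
    by (intro sums_minus Ln_series') (use assms in auto)
  then show ?thesis by (subst sums_Suc_iff) simp
qed

text \<open>The partial fractions \<open>log_coeff a c k / (k + 1) = (a + c) / (k + 1) - a / (k + 2)\<close> reduce the exponent to two
logarithmic series.\<close>

lemma exp_coeff_generating_function:
  fixes z :: complex
  assumes z: "norm z < 1" "z \<noteq> 0"
  shows "(\<lambda>n. of_real (exp_coeff (log_coeff a c) n) * z ^ n) sums
           exp (- of_real a + of_real c * Ln (1 - z) - of_real a * Ln (1 - z) * (1 / z - 1))"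
proof -
  let ?l = "- Ln (1 - z)"
  have s1: "(\<lambda>k. z ^ Suc k / of_nat (Suc k)) sums ?l" by (rule Ln_1_minus_sums[OF z(1)])
  then have "(\<lambda>k. z ^ Suc (Suc k) / of_nat (Suc (Suc k))) sums (?l - z)"
    by (subst sums_Suc_iff) simp
  then have "(\<lambda>k. (z ^ Suc (Suc k) / of_nat (Suc (Suc k))) / z) sums ((?l - z) / z)"
    by (rule sums_divide)
  then have s2: "(\<lambda>k. z ^ Suc k / of_nat (Suc (Suc k))) sums ((?l - z) / z)"
    using z by (simp add: field_simps del: of_nat_Suc)
  have "(\<lambda>k. of_real (a + c) * (z ^ Suc k / of_nat (Suc k)) - of_real a * (z ^ Suc k / of_nat (Suc (Suc k))))
     sums (of_real (a + c) * ?l - of_real a * ((?l - z) / z))"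
    by (intro sums_diff sums_mult s1 s2)
  moreover have "of_real (a + c) * (z ^ Suc k / of_nat (Suc k)) - of_real a * (z ^ Suc k / of_nat (Suc (Suc k)))
     = of_real (log_coeff a c k / real (Suc k)) * z ^ Suc k" for k
  proof -
    have "log_coeff a c k / real (Suc k) = (a + c) / real (Suc k) - a / real (Suc (Suc k))"
      unfolding log_coeff_def by (simp add: field_simps)
    then have "of_real (log_coeff a c k / real (Suc k)) * z ^ Suc k
      = (of_real (a + c) / of_nat (Suc k) - of_real a / of_nat (Suc (Suc k))) * z ^ Suc k"
      by (simp only: of_real_diff of_real_divide of_real_of_nat_eq)
    then show ?thesis by (simp add: left_diff_distrib del: of_nat_Suc power_Suc of_real_add)
  qed
  ultimately have "(\<lambda>k. of_real (log_coeff a c k / real (Suc k)) * z ^ Suc k) sums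
     (of_real (a + c) * ?l - of_real a * ((?l - z) / z))" by simp
  then have "(\<Sum>k. of_real (log_coeff a c k / real (Suc k)) * z ^ Suc k) =
     (of_real (a + c) * ?l - of_real a * ((?l - z) / z))" by (simp only: sums_iff)
  also have "- \<dots> = - of_real a + of_real c * Ln (1 - z) - of_real a * Ln (1 - z) * (1 / z - 1)"
    using z by (simp add: field_simps)
  finally show ?thesis using exp_coeff_sums[OF tame_log_coeff tame_exp_coeff z(1), of a c] by simp
qed

lemma F_eq_borel_sum:
  assumes a: "a > 0" and x: "x > 0"
  shows "F a (-c) x = exp a * (1 - borel_sum (dcoeff a c) (1 + x / a))"
proof -
  define y where "y = x / a"
  have y: "y > 0" using a x by (simp add: y_def)
  define \<zeta> where "\<zeta> = 1 / (1 + y)"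
  have \<zeta>: "0 < \<zeta>" "\<zeta> < 1" "1 - \<zeta> = y / (1 + y)" "1 / \<zeta> - 1 = y" using y by (auto simp: \<zeta>_def field_simps)
  have "(\<lambda>n. of_real (exp_coeff (log_coeff a c) n) * complex_of_real \<zeta> ^ n) sums
     exp (- of_real a + of_real c * Ln (1 - of_real \<zeta>) - of_real a * Ln (1 - of_real \<zeta>) * (1 / of_real \<zeta> - 1))"
    by (rule exp_coeff_generating_function) (use \<zeta> in auto)
  also have "Ln (1 - complex_of_real \<zeta>) = of_real (ln (1 - \<zeta>))"
    using Ln_of_real[of "1 - \<zeta>"] \<zeta>(2) by simp
  also have "exp (- of_real a + of_real c * complex_of_real (ln (1 - \<zeta>)) - of_real a * of_real (ln (1 - \<zeta>)) * (1 / of_real \<zeta> - 1))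
     = complex_of_real (exp (- a + c * ln (1 - \<zeta>) - a * ln (1 - \<zeta>) * (1 / \<zeta> - 1)))"
    by (subst exp_of_real[symmetric]) simp
  finally have "(\<lambda>n. complex_of_real (exp_coeff (log_coeff a c) n * \<zeta> ^ n)) sums
     complex_of_real (exp (- a + c * ln (1 - \<zeta>) - a * ln (1 - \<zeta>) * (1 / \<zeta> - 1)))" by simp
  then have "(\<lambda>n. exp_coeff (log_coeff a c) n * \<zeta> ^ n) sums exp (- a + c * ln (1 - \<zeta>) - a * ln (1 - \<zeta>) * (1 / \<zeta> - 1))"
    by (simp only: sums_of_real_iff)
  then have "(\<lambda>n. exp_coeff (log_coeff a c) (Suc n) * \<zeta> ^ Suc n) sums
     (exp (- a + c * ln (1 - \<zeta>) - a * ln (1 - \<zeta>) * (1 / \<zeta> - 1)) - 1)"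
    by (subst sums_Suc_iff) simp
  then have "(\<lambda>n. dcoeff a c n * \<zeta> ^ Suc n) sums
     - (exp (- a + c * ln (1 - \<zeta>) - a * ln (1 - \<zeta>) * (1 / \<zeta> - 1)) - 1)"
    unfolding dcoeff_def using sums_minus by fastforce
  then have b: "1 - borel_sum (dcoeff a c) (1 + y) = exp (- a + c * ln (1 - \<zeta>) - a * ln (1 - \<zeta>) * (1 / \<zeta> - 1))"
    by (simp add: borel_sum_def \<zeta>_def sums_iff)
  have "ln (1 - \<zeta>) = - ln (1 + 1 / y)"
    using y by (simp add: \<zeta> ln_div field_simps)
  then have "exp a * (1 - borel_sum (dcoeff a c) (1 + y)) = exp ((a * y - c) * ln (1 + 1 / y))"
    unfolding b \<zeta>(4) by (simp flip: exp_add) (simp add: algebra_simps)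
  moreover have "1 + 1 / y = 1 + a / x" "a * y = x" using a x by (auto simp: y_def)
  moreover have "1 + a / x > 0" using a x by (simp add: add_pos_pos)
  ultimately show ?thesis unfolding F_def powr_def by (simp add: y_def)
qed

section \<open>A criterion for Bernstein functions\<close>

lemma iterated_deriv_on_open:
  fixes f :: "nat \<Rightarrow> real \<Rightarrow> real"
  assumes U: "open U" and f: "\<And>n x. x \<in> U \<Longrightarrow> (f n has_real_derivative f (Suc n) x) (at x)"
    and g: "\<And>x. x \<in> U \<Longrightarrow> g x = f 0 x"
  shows "x \<in> U \<Longrightarrow> (deriv ^^ n) g x = f n x" and "smooth_on U g"
proof -
  have eq: "\<forall>x\<in>U. (deriv ^^ n) g x = f n x" for n
  proof (induction n)
    case (Suc n)
    show ?case
    proof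
      fix x assume x: "x \<in> U"
      have "((deriv ^^ n) g has_real_derivative f (Suc n) x) (at x)"
        by (rule has_field_derivative_transform_within_open[OF f[OF x] U x]) (use Suc in auto)
      then show "(deriv ^^ Suc n) g x = f (Suc n) x" by (simp add: DERIV_imp_deriv)
    qed
  qed (use g in auto)
  then show "x \<in> U \<Longrightarrow> (deriv ^^ n) g x = f n x" by blast
  show "smooth_on U g"
    unfolding smooth_on_def
  proof (intro allI ballI)
    fix n x assume x: "x \<in> U"
    have "((deriv ^^ n) g has_real_derivative f (Suc n) x) (at x)"
      by (rule has_field_derivative_transform_within_open[OF f[OF x] U x]) (use eq in auto)
    then show "(deriv ^^ n) g differentiable (at x)" using real_differentiable_def by blast
  qed
qed

text \<open>Multiplication by \<open>t ^ m\<close> on coefficients, see \<open>egf_moment_coeff\<close>.\<close>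

primrec moment_coeff :: "(nat \<Rightarrow> real) \<Rightarrow> nat \<Rightarrow> nat \<Rightarrow> real" where
  "moment_coeff d 0 = d"
| "moment_coeff d (Suc m) = (\<lambda>n. real n * moment_coeff d m (n - 1))"

lemma tame_moment_coeff: "tame d \<Longrightarrow> tame (moment_coeff d m)"
  by (induction m) (auto dest: tame_index_mult)

lemma egf_moment_coeff:
  assumes "tame d"
  shows "egf (moment_coeff d m) t = t ^ m * egf d t"
proof (induction m)
  case (Suc m)
  have "egf (moment_coeff d (Suc m)) t = t * egf (moment_coeff d m) t"
    unfolding moment_coeff.simps by (rule egf_index_mult[OF tame_moment_coeff[OF assms]])
  then show ?case using Suc by simp
qed simp

lemma F_derivatives:
  fixes a c :: real
  assumes a: "a > 0"
  shows "smooth_on {0<..} (F a (-c))"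
    and "x > 0 \<Longrightarrow> (deriv ^^ Suc n) (F a (-c)) x =
      (-1) ^ n * exp a * (1 / a) ^ Suc n * borel_sum (moment_coeff (dcoeff a c) (Suc n)) (1 + x / a)"
proof -
  define f where "f n x = (if n = 0 then exp a else 0)
     - exp a * (- 1 / a) ^ n * borel_sum (moment_coeff (dcoeff a c) n) (1 + x / a)" for n :: nat and x
  have f: "(f n has_real_derivative f (Suc n) x) (at x)" if "x \<in> {0<..}" for n x
  proof -
    have z: "1 + x / a > 1" using that a by simp
    have "((\<lambda>x. 1 + x / a) has_real_derivative 1 / a) (at x)"
      using a by (auto intro!: derivative_eq_intros)
    from DERIV_chain2[OF borel_sum_has_derivative[OF tame_moment_coeff[OF tame_dcoeff] z] this]
    have "((\<lambda>x. borel_sum (moment_coeff (dcoeff a c) n) (1 + x / a)) has_real_derivative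
      - borel_sum (moment_coeff (dcoeff a c) (Suc n)) (1 + x / a) * (1 / a)) (at x)" by simp
    from DERIV_diff[OF DERIV_const[of "if n = 0 then exp a else 0"] DERIV_cmult[OF this, of "exp a * (- 1 / a) ^ n"]]
    show ?thesis unfolding f_def by (simp add: field_simps)
  qed
  have g: "F a (-c) x = f 0 x" if "x \<in> {0<..}" for x
    using F_eq_borel_sum[OF a, of x c] that by (simp add: f_def algebra_simps)
  show "smooth_on {0<..} (F a (-c))"
    by (rule iterated_deriv_on_open(2)[where f = f]) (use f g in auto)
  assume "x > 0"
  then have "(deriv ^^ Suc n) (F a (-c)) x = f (Suc n) x"
    by (intro iterated_deriv_on_open(1)[where f = f and U = "{0<..}"]) (use f g in auto)
  also have "\<dots> = (-1) ^ n * exp a * (1 / a) ^ Suc n * borel_sum (moment_coeff (dcoeff a c) (Suc n)) (1 + x / a)"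
    unfolding f_def by (simp add: power_divide power_minus' divide_simps)
  finally show "(deriv ^^ Suc n) (F a (-c)) x =
      (-1) ^ n * exp a * (1 / a) ^ Suc n * borel_sum (moment_coeff (dcoeff a c) (Suc n)) (1 + x / a)" .
qed

text \<open>The \<open>n\<close>-th derivative of \<open>F'\<close> is, up to the sign \<open>(- 1) ^ n\<close> and a positive factor, the Laplace transform of
\<open>t ^ (n + 1) * Dser a c t\<close>.\<close>

lemma bernstein_iff_borel_sums:
  assumes a: "a > 0"
  shows "bernstein (F a (-c)) \<longleftrightarrow> (\<forall>n. \<forall>z>1. borel_sum (moment_coeff (dcoeff a c) (Suc n)) z \<ge> 0)"
proof -
  have sm: "smooth_on {0<..} (F a (-c))" by (rule F_derivatives[OF a])
  have pos: "F a (-c) x \<ge> 0" for x by (simp add: F_def)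
  have shift: "(deriv ^^ n) (deriv (F a (-c))) = (deriv ^^ Suc n) (F a (-c))" for n
    by (metis funpow_Suc_right o_apply)
  have sm': "smooth_on {0<..} (deriv (F a (-c)))"
    using sm unfolding smooth_on_def shift by blast
  have sgn: "(-1) ^ n * (deriv ^^ Suc n) (F a (-c)) x = 
     (exp a * (1 / a) ^ Suc n) * borel_sum (moment_coeff (dcoeff a c) (Suc n)) (1 + x / a)" if "x > 0" for n x
    unfolding F_derivatives(2)[OF a that] by (simp flip: power_add add: mult.assoc[symmetric] del: moment_coeff.simps power_Suc)
  have cancel: "0 \<le> C * B \<longleftrightarrow> 0 \<le> B" if "C > 0" for C B :: real using that by (simp add: zero_le_mult_iff)
  have "exp a * (1 / a) ^ Suc n > 0" for n using a by simp
  then have sgn': "0 \<le> (-1) ^ n * (deriv ^^ Suc n) (F a (-c)) x \<longleftrightarrow>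
     0 \<le> borel_sum (moment_coeff (dcoeff a c) (Suc n)) (1 + x / a)" if "x > 0" for n x
    unfolding sgn[OF that] by (rule cancel)
  have "bernstein (F a (-c)) \<longleftrightarrow> (\<forall>n. \<forall>x>0. borel_sum (moment_coeff (dcoeff a c) (Suc n)) (1 + x / a) \<ge> 0)"
    unfolding bernstein_def completely_monotone_def shift using sm sm' pos sgn' by blast
  also have "\<dots> \<longleftrightarrow> (\<forall>n. \<forall>z>1. borel_sum (moment_coeff (dcoeff a c) (Suc n)) z \<ge> 0)"
  proof (intro iffI allI impI)
    fix n z assume *: "\<forall>n. \<forall>x>0. borel_sum (moment_coeff (dcoeff a c) (Suc n)) (1 + x / a) \<ge> 0" and "(z::real) > 1"
    then show "borel_sum (moment_coeff (dcoeff a c) (Suc n)) z \<ge> 0"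
      using *[rule_format, of "a * (z - 1)" n] a by simp
  qed (use a in auto)
  finally show ?thesis .
qed

lemma exp_kernel_mono:
  fixes s t t0 :: real
  assumes "t0 > 0"
  shows "s \<le> t \<Longrightarrow> t \<le> t0 \<Longrightarrow> s * exp (- (s / t0)) \<le> t * exp (- (t / t0))"
    and "s < t \<Longrightarrow> t \<le> t0 \<Longrightarrow> s * exp (- (s / t0)) < t * exp (- (t / t0))"
    and "s \<le> t \<Longrightarrow> t0 \<le> s \<Longrightarrow> t * exp (- (t / t0)) \<le> s * exp (- (s / t0))"
    and "s < t \<Longrightarrow> t0 \<le> s \<Longrightarrow> t * exp (- (t / t0)) < s * exp (- (s / t0))"
proof -
  have d: "((\<lambda>t. t * exp (- (t / t0))) has_real_derivative (1 - x / t0) * exp (- (x / t0))) (at x)" for x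
    using assms by (auto intro!: derivative_eq_intros simp: field_simps)
  have c: "continuous_on S (\<lambda>t. t * exp (- (t / t0)))" for S
    by (intro continuous_intros) (use assms in auto)
  show up: "s < t \<Longrightarrow> t \<le> t0 \<Longrightarrow> s * exp (- (s / t0)) < t * exp (- (t / t0))" for s t
    by (rule DERIV_pos_imp_increasing_open[where f = "\<lambda>t. t * exp (- (t / t0))"])
      (use d c assms in \<open>auto intro!: exI mult_pos_pos simp: field_simps\<close>)
  show down: "s < t \<Longrightarrow> t0 \<le> s \<Longrightarrow> t * exp (- (t / t0)) < s * exp (- (s / t0))" for s t
    by (rule DERIV_neg_imp_decreasing_open[where f = "\<lambda>t. t * exp (- (t / t0))"])
      (use d c assms in \<open>auto intro!: exI mult_neg_pos simp: field_simps\<close>)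
  show "s \<le> t \<Longrightarrow> t \<le> t0 \<Longrightarrow> s * exp (- (s / t0)) \<le> t * exp (- (t / t0))"
    using up[of s t] by (cases "s = t") auto
  show "s \<le> t \<Longrightarrow> t0 \<le> s \<Longrightarrow> t * exp (- (t / t0)) \<le> s * exp (- (s / t0))"
    using down[of s t] by (cases "s = t") auto
qed

text \<open>The functions \<open>(t * exp (- t / t0)) ^ n\<close> concentrate at \<open>t0\<close>, where the base has its strict maximum. If \<open>E\<close> were
negative at \<open>t0\<close>, then for large \<open>n\<close> the contribution of a small interval around \<open>t0\<close>, of size at least
a multiple of \<open>\<rho>' ^ n\<close>, would outweigh everything outside a larger interval, at most a multiple of \<open>\<rho> ^ n\<close> with \<open>\<rho> < \<rho>'\<close>. This is the
qualitative part of Post's inversion formula, which is all that the criterion needs.\<close>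

lemma peak_kernel_nonneg:
  fixes E :: "real \<Rightarrow> real"
  assumes t0: "t0 > 0" and cont: "isCont E t0"
    and int: "\<And>n. integrable lborel (\<lambda>t. indicator {0..} t * ((t * exp (- (t / t0))) ^ Suc n * E t))"
    and nonneg: "\<And>n. (LINT t|lborel. indicator {0..} t * ((t * exp (- (t / t0))) ^ Suc n * E t)) \<ge> 0"
  shows "E t0 \<ge> 0"
proof (rule ccontr)
  assume "\<not> E t0 \<ge> 0"
  define \<eta> where "\<eta> = - E t0 / 2"
  have \<eta>: "\<eta> > 0" using \<open>\<not> E t0 \<ge> 0\<close> by (simp add: \<eta>_def)
  define k where "k t = t * exp (- (t / t0))" for t
  obtain e where e: "e > 0" "\<And>t. \<bar>t - t0\<bar> < e \<Longrightarrow> \<bar>E t - E t0\<bar> < \<eta>"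
    using cont \<eta> unfolding continuous_at_eps_delta by (metis dist_real_def)
  define \<delta> where "\<delta> = min (e / 2) (t0 / 2)"
  have \<delta>: "0 < \<delta>" "\<delta> < e" "\<delta> < t0" using e t0 by (auto simp: \<delta>_def)
  have E: "E t \<le> - \<eta>" if "\<bar>t - t0\<bar> \<le> \<delta>" for t
    using e(2)[of t] that \<delta> unfolding \<eta>_def by linarith
  define \<rho> where "\<rho> = max (k (t0 - \<delta>)) (k (t0 + \<delta>))"
  have \<rho>0: "\<rho> > 0" unfolding \<rho>_def k_def using \<delta> by (simp add: less_max_iff_disj)
  have \<rho>1: "\<rho> < k t0" unfolding \<rho>_def k_def
    using exp_kernel_mono(2)[OF t0, of "t0 - \<delta>" t0] exp_kernel_mono(4)[OF t0, of t0 "t0 + \<delta>"] \<delta> by simp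
  have far: "k t \<le> \<rho>" if "\<bar>t - t0\<bar> \<ge> \<delta>" for t
    using exp_kernel_mono(1)[OF t0, of t "t0 - \<delta>"] exp_kernel_mono(3)[OF t0, of "t0 + \<delta>" t] that \<delta>
    unfolding \<rho>_def k_def by (cases "t \<le> t0") (auto simp: le_max_iff_disj)
  \<comment> \<open>Any number strictly between the two values separates the growth rates.\<close>
  define \<rho>' where "\<rho>' = (\<rho> + k t0) / 2"
  have \<rho>': "\<rho> < \<rho>'" "\<rho>' < k t0" using \<rho>1 by (auto simp: \<rho>'_def)
  have "isCont k t0" unfolding k_def by (intro continuous_intros) (use t0 in auto)
  then obtain e' where e': "e' > 0" "\<And>t. \<bar>t - t0\<bar> < e' \<Longrightarrow> \<bar>k t - k t0\<bar> < k t0 - \<rho>'"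
    using \<rho>' unfolding continuous_at_eps_delta by (metis dist_real_def diff_gt_0_iff_gt)
  define \<delta>' where "\<delta>' = min (e' / 2) \<delta>"
  have \<delta>': "0 < \<delta>'" "\<delta>' < e'" "\<delta>' \<le> \<delta>" using e' \<delta> by (auto simp: \<delta>'_def)
  have near: "\<rho>' \<le> k t" if "\<bar>t - t0\<bar> \<le> \<delta>'" for t
    using e'(2)[of t] that \<delta>' by linarith
  define G where "G = (LINT t|lborel. \<bar>indicator {0..} t * (k t * E t)\<bar>)"
  have I0: "integrable lborel (\<lambda>t. \<bar>indicator {0..} t * (k t * E t)\<bar>)"
    using int[of 0] unfolding k_def by (intro integrable_abs) simp
  have i: "integrable lborel (indicator {t0 - \<delta>'..t0 + \<delta>'} :: real \<Rightarrow> real)"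
    by (rule integrable_real_indicator) (auto simp: emeasure_lborel_Icc_eq)
  have main: "\<rho>' ^ Suc n * \<eta> * (2 * \<delta>') \<le> \<rho> ^ n * G" for n
  proof -
    have I1: "integrable lborel (\<lambda>t. indicator {t0 - \<delta>'..t0 + \<delta>'} t * (\<rho>' ^ Suc n * \<eta>))"
      by (intro integrable_mult_left i)
    have I2: "integrable lborel (\<lambda>t. \<rho> ^ n * \<bar>indicator {0..} t * (k t * E t)\<bar> - indicator {t0 - \<delta>'..t0 + \<delta>'} t * (\<rho>' ^ Suc n * \<eta>))"
      by (intro Bochner_Integration.integrable_diff integrable_mult_right I0 I1)
    have "0 \<le> (LINT t|lborel. indicator {0..} t * (k t ^ Suc n * E t))"
      using nonneg[of n] by (simp add: k_def)
    also have "\<dots> \<le> (LINT t|lborel. \<rho> ^ n * \<bar>indicator {0..} t * (k t * E t)\<bar> - indicator {t0 - \<delta>'..t0 + \<delta>'} t * (\<rho>' ^ Suc n * \<eta>))"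
    proof (rule integral_mono)
      show "integrable lborel (\<lambda>t. indicator {0..} t * (k t ^ Suc n * E t))"
        using int[of n] by (simp only: k_def)
      show "integrable lborel (\<lambda>t. \<rho> ^ n * \<bar>indicator {0..} t * (k t * E t)\<bar> - indicator {t0 - \<delta>'..t0 + \<delta>'} t * (\<rho>' ^ Suc n * \<eta>))"
        by (rule I2)
      fix t :: real
      show "indicator {0..} t * (k t ^ Suc n * E t) \<le> \<rho> ^ n * \<bar>indicator {0..} t * (k t * E t)\<bar> - indicator {t0 - \<delta>'..t0 + \<delta>'} t * (\<rho>' ^ Suc n * \<eta>)"
      proof (cases "t \<ge> 0")
        case False
        then have "t \<notin> {t0 - \<delta>'..t0 + \<delta>'}" using \<delta>' \<delta> by auto
        then show ?thesis using False by simp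
      next
        case True
        then have k0: "k t \<ge> 0" by (simp add: k_def)
        show ?thesis
        proof (cases "\<bar>t - t0\<bar> \<le> \<delta>'")
          case in': True
          have "k t ^ Suc n * E t \<le> k t ^ Suc n * (- \<eta>)"
            using k0 E[of t] in' \<delta>' by (intro mult_left_mono) auto
          also have "\<dots> \<le> \<rho>' ^ Suc n * (- \<eta>)"
            using near[OF in'] \<eta> \<rho>' \<rho>0 by (intro mult_right_mono_neg power_mono) auto
          finally have "k t ^ Suc n * E t \<le> - (\<rho>' ^ Suc n * \<eta>)" by simp
          moreover have "0 \<le> \<rho> ^ n * \<bar>k t * E t\<bar>" using \<rho>0 by simp
          moreover have "t \<in> {t0 - \<delta>'..t0 + \<delta>'}" using in' by auto
          ultimately show ?thesis using True by simp
        next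
          case out: False
          then have ind: "t \<notin> {t0 - \<delta>'..t0 + \<delta>'}" by auto
          show ?thesis
          proof (cases "\<bar>t - t0\<bar> \<le> \<delta>")
            case True
            then have "E t \<le> 0" using E[of t] \<eta> by simp
            then have "k t ^ Suc n * E t \<le> 0" using k0 by (intro mult_nonneg_nonpos) auto
            moreover have "0 \<le> \<rho> ^ n * \<bar>k t * E t\<bar>" using \<rho>0 by simp
            ultimately show ?thesis using ind \<open>t \<ge> 0\<close> by simp
          next
            case False
            have "k t ^ Suc n * E t \<le> k t ^ n * \<bar>k t * E t\<bar>"
              using k0 by (simp add: abs_mult mult_left_mono mult.assoc mult.left_commute)
            also have "\<dots> \<le> \<rho> ^ n * \<bar>k t * E t\<bar>"
              using far[of t] False k0 by (intro mult_right_mono power_mono) auto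
            finally show ?thesis using ind \<open>t \<ge> 0\<close> by simp
          qed
        qed
      qed
    qed
    also have "\<dots> = \<rho> ^ n * G - (LINT t|lborel. indicator {t0 - \<delta>'..t0 + \<delta>'} t * (\<rho>' ^ Suc n * \<eta>))"
      unfolding G_def by (subst Bochner_Integration.integral_diff) (use I0 I1 in auto)
    also have "(LINT t|lborel. indicator {t0 - \<delta>'..t0 + \<delta>'} t * (\<rho>' ^ Suc n * \<eta>)) = \<rho>' ^ Suc n * \<eta> * (2 * \<delta>')"
      using \<delta>' by (subst Bochner_Integration.integral_mult_left) (use i in auto)
    finally show ?thesis by simp
  qed
  have "(\<rho>' / \<rho>) ^ n \<le> G / (\<rho>' * \<eta> * (2 * \<delta>'))" for n
    using main[of n] \<rho>0 \<rho>' \<eta> \<delta>' by (simp add: power_divide field_simps)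
  moreover obtain n where "G / (\<rho>' * \<eta> * (2 * \<delta>')) < (\<rho>' / \<rho>) ^ n"
    using real_arch_pow[of "\<rho>' / \<rho>" "G / (\<rho>' * \<eta> * (2 * \<delta>'))"] \<rho>' \<rho>0 by (auto simp: field_simps)
  ultimately show False by (meson not_le)
qed

text \<open>For the forward direction the Laplace variable \<open>1 + (n + 1) / t\<close> is chosen so that
\<open>u ^ (n + 1) * exp (- (n + 1) * u / t)\<close>, the \<open>(n + 1)\<close>-st power of the kernel of \<open>peak_kernel_nonneg\<close>, appears.\<close>

lemma bernstein_iff_Dser_nonneg:
  assumes a: "a > 0" and c: "c \<ge> 0"
  shows "bernstein (F a (-c)) \<longleftrightarrow> (\<forall>t\<ge>0. Dser a c t \<ge> 0)"
proof
  assume "bernstein (F a (-c))"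
  then have b: "borel_sum (moment_coeff (dcoeff a c) (Suc n)) z \<ge> 0" if "z > 1" for n z
    using bernstein_iff_borel_sums[OF a] that by blast
  show "\<forall>t\<ge>0. Dser a c t \<ge> 0"
  proof (intro allI impI)
    fix t :: real assume t: "t \<ge> 0"
    show "Dser a c t \<ge> 0"
    proof (cases "t = 0")
      case True
      then show ?thesis using a c by (simp add: Dser_0 q1_def)
    next
      case False
      then have t: "t > 0" using t by simp
      have h: "has_bochner_integral lborel (\<lambda>u. indicator {0..} u * ((u * exp (- (u / t))) ^ Suc n * (exp (- u) * Dser a c u)))
          (borel_sum (moment_coeff (dcoeff a c) (Suc n)) (1 + real (Suc n) / t))" for n
      proof -
        have "has_bochner_integral lborel (\<lambda>u. indicator {0..} u * (exp (- (1 + real (Suc n) / t) * u) * egf (moment_coeff (dcoeff a c) (Suc n)) u))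
          (borel_sum (moment_coeff (dcoeff a c) (Suc n)) (1 + real (Suc n) / t))"
          by (rule laplace_egf[OF tame_moment_coeff[OF tame_dcoeff]]) (use t in simp)
        moreover have "exp (- (1 + real (Suc n) / t) * u) * egf (moment_coeff (dcoeff a c) (Suc n)) u
           = (u * exp (- (u / t))) ^ Suc n * (exp (- u) * Dser a c u)" for u
        proof -
          have "exp (- (1 + real (Suc n) / t) * u) = exp (- u) * exp (- (u / t)) ^ Suc n"
            by (subst exp_of_nat_mult[symmetric], subst exp_add[symmetric]) (simp add: algebra_simps add_divide_distrib)
          then show ?thesis
            unfolding egf_moment_coeff[OF tame_dcoeff] Dser_def power_mult_distrib by (simp only: mult_ac)
        qed
        ultimately show ?thesis by simp
      qed
      have "exp (- t) * Dser a c t \<ge> 0"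
      proof (rule peak_kernel_nonneg[OF t, where E = "\<lambda>u. exp (- u) * Dser a c u"])
        have "isCont (Dser a c) t" unfolding Dser_def using egf_has_derivative[OF tame_dcoeff] DERIV_isCont by blast
        then show "isCont (\<lambda>u. exp (- u) * Dser a c u) t" by (intro continuous_intros)
        show "integrable lborel (\<lambda>u. indicator {0..} u * ((u * exp (- (u / t))) ^ Suc n * (exp (- u) * Dser a c u)))" for n
          using h has_bochner_integral_iff by blast
        have "1 + real (Suc n) / t > 1" for n using t by simp
        then show "(LINT u|lborel. indicator {0..} u * ((u * exp (- (u / t))) ^ Suc n * (exp (- u) * Dser a c u))) \<ge> 0" for n
          using h[of n] b unfolding has_bochner_integral_iff by metis
      qed
      then show ?thesis by (simp add: zero_le_mult_iff)
    qed
  qed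
next
  assume D: "\<forall>t\<ge>0. Dser a c t \<ge> 0"
  have "borel_sum (moment_coeff (dcoeff a c) (Suc n)) z \<ge> 0" if "z > 1" for n z
  proof -
    have h: "has_bochner_integral lborel (\<lambda>u. indicator {0..} u * (exp (- z * u) * egf (moment_coeff (dcoeff a c) (Suc n)) u))
          (borel_sum (moment_coeff (dcoeff a c) (Suc n)) z)"
      by (rule laplace_egf[OF tame_moment_coeff[OF tame_dcoeff] that])
    have "0 \<le> (LINT u|lborel. indicator {0..} u * (exp (- z * u) * egf (moment_coeff (dcoeff a c) (Suc n)) u))"
      unfolding egf_moment_coeff[OF tame_dcoeff] Dser_def[symmetric]
      by (rule integral_nonneg_AE) (use D in \<open>auto split: split_indicator\<close>)
    then show ?thesis using h by (simp add: has_bochner_integral_iff)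
  qed
  then show "bernstein (F a (-c))" using bernstein_iff_borel_sums[OF a] by blast
qed

section \<open>A contour integral for the coefficients\<close>

text \<open>In the variable \<open>L = ln (1 + 1 / y)\<close> the complement of the cut \<open>[- 1, 0]\<close> becomes the strip \<open>\<bar>Im L\<bar> < \<pi>\<close>, its two sides become the
lines \<open>Im L = \<pm> \<pi>\<close>, and \<open>\<zeta> = 1 / (1 + y)\<close> becomes \<open>1 - exp (- L)\<close>. The singularities at the ends of the cut move to infinity,
where the integrand decays exponentially.\<close>

definition zeta_map :: "complex \<Rightarrow> complex" where
  "zeta_map L = 1 - exp (- L)"

text \<open>The function \<open>F a (- c) (a * y)\<close> in the variable \<open>L\<close>, since \<open>y = 1 / \<zeta> - 1\<close>.\<close>

definition strip_fun :: "real \<Rightarrow> real \<Rightarrow> complex \<Rightarrow> complex" where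
  "strip_fun a c L = exp (of_real a * L * (1 / zeta_map L - 1) - of_real c * L)"

text \<open>The differential \<open>F / \<zeta> ^ (N + 1) d\<zeta>\<close> pulled back to the strip; its residue at \<open>L = 0\<close> is \<open>exp a\<close> times
the \<open>N\<close>-th coefficient.\<close>

definition strip_integrand :: "real \<Rightarrow> real \<Rightarrow> nat \<Rightarrow> complex \<Rightarrow> complex" where
  "strip_integrand a c N L = strip_fun a c L * exp (- L) / zeta_map L ^ Suc N"

text \<open>Twice as wide as the image of the cut plane, so that the lines \<open>Im L = \<pm> \<pi>\<close> lie inside; the only zero of \<open>zeta_map\<close> in it is
\<open>L = 0\<close>.\<close>

definition strip :: "complex set" where
  "strip = {L. \<bar>Im L\<bar> < 2 * pi}"

lemma strip_props: "open strip" "convex strip" "0 \<in> strip"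
proof -
  have e: "strip = {L. Im L < 2 * pi} \<inter> {L. Im L > - 2 * pi}" by (auto simp: strip_def)
  show "open strip" unfolding e by (intro open_Int open_halfspace_Im_lt open_halfspace_Im_gt)
  show "convex strip" unfolding e by (intro convex_Int convex_halfspace_Im_lt convex_halfspace_Im_gt)
qed (simp add: strip_def)

lemma zeta_map_eq_0:
  assumes "L \<in> strip" "L \<noteq> 0"
  shows "zeta_map L \<noteq> 0"
proof
  assume "zeta_map L = 0"
  then have "exp (- L) = 1" by (simp add: zeta_map_def)
  then obtain n :: int where n: "Re L = 0" "- Im L = of_int (2 * n) * pi" unfolding exp_eq_1 by auto
  then have "\<bar>of_int (2 * n) * pi\<bar> < 2 * pi" using assms(1) by (simp add: strip_def flip: n(2))
  then have "\<bar>real_of_int n\<bar> < 1" by (simp add: abs_mult)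
  then have "n = 0" by linarith
  with n have "L = 0" by (simp add: complex_eq_iff)
  then show False using assms(2) by simp
qed

lemma zeta_map_deriv: "(zeta_map has_field_derivative exp (- L)) (at L within S)"
  unfolding zeta_map_def by (auto intro!: derivative_eq_intros)

lemma zeta_map_holomorphic: "zeta_map holomorphic_on S"
  unfolding zeta_map_def by (intro holomorphic_intros)

lemma strip_integrand_holomorphic: "strip_integrand a c N holomorphic_on strip - {0}"
  unfolding strip_integrand_def strip_fun_def
  by (intro holomorphic_intros zeta_map_holomorphic) (use zeta_map_eq_0 in auto)

lemma strip_fun_expansion:
  obtains \<epsilon> where "\<epsilon> > 0" "ball 0 \<epsilon> \<subseteq> strip" "\<And>L. L \<in> ball 0 \<epsilon> \<Longrightarrow> norm (zeta_map L) < 1"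
    "\<And>L. L \<in> ball 0 \<epsilon> \<Longrightarrow> L \<noteq> 0 \<Longrightarrow>
      (\<lambda>n. of_real (exp_coeff (log_coeff a c) n) * zeta_map L ^ n) sums (exp (- of_real a) * strip_fun a c L)"
proof -
  have "isCont zeta_map 0" using zeta_map_deriv[of 0 UNIV] by (rule DERIV_isCont)
  then obtain e where e: "e > 0" "\<And>L. dist L 0 < e \<Longrightarrow> dist (zeta_map L) (zeta_map 0) < 1"
    unfolding continuous_at_eps_delta by (metis zero_less_one)
  define \<epsilon> where "\<epsilon> = min e 1"
  have im: "\<bar>Im L\<bar> < 1" if "L \<in> ball 0 \<epsilon>" for L :: complex
    using abs_Im_le_cmod[of L] that by (simp add: \<epsilon>_def)
  have small: "norm (zeta_map L) < 1" if "L \<in> ball 0 \<epsilon>" for L :: complex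
    using e(2)[of L] that by (simp add: \<epsilon>_def zeta_map_def dist_norm)
  show thesis
  proof (rule that)
    show "\<epsilon> > 0" using e by (simp add: \<epsilon>_def)
    show sub: "ball 0 \<epsilon> \<subseteq> strip"
    proof
      fix L :: complex assume "L \<in> ball 0 \<epsilon>"
      from im[OF this] pi_gt3 show "L \<in> strip" by (simp add: strip_def)
    qed
    show "norm (zeta_map L) < 1" if "L \<in> ball 0 \<epsilon>" for L :: complex using small[OF that] .
    fix L :: complex assume L: "L \<in> ball 0 \<epsilon>" "L \<noteq> 0"
    have nz: "zeta_map L \<noteq> 0" using zeta_map_eq_0 sub L by auto
    have "1 - zeta_map L = exp (- L)" by (simp add: zeta_map_def)
    moreover have "Ln (exp (- L)) = - L"
      by (rule Ln_exp) (use im[OF L(1)] pi_gt3 in auto)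
    ultimately have ln: "Ln (1 - zeta_map L) = - L" by simp
    have "exp (- of_real a + of_real c * Ln (1 - zeta_map L) - of_real a * Ln (1 - zeta_map L) * (1 / zeta_map L - 1))
       = exp (- of_real a) * strip_fun a c L"
      unfolding ln strip_fun_def exp_add[symmetric] by (rule arg_cong[where f = exp]) (simp add: algebra_simps)
    then show "(\<lambda>n. of_real (exp_coeff (log_coeff a c) n) * zeta_map L ^ n) sums (exp (- of_real a) * strip_fun a c L)"
      using exp_coeff_generating_function[OF small[OF L(1)] nz, of a c] by simp
  qed
qed

lemma powser_holomorphic:
  assumes "tame f"
  shows "(\<lambda>z. \<Sum>n. complex_of_real (f n) * z ^ n) holomorphic_on ball 0 1"
proof -
  have s: "summable (\<lambda>n. complex_of_real (f n) * z ^ n)" if "norm z < 1" for z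
  proof (rule summable_norm_cancel)
    have "summable (\<lambda>n. \<bar>f n\<bar> * norm z ^ n)"
      by (rule tame_summable_signed[where f = "\<lambda>n. \<bar>f n\<bar>"]) (use assms that in \<open>auto simp: tame_def\<close>)
    then show "summable (\<lambda>n. norm (complex_of_real (f n) * z ^ n))" by (simp add: norm_mult norm_power)
  qed
  show ?thesis
  proof (rule holomorphic_onI)
    fix z :: complex assume z: "z \<in> ball 0 1"
    have "((\<lambda>z. \<Sum>n. complex_of_real (f n) * z ^ n) has_field_derivative
        (\<Sum>n. diffs (\<lambda>n. complex_of_real (f n)) n * z ^ n)) (at z)"
      by (rule termdiffs_strong'[where K = 1]) (use s z in auto)
    then show "(\<lambda>z. \<Sum>n. complex_of_real (f n) * z ^ n) field_differentiable at z within ball 0 1"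
      using field_differentiable_def field_differentiable_at_within by blast
  qed
qed

text \<open>Subtracting the polar part leaves a function that is a convergent power series in \<open>\<zeta>\<close> near \<open>L = 0\<close>, so the singularity
there is removable.\<close>

lemma strip_remainder_holomorphic:
  obtains r where "r holomorphic_on strip"
    "\<And>L. L \<in> strip \<Longrightarrow> L \<noteq> 0 \<Longrightarrow> strip_integrand a c N L =
       exp (of_real a) * (\<Sum>j\<le>N. of_real (exp_coeff (log_coeff a c) j) * (zeta_map L ^ j * exp (- L) / zeta_map L ^ Suc N)) + r L"
proof -
  obtain \<epsilon> where \<epsilon>: "\<epsilon> > 0" "ball 0 \<epsilon> \<subseteq> strip" "\<And>L. L \<in> ball 0 \<epsilon> \<Longrightarrow> norm (zeta_map L) < 1"
    "\<And>L. L \<in> ball 0 \<epsilon> \<Longrightarrow> L \<noteq> 0 \<Longrightarrow>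
      (\<lambda>n. of_real (exp_coeff (log_coeff a c) n) * zeta_map L ^ n) sums (exp (- of_real a) * strip_fun a c L)"
    using strip_fun_expansion[of a c] by blast
  define h where "h n = exp_coeff (log_coeff a c) n" for n
  define P where "P L = exp (complex_of_real a) * (\<Sum>j\<le>N. of_real (h j) * (zeta_map L ^ j * exp (- L) / zeta_map L ^ Suc N))" for L
  define R where "R z = (\<Sum>n. complex_of_real (h (n + Suc N)) * z ^ n)" for z
  define r where "r L = (if L = 0 then exp (of_real a) * R (zeta_map 0) * exp (- 0) else strip_integrand a c N L - P L)" for L
  have near: "r L = exp (of_real a) * R (zeta_map L) * exp (- L)" if L: "L \<in> ball 0 \<epsilon>" for L
  proof (cases "L = 0")
    case False
    define z where "z = zeta_map L"
    have nz: "z \<noteq> 0" using zeta_map_eq_0[of L] \<epsilon>(2) L False by (auto simp: z_def)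
    have "(\<lambda>n. of_real (h (n + Suc N)) * z ^ (n + Suc N)) sums
       (exp (- of_real a) * strip_fun a c L - (\<Sum>j<Suc N. of_real (h j) * z ^ j))"
      using sums_split_initial_segment[OF \<epsilon>(4)[OF L False], of "Suc N"] by (simp only: z_def h_def)
    then have "(\<lambda>n. of_real (h (n + Suc N)) * z ^ (n + Suc N) / z ^ Suc N) sums
       ((exp (- of_real a) * strip_fun a c L - (\<Sum>j<Suc N. of_real (h j) * z ^ j)) / z ^ Suc N)"
      by (rule sums_divide)
    moreover have "of_real (h (n + Suc N)) * z ^ (n + Suc N) / z ^ Suc N = of_real (h (n + Suc N)) * z ^ n" for n
      unfolding power_add mult.assoc[symmetric] by (rule nonzero_mult_div_cancel_right) (use nz in simp)
    ultimately have "R z = (exp (- of_real a) * strip_fun a c L - (\<Sum>j<Suc N. of_real (h j) * z ^ j)) / z ^ Suc N"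
      unfolding R_def by (simp only: sums_iff)
    moreover have gen: "e * ((e' * s - y) / d) * f = (e * e') * (s * f / d) - e * (y * (f / d))" for e e' s y d f :: complex
      by (simp add: diff_divide_distrib algebra_simps)
    ultimately have "exp (of_real a) * R z * exp (- L) = 
       (exp (of_real a) * exp (- of_real a)) * (strip_fun a c L * exp (- L) / z ^ Suc N) 
        - exp (of_real a) * ((\<Sum>j<Suc N. of_real (h j) * z ^ j) * (exp (- L) / z ^ Suc N))"
      by (simp only: gen)
    also have "exp (complex_of_real a) * exp (- complex_of_real a) = 1" by (simp flip: exp_add)
    also have "(\<Sum>j<Suc N. of_real (h j) * z ^ j) * (exp (- L) / z ^ Suc N) = (\<Sum>j\<le>N. of_real (h j) * (z ^ j * exp (- L) / z ^ Suc N))"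
      unfolding sum_distrib_right lessThan_Suc_atMost by (intro sum.cong refl) simp
    finally show ?thesis
      unfolding r_def P_def strip_integrand_def using False by (simp add: z_def)
  qed (simp add: r_def)
  have tR: "tame (\<lambda>n. h (n + Suc N))"
    unfolding h_def by (rule tame_shift[OF tame_exp_coeff])
  have "r holomorphic_on ball 0 \<epsilon>"
  proof (rule holomorphic_transform)
    show "(\<lambda>L. exp (of_real a) * R (zeta_map L) * exp (- L)) holomorphic_on ball 0 \<epsilon>"
      unfolding R_def
      by (intro holomorphic_intros holomorphic_on_compose_gen[OF zeta_map_holomorphic powser_holomorphic[OF tR], unfolded o_def])
        (use \<epsilon>(3) in auto)
  qed (use near in auto)
  moreover have "r holomorphic_on strip - {0}"
  proof (rule holomorphic_transform)
    show "(\<lambda>L. strip_integrand a c N L - P L) holomorphic_on strip - {0}"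
      unfolding P_def by (intro holomorphic_intros strip_integrand_holomorphic zeta_map_holomorphic) (use zeta_map_eq_0 in auto)
  qed (simp add: r_def)
  ultimately have "r holomorphic_on (ball 0 \<epsilon> \<union> (strip - {0}))"
    by (rule holomorphic_on_Un) (use strip_props in auto)
  moreover have "ball 0 \<epsilon> \<union> (strip - {0}) = strip" using \<epsilon> strip_props(3) by auto
  ultimately have "r holomorphic_on strip" by simp
  then show thesis
    by (rule that) (simp add: r_def P_def h_def)
qed

lemma contour_integral_log_derivative:
  assumes p: "valid_path p" "path_image p \<subseteq> strip - {0}" "pathfinish p = pathstart p" "winding_number p 0 = 1"
  shows "((\<lambda>L. exp (- L) / zeta_map L) has_contour_integral (2 * of_real pi * \<i>)) p"
proof -
  define \<psi> where "\<psi> L = (if L = 0 then deriv zeta_map 0 else (zeta_map L - zeta_map 0) / (L - 0))" for L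
  have d0: "deriv zeta_map 0 = 1" using DERIV_imp_deriv[OF zeta_map_deriv[of 0 UNIV]] by simp
  have z0: "zeta_map 0 = 0" by (simp add: zeta_map_def)
  have "\<psi> holomorphic_on strip"
    unfolding \<psi>_def by (rule pole_lemma[OF zeta_map_holomorphic]) (use strip_props in \<open>simp add: interior_open\<close>)
  moreover have nz: "\<psi> L \<noteq> 0" if "L \<in> strip" for L
    using zeta_map_eq_0[OF that] by (simp add: \<psi>_def d0 z0)
  ultimately have h: "(\<lambda>L. exp (- L) / \<psi> L) holomorphic_on strip" by (intro holomorphic_intros)
  have "((\<lambda>L. exp (- L) / \<psi> L / (L - 0)) has_contour_integral (2 * pi * \<i> * winding_number p 0 * (exp (- 0) / \<psi> 0))) p"
    by (rule Cauchy_integral_formula_convex_simple[OF strip_props(2) h])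
      (use strip_props p in \<open>auto simp: interior_open\<close>)
  then have "((\<lambda>L. exp (- L) / \<psi> L / (L - 0)) has_contour_integral (2 * of_real pi * \<i>)) p"
    using p(4) by (simp add: \<psi>_def d0)
  then show ?thesis
    by (rule has_contour_integral_eq) (use p(2) in \<open>auto simp: \<psi>_def z0\<close>)
qed

text \<open>The remainder integrates to zero by Cauchy's theorem, and the terms \<open>\<zeta> ^ (j - N - 1) d\<zeta>\<close> with \<open>j < N\<close> have a
single-valued primitive, so only the logarithmic derivative \<open>d\<zeta> / \<zeta>\<close> contributes.\<close>

lemma strip_contour_integral:
  assumes p: "valid_path p" "path_image p \<subseteq> strip - {0}" "pathfinish p = pathstart p" "winding_number p 0 = 1"
  shows "(strip_integrand a c N has_contour_integral
           (2 * of_real pi * \<i> * of_real (exp a * exp_coeff (log_coeff a c) N))) p"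
proof -
  obtain r where r: "r holomorphic_on strip"
    "\<And>L. L \<in> strip \<Longrightarrow> L \<noteq> 0 \<Longrightarrow> strip_integrand a c N L =
       exp (of_real a) * (\<Sum>j\<le>N. of_real (exp_coeff (log_coeff a c) j) * (zeta_map L ^ j * exp (- L) / zeta_map L ^ Suc N)) + r L"
    using strip_remainder_holomorphic[of a c N] by blast
  define T where "T j L = zeta_map L ^ j * exp (- L) / zeta_map L ^ Suc N" for j L
  define v where "v j = (if j = N then 2 * of_real pi * \<i> else 0)" for j
  have T: "(T j has_contour_integral v j) p" if j: "j \<le> N" for j
  proof (cases "j = N")
    case True
    have "((\<lambda>L. exp (- L) / zeta_map L) has_contour_integral v j) p"
      using contour_integral_log_derivative[OF p] True by (simp add: v_def)
    then show ?thesis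
    proof (rule has_contour_integral_eq)
      fix L assume "L \<in> path_image p"
      then have "zeta_map L \<noteq> 0" using zeta_map_eq_0 p(2) by auto
      then show "exp (- L) / zeta_map L = T j L" unfolding T_def True by (simp add: field_simps)
    qed
  next
    case False
    define m where "m = N - j"
    have m: "m > 0" "N = j + m" using j False by (auto simp: m_def)
    have "((\<lambda>L. exp (- L) / zeta_map L ^ Suc m) has_contour_integral 0) p"
    proof (rule Cauchy_theorem_primitive[OF _ p(1,2,3)])
      fix L assume L: "L \<in> strip - {0}"
      then have nz: "zeta_map L \<noteq> 0" using zeta_map_eq_0 by auto
      show "((\<lambda>L. - 1 / of_nat m * inverse (zeta_map L ^ m)) has_field_derivative exp (- L) / zeta_map L ^ Suc m) (at L within strip - {0})"
      proof -
        obtain k where k: "m = Suc k" using m(1) by (cases m) auto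
        show ?thesis
          by (rule DERIV_cong[OF DERIV_cmult[OF DERIV_inverse'[OF DERIV_power[OF zeta_map_deriv]]]])
            (use nz in \<open>simp_all add: k field_simps del: of_nat_Suc\<close>)
      qed
    qed
    then have "((\<lambda>L. exp (- L) / zeta_map L ^ Suc m) has_contour_integral v j) p"
      using False by (simp add: v_def)
    then show ?thesis
    proof (rule has_contour_integral_eq)
      fix L assume "L \<in> path_image p"
      then have "zeta_map L \<noteq> 0" using zeta_map_eq_0 p(2) by auto
      then show "exp (- L) / zeta_map L ^ Suc m = T j L"
        unfolding T_def m(2) by (simp add: power_add field_simps)
    qed
  qed
  have "((\<lambda>L. exp (of_real a) * (\<Sum>j\<le>N. of_real (exp_coeff (log_coeff a c) j) * T j L) + r L) has_contour_integral
      (exp (of_real a) * (\<Sum>j\<le>N. of_real (exp_coeff (log_coeff a c) j) * v j) + 0)) p"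
    by (intro has_contour_integral_add has_contour_integral_lmul has_contour_integral_sum T
        Cauchy_theorem_convex_simple[OF r(1) strip_props(2)]) (use p in auto)
  moreover have "(\<Sum>j\<le>N. of_real (exp_coeff (log_coeff a c) j) * v j) = of_real (exp_coeff (log_coeff a c) N) * (2 * of_real pi * \<i>)"
    unfolding v_def by (simp add: if_distrib cong: if_cong)
  ultimately have "((\<lambda>L. exp (of_real a) * (\<Sum>j\<le>N. of_real (exp_coeff (log_coeff a c) j) * T j L) + r L) has_contour_integral
      (2 * of_real pi * \<i> * of_real (exp a * exp_coeff (log_coeff a c) N))) p"
    by (simp add: mult_ac flip: exp_of_real)
  then show ?thesis
  proof (rule has_contour_integral_eq)
    fix L assume "L \<in> path_image p"
    then have L: "L \<in> strip" "L \<noteq> 0" using p(2) by auto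
    show "exp (of_real a) * (\<Sum>j\<le>N. of_real (exp_coeff (log_coeff a c) j) * T j L) + r L = strip_integrand a c N L"
      unfolding r(2)[OF L] T_def ..
  qed
qed

section \<open>The moments of the weight\<close>

lemma w_bound:
  assumes a: "a > 0" "c \<ge> 0" and s: "0 < s" "s < 1"
  shows "\<bar>w a c s\<bar> \<le> (1 - s) powr (- (a + c))"
proof -
  define e where "e = a * s + c"
  have e: "0 \<le> e" "e \<le> a + c" using a s by (auto simp: e_def mult_left_le)
  have "(s / (1 - s)) powr e = s powr e * (1 - s) powr (- e)"
    using s by (simp add: powr_divide powr_minus_divide)
  also have "\<dots> \<le> 1 * (1 - s) powr (- (a + c))"
  proof (rule mult_mono)
    show "s powr e \<le> 1" using s e by (simp add: powr_le1)
    show "(1 - s) powr (- e) \<le> (1 - s) powr (- (a + c))" using s e by (intro powr_mono') auto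
  qed auto
  finally have p: "(s / (1 - s)) powr e \<le> (1 - s) powr (- (a + c))" by simp
  have "\<bar>w a c s\<bar> = 1 / pi * (s / (1 - s)) powr e * \<bar>sin (pi * e)\<bar>"
    by (simp add: w_def e_def abs_mult)
  also have "\<dots> \<le> 1 * (1 - s) powr (- (a + c)) * 1"
    using p pi_ge_two by (intro mult_mono) auto
  finally show ?thesis by simp
qed

lemma w_continuous: "continuous_on {0<..<1} (w a c)"
proof -
  have "continuous_on {0<..<1} (\<lambda>s. 1 / pi * (s / (1 - s)) powr (a * s + c) * sin (pi * (a * s + c)))"
    by (intro continuous_intros) auto
  then show ?thesis by (simp add: w_def[abs_def])
qed

lemma one_minus_powr_integrable:
  fixes p :: real
  assumes "p > -1"
  shows "set_integrable lborel {0<..<1} (\<lambda>s. (1 - s) powr p)"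
proof -
  have "(\<lambda>x. x powr p) integrable_on {0<..<1}"
    using integrable_on_powr_from_0[of p 1] assms by (simp add: integrable_on_Icc_iff_Ioo)
  then have "(\<lambda>x. x powr p) absolutely_integrable_on {0<..<1::real}"
    by (intro nonnegative_absolutely_integrable_1) auto
  then have "integrable lebesgue (\<lambda>x. indicator {0<..<1} x * x powr p)"
    by (simp add: set_integrable_def)
  then have i: "integrable lborel (\<lambda>x. indicator {0<..<1} x * x powr p)"
    by (subst (asm) integrable_completion) auto
  have "integrable lborel (\<lambda>x. indicator {0<..<1} (1 + (-1) * x) * (1 + (-1) * x) powr p)"
    using lborel_integrable_real_affine[OF i, of "-1" 1] by simp
  moreover have "indicator {0<..<1} (1 + (-1) * x) = (indicator {0<..<1} x :: real)" for x :: real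
    by (auto simp: indicator_def)
  ultimately show ?thesis by (simp add: set_integrable_def)
qed

lemma w_moment_integrable:
  assumes a: "a > 0" "c \<ge> 0" "a + c < 3" and b: "continuous_on {0<..<1} b" "\<And>s. 0 < s \<Longrightarrow> s < 1 \<Longrightarrow> \<bar>b s\<bar> \<le> B * (1 - s)\<^sup>2"
  shows "set_integrable lborel {0<..<1} (\<lambda>s. w a c s * b s)"
proof (rule set_integrable_bound)
  define p where "p = 2 - (a + c)"
  show "set_integrable lborel {0<..<1} (\<lambda>s. B * (1 - s) powr p)"
    by (intro set_integrable_mult_right one_minus_powr_integrable) (use a in \<open>simp add: p_def\<close>)
  show "set_borel_measurable lborel {0<..<1} (\<lambda>s. w a c s * b s)"
    unfolding set_borel_measurable_def
    using borel_measurable_continuous_on_indicator[of "{0<..<1}" "\<lambda>s. w a c s * b s"]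
    by (simp add: continuous_on_mult w_continuous b(1))
  have "norm (w a c s * b s) \<le> norm (B * (1 - s) powr p)" if s: "s \<in> {0<..<1}" for s
  proof -
    have "\<bar>w a c s * b s\<bar> \<le> (1 - s) powr (- (a + c)) * (B * (1 - s)\<^sup>2)"
      unfolding abs_mult using w_bound[of a c s] b(2)[of s] a s by (intro mult_mono) auto
    also have "(1 - s)\<^sup>2 = (1 - s) powr 2" using s by simp
    also have "(1 - s) powr (- (a + c)) * (B * (1 - s) powr 2) = B * (1 - s) powr p"
    proof -
      have "p = - (a + c) + 2" by (simp add: p_def)
      then show ?thesis by (simp only: powr_add mult.left_commute)
    qed
    finally show ?thesis by simp
  qed
  then show "AE s\<in>{0<..<1} in lborel. norm (w a c s * b s) \<le> norm (B * (1 - s) powr p)" by simp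
qed

lemma pow_le_square: "2 \<le> n \<Longrightarrow> 0 \<le> x \<Longrightarrow> x \<le> 1 \<Longrightarrow> x ^ n \<le> (x::real)\<^sup>2"
  by (rule power_decreasing) auto

lemma w_power_integrable:
  assumes "a > 0" "c \<ge> 0" "a + c < 3" "n \<ge> 2"
  shows "set_integrable lborel {0<..<1} (\<lambda>s. w a c s * (1 - s) ^ n)"
proof (rule w_moment_integrable[OF assms(1-3), where B = 1])
  show "\<bar>(1 - s) ^ n\<bar> \<le> 1 * (1 - s)\<^sup>2" if "0 < s" "s < 1" for s :: real
    using pow_le_square[OF assms(4), of "1 - s"] that by simp
qed (intro continuous_intros)

lemma strip_integrand_cnj: "strip_integrand a c N (cnj L) = cnj (strip_integrand a c N L)"
  by (simp add: strip_integrand_def strip_fun_def zeta_map_def exp_cnj)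

lemma exp_Complex_pi: "exp (- Complex u pi) = - of_real (exp (- u))"
proof -
  have "- Complex u pi = of_real (- u) + (- (of_real pi * \<i>))" by (simp add: complex_eq_iff)
  then show ?thesis by (simp only: exp_add exp_minus exp_pi_i exp_of_real) simp
qed

text \<open>The point \<open>L = u + i \<pi>\<close> corresponds to \<open>y = - s\<close> on the cut, with \<open>s = 1 / (1 + exp u)\<close>, where the imaginary part of
\<open>F\<close> is \<open>- \<pi> * w a c s\<close>; the factor \<open>s * (1 - s)\<close> is \<open>- ds / du\<close>.\<close>

lemma strip_integrand_top:
  fixes u :: real
  defines "s \<equiv> 1 / (1 + exp u)"
  shows "Im (strip_integrand a c (Suc n) (Complex u pi)) = pi * (w a c s * (1 - s) ^ n) * (s * (1 - s))"
proof -
  have im: "Im (of_real r * z) = r * Im z" for r z by simp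
  have pos: "1 + exp u > 0" "1 + exp (- u) > 0" by (simp_all add: add_pos_pos)
  have s1: "1 - s = 1 / (1 + exp (- u))"
    using pos unfolding s_def by (simp add: exp_minus field_simps)
  have s2: "s = exp (- u) * (1 - s)" unfolding s1 using pos unfolding s_def by (simp add: exp_minus field_simps)
  have s3: "s / (1 - s) = exp (- u)" using s2 s1 pos by (metis nonzero_eq_divide_eq divide_eq_0_iff zero_neq_one less_irrefl)
  have z: "zeta_map (Complex u pi) = of_real (1 / (1 - s))"
    unfolding zeta_map_def exp_Complex_pi s1 by simp
  have "1 / zeta_map (Complex u pi) - 1 = of_real (- s)" unfolding z by simp
  moreover have "of_real a * Complex u pi * of_real (- s) - of_real c * Complex u pi = of_real (- (a * s + c)) * Complex u pi"
    by (simp add: algebra_simps)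
  ultimately have "strip_fun a c (Complex u pi) = exp (of_real (- (a * s + c)) * Complex u pi)"
    unfolding strip_fun_def by (simp only:)
  also have "of_real (- (a * s + c)) * Complex u pi = Complex (- (a * s + c) * u) (- (pi * (a * s + c)))"
    by (simp add: complex_eq_iff) (simp add: algebra_simps)
  finally have g: "strip_fun a c (Complex u pi) = exp (Complex (- (a * s + c) * u) (- (pi * (a * s + c))))" .
  have "strip_integrand a c (Suc n) (Complex u pi) = of_real (- exp (- u) * (1 - s) ^ Suc (Suc n)) * strip_fun a c (Complex u pi)"
    unfolding strip_integrand_def exp_Complex_pi z by (simp add: power_divide)
  then have "Im (strip_integrand a c (Suc n) (Complex u pi)) = - exp (- u) * (1 - s) ^ Suc (Suc n) * Im (strip_fun a c (Complex u pi))"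
    by (simp only: im)
  also have "Im (strip_fun a c (Complex u pi)) = - (exp (- (a * s + c) * u) * sin (pi * (a * s + c)))"
    unfolding g by (simp add: Im_exp)
  also have "exp (- (a * s + c) * u) = (s / (1 - s)) powr (a * s + c)"
    unfolding s3 powr_def by (simp add: algebra_simps)
  also have "- exp (- u) * (1 - s) ^ Suc (Suc n) * - ((s / (1 - s)) powr (a * s + c) * sin (pi * (a * s + c)))
     = pi * (w a c s * (1 - s) ^ n) * (exp (- u) * (1 - s) * (1 - s))"
    by (simp add: w_def)
  finally show ?thesis by (simp only: s2[symmetric])
qed

text \<open>On the right side \<open>exp (- L)\<close> is small and \<open>zeta_map L\<close> is close to \<open>1\<close>; on the left side \<open>zeta_map L\<close> grows like
\<open>exp R\<close> and \<open>strip_fun a c L\<close> at most like \<open>exp ((a + c) * R)\<close>. The constant \<open>10\<close> bounds \<open>2 * norm L * exp (- R)\<close>, using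
\<open>norm L \<le> R + 4 \<le> 5 * R \<le> 5 * exp R\<close>.\<close>

lemma strip_integrand_side_bound:
  assumes a: "a > 0" "c \<ge> 0" and L: "\<bar>Re L\<bar> = R" "R \<ge> 1" "\<bar>Im L\<bar> \<le> pi"
  shows "norm (strip_integrand a c N L) \<le> exp (10 * a) * 2 ^ Suc N * (exp (- R) + exp ((a + c - real N) * R))"
proof -
  have Lb: "norm L * (2 * exp (- R)) \<le> 10"
  proof -
    have "norm L \<le> R + 4" using cmod_le[of L] L pi_less_4 by linarith
    moreover have "R + 4 \<le> 5 * R" using L by simp
    moreover have "R \<le> exp R" using exp_gt_self[of R] by simp
    ultimately have "norm L \<le> 5 * exp R" by linarith
    then have "norm L * (2 * exp (- R)) \<le> 5 * exp R * (2 * exp (- R))" by (intro mult_right_mono) auto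
    then show ?thesis by (simp add: exp_minus)
  qed
  have e2: "exp R \<ge> 2" using exp_ge_add_one_self[of R] L by linarith
  have em: "exp (- R) \<le> 1 / 2" using e2 by (simp add: exp_minus field_simps)
  have nz: "zeta_map L \<noteq> 0"
  proof (rule zeta_map_eq_0)
    have "pi < 2 * pi" by simp
    then show "L \<in> strip" using L unfolding strip_def by (auto intro: le_less_trans)
  qed (use L in auto)
  have ne: "norm (exp (- L)) = exp (- Re L)" by simp
  have fb: "norm (strip_integrand a c N L) = exp (Re (of_real a * L * (1 / zeta_map L - 1) - of_real c * L)) * exp (- Re L) / norm (zeta_map L) ^ Suc N"
    unfolding strip_integrand_def strip_fun_def by (simp add: norm_divide norm_mult norm_power)
  show ?thesis
  proof (cases "Re L \<ge> 0")
    case True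
    then have R: "Re L = R" using L by simp
    have zn: "norm (zeta_map L) \<ge> 1 / 2"
      using norm_triangle_ineq2[of 1 "exp (- L)"] em unfolding zeta_map_def by (simp add: R)
    have "1 / zeta_map L - 1 = exp (- L) / zeta_map L" using nz by (simp add: zeta_map_def field_simps)
    then have "norm (1 / zeta_map L - 1) = exp (- R) / norm (zeta_map L)" by (simp add: norm_divide R)
    also have "\<dots> \<le> exp (- R) / (1 / 2)" using zn by (intro divide_left_mono) auto
    finally have "norm (1 / zeta_map L - 1) \<le> 2 * exp (- R)" by simp
    then have "norm (L * (1 / zeta_map L - 1)) \<le> norm L * (2 * exp (- R))"
      unfolding norm_mult by (intro mult_left_mono) auto
    then have "Re (L * (1 / zeta_map L - 1)) \<le> 10"
      using Lb complex_Re_le_cmod[of "L * (1 / zeta_map L - 1)"] by linarith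
    then have "a * Re (L * (1 / zeta_map L - 1)) \<le> a * 10" using a by (intro mult_left_mono) auto
    moreover have "c * Re L \<ge> 0" using a True by simp
    moreover have "Re (of_real a * L * (1 / zeta_map L - 1) - of_real c * L) = a * Re (L * (1 / zeta_map L - 1)) - c * Re L"
      by (simp add: mult.assoc)
    ultimately have "Re (of_real a * L * (1 / zeta_map L - 1) - of_real c * L) \<le> 10 * a" by linarith
    then have "norm (strip_integrand a c N L) \<le> exp (10 * a) * exp (- R) / (1 / 2) ^ Suc N"
      unfolding fb R using zn by (intro frac_le mult_mono power_mono) auto
    also have "\<dots> = exp (10 * a) * 2 ^ Suc N * exp (- R)" by (simp add: power_divide)
    also have "\<dots> \<le> exp (10 * a) * 2 ^ Suc N * (exp (- R) + exp ((a + c - real N) * R))"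
      by (intro mult_left_mono) auto
    finally show ?thesis .
  next
    case False
    then have R: "Re L = - R" using L by simp
    have zn: "norm (zeta_map L) \<ge> exp R / 2"
      using norm_triangle_ineq2[of "exp (- L)" 1] e2 unfolding zeta_map_def
      by (simp add: R norm_minus_commute)
    have "norm (1 / zeta_map L) = 1 / norm (zeta_map L)" by (simp add: norm_divide)
    also have "\<dots> \<le> 1 / (exp R / 2)" using zn by (intro divide_left_mono mult_pos_pos) (auto intro: less_le_trans[of 0 "exp R / 2"])
    finally have "norm (1 / zeta_map L) \<le> 2 * exp (- R)" by (simp add: exp_minus field_simps)
    then have "norm (L * (1 / zeta_map L)) \<le> norm L * (2 * exp (- R))"
      unfolding norm_mult by (intro mult_left_mono) auto
    then have "Re (L * (1 / zeta_map L)) \<le> 10"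
      using Lb complex_Re_le_cmod[of "L * (1 / zeta_map L)"] by linarith
    then have "a * Re (L * (1 / zeta_map L)) \<le> a * 10" using a by (intro mult_left_mono) auto
    moreover have "Re (of_real a * L * (1 / zeta_map L - 1) - of_real c * L) = a * Re (L * (1 / zeta_map L)) - a * Re L - c * Re L"
    proof -
      have "of_real a * L * (1 / zeta_map L - 1) - of_real c * L = of_real a * (L * (1 / zeta_map L)) - of_real a * L - of_real c * L"
        by (simp add: algebra_simps)
      moreover have "Re (of_real a * X - of_real a * L - of_real c * L) = a * Re X - a * Re L - c * Re L" for X by simp
      ultimately show ?thesis by (simp only:)
    qed
    ultimately have "Re (of_real a * L * (1 / zeta_map L - 1) - of_real c * L) \<le> 10 * a + (a + c) * R"
      by (simp add: R algebra_simps)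
    then have "norm (strip_integrand a c N L) \<le> exp (10 * a + (a + c) * R) * exp R / (exp R / 2) ^ Suc N"
      unfolding fb R using zn by (intro frac_le mult_mono power_mono) auto
    also have "\<dots> = exp (10 * a) * 2 ^ Suc N * exp ((a + c - real N) * R)"
    proof -
      have "exp R ^ Suc N = exp (real (Suc N) * R)" by (rule exp_of_nat_mult[symmetric])
      moreover have "exp (10 * a + (a + c) * R) * exp R = exp (10 * a) * exp ((a + c - real N) * R) * exp (real (Suc N) * R)"
        by (simp add: exp_add[symmetric] algebra_simps)
      ultimately show ?thesis by (simp add: power_divide del: power_Suc of_nat_Suc)
    qed
    also have "\<dots> \<le> exp (10 * a) * 2 ^ Suc N * (exp (- R) + exp ((a + c - real N) * R))"
      by (intro mult_left_mono) auto
    finally show ?thesis .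
  qed
qed

text \<open>Integrate around the rectangle with corners \<open>\<pm> R \<pm> i \<pi>\<close>. The integrals over the two horizontal edges are complex conjugates,
so together they give the imaginary part along the top edge, which the substitution \<open>s = 1 / (1 + exp u)\<close> turns into the moment over
\<open>[1 / (1 + exp R), 1 / (1 + exp (- R))]\<close>. The vertical edges vanish as \<open>R \<rightarrow> \<infinity>\<close> because \<open>n + 1 \<ge> 3 > a + c\<close>.\<close>

lemma w_power_moment:
  assumes a: "a > 0" "c \<ge> 0" "a + c < 3" and n: "n \<ge> 2"
  shows "(LBINT s:{0<..<1}. w a c s * (1 - s) ^ n) = exp a * dcoeff a c n"
proof -
  define \<phi> where "\<phi> s = w a c s * (1 - s) ^ n" for s
  define W where "W x = integral {0..x} \<phi>" for x
  define N where "N = Suc n"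
  define f where "f = strip_integrand a c N"
  define \<sigma> where "\<sigma> u = 1 / (1 + exp u)" for u :: real
  define H where "H = exp a * exp_coeff (log_coeff a c) N"
  define B where "B R = exp (10 * a) * 2 ^ Suc N * (exp (- R) + exp ((a + c - real N) * R))" for R :: real
  have si: "set_integrable lborel {0<..<1} \<phi>" unfolding \<phi>_def by (rule w_power_integrable[OF a n])
  then have "\<phi> integrable_on {0<..<1}" by (rule set_borel_integral_eq_integral(1))
  then have \<phi>i: "\<phi> integrable_on {0..1}" by (simp add: integrable_on_Icc_iff_Ioo)
  have L1: "(LBINT s:{0<..<1}. \<phi> s) = W 1"
    using set_borel_integral_eq_integral(2)[OF si] by (simp add: W_def integral_open_interval_real)
  have Wc: "continuous_on {0..1} W" unfolding W_def by (rule indefinite_integral_continuous_1[OF \<phi>i])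
  have \<sigma>01: "0 < \<sigma> u" "\<sigma> u < 1" for u by (simp_all add: \<sigma>_def add_pos_pos)
  have Wd: "(W has_real_derivative \<phi> s) (at s)" if s: "0 < s" "s < 1" for s
  proof -
    have "continuous_on {0<..<1} \<phi>" unfolding \<phi>_def by (intro continuous_intros w_continuous)
    then have "isCont \<phi> s" using s by (simp add: continuous_on_eq_continuous_at)
    then have "continuous (at s within {0..1} - {}) \<phi>" by (rule continuous_at_imp_continuous_within)
    then have "((\<lambda>u. integral {0..u} \<phi>) has_vector_derivative \<phi> s) (at s within {0..1} - {})"
      by (intro integral_has_vector_derivative_continuous_at[OF \<phi>i]) (use s in auto)
    then show ?thesis
      using s by (simp add: W_def[abs_def] has_real_derivative_iff_has_vector_derivative at_within_Icc_at)
  qed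
  have \<sigma>d: "(\<sigma> has_real_derivative - (\<sigma> u * (1 - \<sigma> u))) (at u)" for u
  proof -
    have "1 + exp u > 0" by (simp add: add_pos_pos)
    then have "1 + exp u \<noteq> 0" by simp
    then show ?thesis unfolding \<sigma>_def by (auto intro!: derivative_eq_intros simp: field_simps power2_eq_square)
  qed
  have main: "\<bar>H + (W (\<sigma> (- R)) - W (\<sigma> R))\<bar> \<le> 2 * B R" if R: "R \<ge> 1" for R
  proof -
    define p1 p2 p3 p4 where p: "p1 = Complex (- R) (- pi)" "p2 = Complex R (- pi)" "p3 = Complex R pi" "p4 = Complex (- R) pi"
    have in_strip: "L \<in> strip - {0}" if "\<bar>Im L\<bar> \<le> pi" "\<bar>Im L\<bar> = pi \<or> \<bar>Re L\<bar> = R" for L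
    proof -
      have "pi < 2 * pi" by simp
      with that(1) have "\<bar>Im L\<bar> < 2 * pi" by linarith
      moreover have "L \<noteq> 0" using that(2) R by auto
      ultimately show ?thesis by (simp add: strip_def)
    qed
    have seg: "closed_segment p1 p2 \<subseteq> strip - {0}" "closed_segment p2 p3 \<subseteq> strip - {0}"
      "closed_segment p3 p4 \<subseteq> strip - {0}" "closed_segment p4 p1 \<subseteq> strip - {0}"
      unfolding p using R by (auto intro!: in_strip simp: closed_segment_same_Re closed_segment_same_Im closed_segment_eq_real_ivl simp del: Diff_iff)
    have fc: "continuous_on S f" if "S \<subseteq> strip - {0}" for S
      unfolding f_def using holomorphic_on_imp_continuous_on[OF strip_integrand_holomorphic] that by (rule continuous_on_subset)
    have ci: "f contour_integrable_on linepath x y" if "closed_segment x y \<subseteq> strip - {0}" for x y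
      by (rule contour_integrable_continuous_linepath[OF fc[OF that]])
    have rp: "rectpath p1 p3 = linepath p1 p2 +++ linepath p2 p3 +++ linepath p3 p4 +++ linepath p4 p1"
      by (simp add: rectpath_def p Let_def)
    have "(f has_contour_integral (2 * of_real pi * \<i> * of_real H)) (rectpath p1 p3)"
      unfolding f_def H_def
    proof (rule strip_contour_integral)
      show "path_image (rectpath p1 p3) \<subseteq> strip - {0}"
        unfolding rp using seg by (simp add: path_image_join)
      show "winding_number (rectpath p1 p3) 0 = 1"
        by (rule winding_number_rectpath) (use R in \<open>simp add: p in_box_complex_iff\<close>)
    qed simp_all
    then have "contour_integral (rectpath p1 p3) f = 2 * of_real pi * \<i> * of_real H" by (rule contour_integral_unique)
    then have sum4: "contour_integral (linepath p1 p2) f + (contour_integral (linepath p2 p3) f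
        + (contour_integral (linepath p3 p4) f + contour_integral (linepath p4 p1) f)) = 2 * of_real pi * \<i> * of_real H"
      unfolding rp using ci seg by (simp add: contour_integrable_join)
    have side: "norm (contour_integral (linepath x y) f) \<le> B R * (2 * pi)"
      if "(x, y) = (p2, p3) \<or> (x, y) = (p4, p1)" for x y
    proof -
      have "norm (contour_integral (linepath x y) f) \<le> B R * norm (y - x)"
      proof (rule contour_integral_bound_linepath)
        show "f contour_integrable_on linepath x y" using ci seg that by auto
        show "0 \<le> B R" by (simp add: B_def)
        fix L assume "L \<in> closed_segment x y"
        then have "\<bar>Re L\<bar> = R" "\<bar>Im L\<bar> \<le> pi"
          using that R pi_gt_zero by (auto simp: p closed_segment_same_Re closed_segment_eq_real_ivl split: if_splits)
        then show "norm (f L) \<le> B R" unfolding f_def B_def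
          by (intro strip_integrand_side_bound) (use a R in auto)
      qed
      also have "norm (y - x) = 2 * pi"
        using that by (auto simp: p cmod_def real_sqrt_mult)
      finally show ?thesis .
    qed
    define J where "J = contour_integral (linepath p4 p3) f"
    have "(f has_contour_integral J) (linepath p4 p3)"
      unfolding J_def using ci[of p4 p3] seg(3) by (simp add: has_contour_integral_integral closed_segment_commute)
    then have hJ: "((\<lambda>x. f (linepath p4 p3 x) * (p3 - p4)) has_integral J) {0..1}"
      by (simp add: has_contour_integral_linepath)
    have l43: "linepath p4 p3 x = Complex (2 * R * x - R) pi" for x
      by (simp add: p linepath_def complex_eq_iff algebra_simps)
    have "contour_integral (linepath p3 p4) f = - J"
      unfolding J_def by (rule contour_integral_reverse_linepath[OF fc[OF seg(3)]])
    moreover have "contour_integral (linepath p1 p2) f = cnj J"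
    proof (rule contour_integral_unique)
      have "(cnj \<circ> (\<lambda>x. f (linepath p4 p3 x) * (p3 - p4)) has_integral cnj J) {0..1}"
        using hJ by (simp only: has_integral_cnj)
      moreover have "cnj \<circ> (\<lambda>x. f (linepath p4 p3 x) * (p3 - p4)) = (\<lambda>x. f (linepath p1 p2 x) * (p2 - p1))"
      proof
        fix x
        have "linepath p1 p2 x = cnj (linepath p4 p3 x)" "p2 - p1 = cnj (p3 - p4)"
          by (simp_all add: p linepath_def complex_eq_iff)
        then show "(cnj \<circ> (\<lambda>x. f (linepath p4 p3 x) * (p3 - p4))) x = f (linepath p1 p2 x) * (p2 - p1)"
          by (simp add: f_def strip_integrand_cnj)
      qed
      ultimately show "(f has_contour_integral cnj J) (linepath p1 p2)" by (simp add: has_contour_integral_linepath)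
    qed
    ultimately have "2 * of_real pi * \<i> * of_real H - (cnj J - J) = contour_integral (linepath p2 p3) f + contour_integral (linepath p4 p1) f"
      using sum4 by (simp add: algebra_simps)
    then have "norm (2 * of_real pi * \<i> * of_real H - (cnj J - J)) \<le> B R * (2 * pi) + B R * (2 * pi)"
      using norm_triangle_le[OF add_mono[OF side[of p2 p3] side[of p4 p1]]] by simp
    moreover have "2 * of_real pi * \<i> * of_real H - (cnj J - J) = of_real (2 * (pi * H + Im J)) * \<i>"
      by (simp add: complex_eq_iff)
    ultimately have bnd: "\<bar>2 * (pi * H + Im J)\<bar> \<le> B R * (2 * pi) + B R * (2 * pi)"
      by (simp only: norm_mult norm_of_real norm_ii mult_1_right)
    \<comment> \<open>The imaginary part along the top edge has the primitive - pi * W o sigma, which carries out the substitution.\<close>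
    have "((\<lambda>x. Im (f (linepath p4 p3 x) * (p3 - p4))) has_integral Im J) {0..1}"
      using has_integral_linear[OF hJ bounded_linear_Im] by (simp add: o_def)
    moreover have "((\<lambda>x. Im (f (linepath p4 p3 x) * (p3 - p4))) has_integral
       ((- pi * W (\<sigma> (2 * R * 1 - R))) - (- pi * W (\<sigma> (2 * R * 0 - R))))) {0..1}"
    proof (rule fundamental_theorem_of_calculus)
      fix x :: real
      let ?s = "\<sigma> (2 * R * x - R)"
      have d1: "((\<lambda>x. 2 * R * x - R) has_real_derivative 2 * R) (at x)" by (auto intro!: derivative_eq_intros)
      have "((\<lambda>x. - pi * W (\<sigma> (2 * R * x - R))) has_real_derivative
          - pi * (\<phi> ?s * (- (?s * (1 - ?s)) * (2 * R)))) (at x)"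
        by (rule DERIV_cmult[OF DERIV_chain2[OF Wd[OF \<sigma>01] DERIV_chain2[OF \<sigma>d d1]]])
      moreover have "- pi * (\<phi> ?s * (- (?s * (1 - ?s)) * (2 * R))) = Im (f (linepath p4 p3 x) * (p3 - p4))"
      proof -
        have "p3 - p4 = of_real (2 * R)" by (simp add: p complex_eq_iff)
        then have "Im (f (linepath p4 p3 x) * (p3 - p4)) = Im (f (linepath p4 p3 x)) * (2 * R)" by simp
        also have "Im (f (linepath p4 p3 x)) = pi * \<phi> ?s * (?s * (1 - ?s))"
          unfolding f_def N_def l43 strip_integrand_top \<phi>_def \<sigma>_def ..
        finally show ?thesis by simp
      qed
      ultimately have "((\<lambda>x. - pi * W (\<sigma> (2 * R * x - R))) has_real_derivative
          Im (f (linepath p4 p3 x) * (p3 - p4))) (at x within {0..1})"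
        using has_field_derivative_at_within by fastforce
      then show "((\<lambda>x. - pi * W (\<sigma> (2 * R * x - R))) has_vector_derivative
          Im (f (linepath p4 p3 x) * (p3 - p4))) (at x within {0..1})"
        by (simp only: has_real_derivative_iff_has_vector_derivative)
    qed simp
    ultimately have "Im J = (- pi * W (\<sigma> (2 * R * 1 - R))) - (- pi * W (\<sigma> (2 * R * 0 - R)))"
      by (rule has_integral_unique)
    then have eq: "2 * (pi * H + Im J) = 2 * pi * (H + (W (\<sigma> (- R)) - W (\<sigma> R)))"
      by (simp add: algebra_simps)
    define X where "X = H + (W (\<sigma> (- R)) - W (\<sigma> R))"
    have "\<bar>2 * pi * X\<bar> \<le> B R * (2 * pi) + B R * (2 * pi)"
      using bnd unfolding eq X_def .
    then have "(2 * pi) * \<bar>X\<bar> \<le> (2 * pi) * (2 * B R)"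
      by (simp add: abs_mult algebra_simps)
    then have "\<bar>X\<bar> \<le> 2 * B R" by (rule mult_left_le_imp_le) simp
    then show ?thesis by (simp only: X_def)
  qed
  have NR: "a + c - real N < 0" using a n by (simp add: N_def)
  have e0: "((\<lambda>R. exp (k * R)) \<longlongrightarrow> 0) at_top" if "k < 0" for k :: real
    by (rule filterlim_compose[OF exp_at_bot])
      (use that filterlim_tendsto_neg_mult_at_bot[OF tendsto_const _ filterlim_ident] in auto)
  have "((\<lambda>R. 2 * B R) \<longlongrightarrow> 2 * (exp (10 * a) * 2 ^ Suc N * (0 + 0))) at_top"
    unfolding B_def using e0[of "-1", simplified] e0[OF NR] by (intro tendsto_intros) auto
  then have B0: "((\<lambda>R. 2 * B R) \<longlongrightarrow> 0) at_top" by simp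
  have "((\<lambda>R. H + (W (\<sigma> (- R)) - W (\<sigma> R))) \<longlongrightarrow> H + (W 1 - W 0)) at_top"
  proof (intro tendsto_intros)
    have "((\<lambda>R::real. 1 / (1 + exp (- R))) \<longlongrightarrow> 1 / (1 + 0)) at_top"
      by (rule tendsto_divide[OF tendsto_const tendsto_add[OF tendsto_const e0[of "-1", simplified]]]) simp
    then have s1: "((\<lambda>R. \<sigma> (- R)) \<longlongrightarrow> 1) at_top" by (simp add: \<sigma>_def)
    show "((\<lambda>R. W (\<sigma> (- R))) \<longlongrightarrow> W 1) at_top"
      by (rule continuous_on_tendsto_compose[OF Wc s1]) (use \<sigma>01 in \<open>auto intro!: always_eventually less_imp_le\<close>)
    have "((\<lambda>R. 1 - \<sigma> (- R)) \<longlongrightarrow> 1 - 1) at_top" by (intro tendsto_intros s1)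
    moreover have "1 - \<sigma> (- R) = \<sigma> R" for R
    proof -
      have "1 + exp R > 0" "1 + exp (- R) > 0" by (simp_all add: add_pos_pos)
      then show ?thesis by (simp add: \<sigma>_def exp_minus field_simps)
    qed
    ultimately have s0: "(\<sigma> \<longlongrightarrow> 0) at_top" by simp
    show "((\<lambda>R. W (\<sigma> R)) \<longlongrightarrow> W 0) at_top"
      by (rule continuous_on_tendsto_compose[OF Wc s0]) (use \<sigma>01 in \<open>auto intro!: always_eventually less_imp_le\<close>)
  qed
  moreover have "((\<lambda>R. H + (W (\<sigma> (- R)) - W (\<sigma> R))) \<longlongrightarrow> 0) at_top"
    by (rule Lim_null_comparison[OF _ B0]) (use main in \<open>auto intro!: eventually_at_top_linorderI[of 1]\<close>)
  ultimately have "H + (W 1 - W 0) = 0" by (rule tendsto_unique[rotated]) simp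
  then have "W 1 = - H" by (simp add: W_def)
  then show ?thesis using L1 by (simp add: \<phi>_def H_def N_def dcoeff_def del: exp_coeff.simps)
qed

lemma dcoeff_0: "dcoeff a c 0 = q1 a c"
  by (simp add: dcoeff_def log_coeff_def q1_def)

lemma dcoeff_1: "dcoeff a c (Suc 0) = q1 a c - q2 a c"
  by (simp add: dcoeff_def log_coeff_def q1_def q2_def field_simps power2_eq_square)

text \<open>The bracket in \<open>D\<close> is the exponential series in \<open>(1 - s) * t\<close> without its first two terms, so only the moments of order
at least two occur; the first two coefficients are the explicit terms of \<open>D\<close>.\<close>

lemma D_eq_Dser:
  assumes a: "a > 0" "c \<ge> 0" "a + c < 3"
  shows "D a c t = Dser a c t"
proof -
  let ?S = "{0<..<1::real}"
  define f where "f n s = indicator ?S s * (w a c s * (1 - s) ^ (n + 2) * (t ^ (n + 2) / fact (n + 2)))" for n and s :: real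
  have iw: "integrable lborel (\<lambda>s. indicator ?S s * (w a c s * (1 - s) ^ m))" if "m \<ge> 2" for m
    using w_power_integrable[OF a that] by (simp add: set_integrable_def)
  have A1: "integrable lborel (f n)" for n
    unfolding f_def using integrable_mult_left[OF iw[of "n + 2"], of "t ^ (n + 2) / fact (n + 2)"] by (simp add: mult.assoc)
  define C where "C = (LINT s|lborel. \<bar>indicator ?S s * (w a c s * (1 - s)\<^sup>2)\<bar>)"
  have sx: "summable (\<lambda>n. x ^ (n + 2) / fact (n + 2))" for x :: real
    using summable_ignore_initial_segment[OF summable_exp[of x], of 2] by (simp add: field_simps)
  have ab: "norm (f n s) = \<bar>indicator ?S s * (w a c s * (1 - s) ^ (n + 2))\<bar> * (\<bar>t\<bar> ^ (n + 2) / fact (n + 2))" for n s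
    unfolding f_def by (simp add: abs_mult power_abs mult.assoc)
  have le: "\<bar>indicator ?S s * (w a c s * (1 - s) ^ (n + 2))\<bar> \<le> \<bar>indicator ?S s * (w a c s * (1 - s)\<^sup>2)\<bar>" for n s
    using pow_le_square[of "n + 2" "1 - s"] by (auto simp: abs_mult indicator_def intro!: mult_left_mono)
  have A2: "AE s in lborel. summable (\<lambda>n. norm (f n s))"
  proof (intro always_eventually allI)
    fix s
    show "summable (\<lambda>n. norm (f n s))"
    proof (rule summable_comparison_test'[where N = 0])
      show "summable (\<lambda>n. \<bar>indicator ?S s * (w a c s * (1 - s)\<^sup>2)\<bar> * (\<bar>t\<bar> ^ (n + 2) / fact (n + 2)))"
        by (intro summable_mult sx)
      show "norm (norm (f n s)) \<le> \<bar>indicator ?S s * (w a c s * (1 - s)\<^sup>2)\<bar> * (\<bar>t\<bar> ^ (n + 2) / fact (n + 2))" for n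
      proof -
        have "norm (f n s) \<le> \<bar>indicator ?S s * (w a c s * (1 - s)\<^sup>2)\<bar> * (\<bar>t\<bar> ^ (n + 2) / fact (n + 2))"
          unfolding ab using le by (intro mult_right_mono) auto
        then show ?thesis by simp
      qed
    qed
  qed
  have A3: "summable (\<lambda>n. LINT s|lborel. norm (f n s))"
  proof (rule summable_comparison_test'[where N = 0])
    show "summable (\<lambda>n. C * (\<bar>t\<bar> ^ (n + 2) / fact (n + 2)))" by (intro summable_mult sx)
    fix n
    have "(LINT s|lborel. norm (f n s)) = (LINT s|lborel. \<bar>indicator ?S s * (w a c s * (1 - s) ^ (n + 2))\<bar>) * (\<bar>t\<bar> ^ (n + 2) / fact (n + 2))"
      unfolding ab by (rule integral_mult_left_zero)
    also have "\<dots> \<le> C * (\<bar>t\<bar> ^ (n + 2) / fact (n + 2))"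
      unfolding C_def using le iw[of "n + 2"] iw[of 2] by (intro mult_right_mono integral_mono integrable_abs) auto
    finally show "norm (LINT s|lborel. norm (f n s)) \<le> C * (\<bar>t\<bar> ^ (n + 2) / fact (n + 2))"
      by (simp add: integral_nonneg_AE)
  qed
  have sumf: "(\<Sum>n. f n s) = indicator ?S s * (w a c s * (exp ((1 - s) * t) - 1 - (1 - s) * t))" for s
  proof -
    define x where "x = (1 - s) * t"
    have "(\<lambda>n. x ^ n / fact n) sums exp x" using exp_converges[of x] by (simp add: field_simps)
    from sums_split_initial_segment[OF this, of 2]
    have "(\<lambda>n. x ^ (n + 2) / fact (n + 2)) sums (exp x - 1 - x)" by (simp add: numeral_2_eq_2 diff_diff_eq)
    then have "(\<lambda>n. indicator ?S s * w a c s * (x ^ (n + 2) / fact (n + 2))) sums (indicator ?S s * w a c s * (exp x - 1 - x))"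
      by (rule sums_mult)
    moreover have "indicator ?S s * w a c s * (x ^ (n + 2) / fact (n + 2)) = f n s" for n
      unfolding f_def x_def power_mult_distrib by simp
    ultimately have "(\<lambda>n. f n s) sums (indicator ?S s * w a c s * (exp x - 1 - x))" by simp
    then show ?thesis by (simp add: sums_iff x_def mult.assoc)
  qed
  have "(\<lambda>n. integral\<^sup>L lborel (f n)) sums (LINT s|lborel. (\<Sum>n. f n s))"
    by (rule sums_integral[OF A1 A2 A3])
  moreover have "integral\<^sup>L lborel (f n) = exp a * dcoeff a c (n + 2) * (t ^ (n + 2) / fact (n + 2))" for n
  proof -
    have "integral\<^sup>L lborel (f n) = (LINT s|lborel. indicator ?S s * (w a c s * (1 - s) ^ (n + 2))) * (t ^ (n + 2) / fact (n + 2))"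
      unfolding f_def mult.assoc[symmetric] by (rule integral_mult_left_zero)
    also have "(LINT s|lborel. indicator ?S s * (w a c s * (1 - s) ^ (n + 2))) = exp a * dcoeff a c (n + 2)"
      using w_power_moment[OF a, of "n + 2"] by (simp add: set_lebesgue_integral_def)
    finally show ?thesis .
  qed
  moreover have "(LINT s|lborel. (\<Sum>n. f n s)) = (LBINT s:?S. w a c s * (exp ((1 - s) * t) - 1 - (1 - s) * t))"
    unfolding sumf by (simp add: set_lebesgue_integral_def)
  ultimately have "(\<lambda>n. exp a * dcoeff a c (n + 2) * (t ^ (n + 2) / fact (n + 2))) sums
      (LBINT s:?S. w a c s * (exp ((1 - s) * t) - 1 - (1 - s) * t))" by simp
  then have "(\<lambda>n. exp (- a) * (exp a * dcoeff a c (n + 2) * (t ^ (n + 2) / fact (n + 2)))) sums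
      (exp (- a) * (LBINT s:?S. w a c s * (exp ((1 - s) * t) - 1 - (1 - s) * t)))" by (rule sums_mult)
  moreover have "exp (- a) * (exp a * dcoeff a c (n + 2) * (t ^ (n + 2) / fact (n + 2))) = dcoeff a c (n + 2) / fact (n + 2) * t ^ (n + 2)" for n
    by (simp add: exp_minus field_simps)
  ultimately have s2: "(\<lambda>n. dcoeff a c (n + 2) / fact (n + 2) * t ^ (n + 2)) sums
      (exp (- a) * (LBINT s:?S. w a c s * (exp ((1 - s) * t) - 1 - (1 - s) * t)))" by (simp only:)
  have "(\<lambda>n. dcoeff a c (n + 2) / fact (n + 2) * t ^ (n + 2)) sums (egf (dcoeff a c) t - (\<Sum>n<2. dcoeff a c n / fact n * t ^ n))"
    by (rule sums_split_initial_segment[OF egf_sums[OF tame_dcoeff]])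
  then have "exp (- a) * (LBINT s:?S. w a c s * (exp ((1 - s) * t) - 1 - (1 - s) * t)) =
     egf (dcoeff a c) t - (\<Sum>n<2. dcoeff a c n / fact n * t ^ n)"
    using s2 sums_unique2 by blast
  moreover have "(\<Sum>n<2. dcoeff a c n / fact n * t ^ n) = q1 a c + (q1 a c - q2 a c) * t"
    by (simp add: numeral_2_eq_2 dcoeff_0 dcoeff_1)
  ultimately show ?thesis unfolding D_def Dser_def by simp
qed

section \<open>Bounds on the parameters and positivity at infinity\<close>

lemma w_nonneg:
  assumes "0 < s" "s < 1" "0 \<le> a * s + c" "a * s + c \<le> 1"
  shows "w a c s \<ge> 0"
proof -
  have "sin (pi * (a * s + c)) \<ge> 0"
    using assms by (intro sin_ge_zero) (auto simp: mult_left_le)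
  then show ?thesis by (simp add: w_def)
qed

lemma exp_remainder_nonneg: "0 \<le> exp x - 1 - (x::real)"
  using exp_ge_add_one_self[of x] by linarith

lemma exp_remainder_mono:
  assumes "0 \<le> x" "x \<le> (y::real)"
  shows "exp x - 1 - x \<le> exp y - 1 - y"
proof (rule DERIV_nonneg_imp_nondecreasing[OF assms(2)])
  fix z assume "x \<le> z"
  then have "exp z - 1 \<ge> 0" using assms by simp
  moreover have "((\<lambda>x. exp x - 1 - x) has_real_derivative exp z - 1) (at z)"
    by (auto intro!: derivative_eq_intros)
  ultimately show "\<exists>d. ((\<lambda>x. exp x - 1 - x) has_real_derivative d) (at z) \<and> 0 \<le> d" by blast
qed

lemma exp_remainder_le:
  assumes "0 \<le> (x::real)"
  shows "exp x - 1 - x \<le> x\<^sup>2 * exp x"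
proof -
  have "exp x - x \<le> 1 + x * (exp x - 1)" 
  proof -
    have "1 - x \<le> exp (- x)" using exp_ge_add_one_self[of "- x"] by simp
    then have "(1 - x) * exp x \<le> exp (- x) * exp x" by (intro mult_right_mono) auto
    then show ?thesis by (simp add: exp_minus algebra_simps)
  qed
  also have "x * (exp x - 1) \<le> x * (x * exp x)"
  proof (rule mult_left_mono[OF _ assms])
    have "1 - x \<le> exp (- x)" using exp_ge_add_one_self[of "- x"] by simp
    then have "(1 - x) * exp x \<le> exp (- x) * exp x" by (intro mult_right_mono) auto
    then show "exp x - 1 \<le> x * exp x" by (simp add: exp_minus algebra_simps)
  qed
  finally show ?thesis by (simp add: power2_eq_square mult.assoc)
qed

lemma D_integrand_integrable:
  assumes a: "a > 0" "c \<ge> 0" "a + c < 3" and t: "t \<ge> 0"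
  shows "set_integrable lborel {0<..<1} (\<lambda>s. w a c s * (exp ((1 - s) * t) - 1 - (1 - s) * t))"
proof (rule w_moment_integrable[OF a, where B = "t\<^sup>2 * exp t"])
  fix s :: real assume s: "0 < s" "s < 1"
  have st: "(1 - s) * t \<le> t" using s t by (simp add: mult_left_le_one_le)
  have "\<bar>exp ((1 - s) * t) - 1 - (1 - s) * t\<bar> = exp ((1 - s) * t) - 1 - (1 - s) * t"
    using exp_remainder_nonneg by (rule abs_of_nonneg)
  also have "\<dots> \<le> ((1 - s) * t)\<^sup>2 * exp ((1 - s) * t)"
    by (rule exp_remainder_le) (use s t in auto)
  also have "\<dots> \<le> ((1 - s) * t)\<^sup>2 * exp t"
    using st by (intro mult_left_mono) auto
  finally show "\<bar>exp ((1 - s) * t) - 1 - (1 - s) * t\<bar> \<le> t\<^sup>2 * exp t * (1 - s)\<^sup>2"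
    by (simp add: power_mult_distrib mult_ac)
qed (intro continuous_intros)

text \<open>For \<open>a = 1 - c\<close> every term of \<open>D\<close> is nonnegative: \<open>a * s + c \<le> 1\<close> keeps the sine nonnegative, and
\<open>q1 - q2 = a * (4 - 3 * a) / 24\<close>.\<close>

lemma bernstein_small_parameter:
  assumes c: "0 \<le> c" "c < 1"
  shows "bernstein (F (1 - c) (-c))"
proof -
  define a where "a = 1 - c"
  have a: "a > 0" "a + c < 3" "a + c = 1" using c by (auto simp: a_def)
  have q: "q1 a c - q2 a c \<ge> 0"
  proof -
    have c': "c = 1 - a" by (simp add: a_def)
    have "q1 a c - q2 a c = a * (4 - 3 * a) / 24"
      unfolding q1_def q2_def c' by (simp add: field_simps power2_eq_square)
    moreover have "a * (4 - 3 * a) \<ge> 0" using a c by (intro mult_nonneg_nonneg) (auto simp: a_def)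
    ultimately show ?thesis by simp
  qed
  have "Dser a c t \<ge> 0" if t: "t \<ge> 0" for t
  proof -
    have "0 \<le> (LBINT s:{0<..<1}. w a c s * (exp ((1 - s) * t) - 1 - (1 - s) * t))"
    proof -
      have "0 \<le> w a c s * (exp ((1 - s) * t) - 1 - (1 - s) * t)" if s: "0 < s" "s < 1" for s
      proof -
        have "a * s \<le> a" using s a by (simp add: mult_left_le)
        then have "a * s + c \<le> 1" using a by linarith
        then have "w a c s \<ge> 0" using s a c by (intro w_nonneg) auto
        then show ?thesis using exp_remainder_nonneg by (rule mult_nonneg_nonneg)
      qed
      then show ?thesis
        unfolding set_lebesgue_integral_def by (intro integral_nonneg_AE AE_I2) (auto simp: indicator_def)
    qed
    moreover have "q1 a c \<ge> 0" using a c by (simp add: q1_def)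
    ultimately have "D a c t \<ge> 0" unfolding D_def using q t by (intro add_nonneg_nonneg mult_nonneg_nonneg) auto
    then show ?thesis using D_eq_Dser[of a c t] a c by simp
  qed
  then show ?thesis using bernstein_iff_Dser_nonneg[of a c] a c by (simp add: a_def)
qed

text \<open>A Bernstein function is nonnegative and concave, so comparing slopes at \<open>a / 2\<close>, \<open>a\<close> and \<open>2 * a\<close> gives
\<open>F(2 * a) \<le> 3 * F(a)\<close>. But the quotient is \<open>(9 / 8) powr a * (4 / 3) powr c\<close>, which exceeds \<open>3\<close> for \<open>a \<ge> 10\<close>.\<close>

lemma bernstein_parameter_bounded:
  assumes a: "a > 0" and c: "c \<ge> 0" and bern: "bernstein (F a (-c))"
  shows "a \<le> 10"
proof (rule ccontr)
  assume "\<not> a \<le> 10"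
  define f where "f = F a (-c)"
  have cm: "completely_monotone (deriv f)" and sm: "smooth_on {0<..} f"
    using bern by (auto simp: bernstein_def f_def)
  have d1: "(f has_real_derivative deriv f x) (at x)" if "x > 0" for x
    using sm that unfolding smooth_on_def by (metis DERIV_deriv_iff_real_differentiable funpow_0 greaterThan_iff)
  have d2: "(deriv f has_real_derivative deriv (deriv f) x) (at x)" if "x > 0" for x
    using cm that unfolding completely_monotone_def smooth_on_def
    by (metis DERIV_deriv_iff_real_differentiable funpow_0 greaterThan_iff)
  have neg: "deriv (deriv f) x \<le> 0" if "x > 0" for x
  proof -
    have "(-1) ^ 1 * (deriv ^^ 1) (deriv f) x \<ge> 0" using cm that unfolding completely_monotone_def by blast
    then show ?thesis by simp
  qed
  have anti: "deriv f y \<le> deriv f x" if "0 < x" "x \<le> y" for x y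
  proof (rule DERIV_nonpos_imp_nonincreasing[OF that(2)])
    fix z assume "x \<le> z"
    then have "z > 0" using that by simp
    then show "\<exists>d. (deriv f has_real_derivative d) (at z) \<and> d \<le> 0" using d2 neg by blast
  qed
  obtain \<xi> where \<xi>: "a < \<xi>" "f (2 * a) - f a = (2 * a - a) * deriv f \<xi>"
    using MVT2[of a "2 * a" f "deriv f"] d1 a by force
  obtain \<xi>' where \<xi>': "a / 2 < \<xi>'" "\<xi>' < a" "f a - f (a / 2) = (a - a / 2) * deriv f \<xi>'"
    using MVT2[of "a / 2" a f "deriv f"] d1 a by force
  have "a * deriv f \<xi> \<le> a * deriv f \<xi>'" using anti[of \<xi>' \<xi>] \<xi> \<xi>' a by (intro mult_left_mono) auto
  moreover have "f (2 * a) - f a = a * deriv f \<xi>" using \<xi>(2) by simp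
  moreover have "2 * (f a - f (a / 2)) = a * deriv f \<xi>'" using \<xi>'(3) by (simp add: field_simps)
  ultimately have "f (2 * a) - f a \<le> 2 * (f a - f (a / 2))" by (simp only:)
  moreover have "f (a / 2) \<ge> 0" by (simp add: f_def F_def)
  ultimately have le: "f (2 * a) \<le> 3 * f a" by (simp add: algebra_simps)
  have f1: "f a = 2 powr (a - c)" and f2: "f (2 * a) = (3 / 2) powr (2 * a - c)"
    using a by (simp_all add: f_def F_def)
  have "(9 / 8) powr a \<le> (9 / 8) powr a * (4 / 3 :: real) powr c"
    using c by (simp add: ge_one_powr_ge_zero)
  also have "\<dots> = f (2 * a) / f a"
  proof -
    have "(3 / 2 :: real) powr (2 * a - c) = ((3 / 2) powr 2) powr a * (3 / 2) powr (- c)"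
      by (simp only: powr_powr powr_add[symmetric]) simp
    also have "(3 / 2 :: real) powr 2 = 9 / 4" by (simp add: power2_eq_square)
    finally have e2: "f (2 * a) = (9 / 4) powr a * (3 / 2) powr (- c)" by (simp add: f2)
    have e1: "f a = 2 powr a * 2 powr (- c)" unfolding f1 by (simp add: powr_add[symmetric])
    have "(9 / 4 :: real) powr a / 2 powr a = (9 / 8) powr a" by (simp add: powr_divide[symmetric])
    moreover have "(3 / 2 :: real) powr (- c) / 2 powr (- c) = (4 / 3) powr c"
    proof -
      have "(3 / 2 :: real) powr (- c) / 2 powr (- c) = (3 / 4) powr (- c)" by (simp add: powr_divide[symmetric])
      also have "\<dots> = (4 / 3) powr c" by (simp add: powr_minus powr_divide)
      finally show ?thesis .
    qed
    ultimately show ?thesis unfolding e1 e2 by (metis times_divide_times_eq)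
  qed
  also have "\<dots> \<le> 3" using le f1 by (simp add: divide_le_eq)
  finally have "(9 / 8 :: real) powr a \<le> 3" .
  moreover have "(9 / 8 :: real) powr 10 \<le> (9 / 8) powr a" using \<open>\<not> a \<le> 10\<close> by (intro powr_mono) auto
  moreover have "(9 / 8 :: real) powr 10 > 3" by (simp add: powr_numeral power_divide)
  ultimately show False by linarith
qed

lemma power_times_exp_tendsto_0:
  fixes k :: real
  assumes "k > 0"
  shows "((\<lambda>t. t ^ n * exp (- (k * t))) \<longlongrightarrow> 0) at_top"
proof -
  have "((\<lambda>t. (k * t) ^ n / exp (k * t)) \<longlongrightarrow> 0) at_top"
    by (rule filterlim_compose[OF tendsto_power_div_exp_0])
      (use assms in \<open>simp add: filterlim_tendsto_pos_mult_at_top[OF tendsto_const] filterlim_ident\<close>)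
  then have "((\<lambda>t. (1 / k) ^ n * ((k * t) ^ n / exp (k * t))) \<longlongrightarrow> (1 / k) ^ n * 0) at_top"
    by (intro tendsto_intros)
  then show ?thesis using assms by (simp add: power_mult_distrib exp_minus field_simps)
qed

text \<open>The weight is bounded below by some \<open>m > 0\<close> on a small interval \<open>[s1, s2]\<close> and is nonnegative on \<open>(0, s0]\<close> with \<open>s0 > s2\<close>. The
interval contributes at least a multiple of \<open>exp ((1 - s2) * t)\<close>, up to terms linear in \<open>t\<close>, while the part beyond \<open>s0\<close>, where the weight may
change sign, is \<open>O(t\<^sup>2 * exp ((1 - s0) * t))\<close>. All constants are uniform for \<open>a\<close> in a one-sided neighbourhood of \<open>a0\<close>.\<close>

lemma Dser_eventually_positive:
  assumes a0: "a0 > 0" and c: "0 \<le> c" "c < 1" and ac: "a0 + c < 3"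
  obtains \<epsilon> T where "\<epsilon> > 0" "T \<ge> 0" "\<And>a t. a0 \<le> a \<Longrightarrow> a \<le> a0 + \<epsilon> \<Longrightarrow> t \<ge> T \<Longrightarrow> Dser a c t > 0"
proof -
  let ?S = "{0<..<1::real}"
  \<comment> \<open>Half the distance to the bound a + c < 3, so that one integrable majorant serves all parameters.\<close>
  define \<epsilon> where "\<epsilon> = (3 - a0 - c) / 2"
  define a1 where "a1 = a0 + \<epsilon>"
  have \<epsilon>: "\<epsilon> > 0" "a1 + c < 3" "a1 > 0" using ac a0 c by (auto simp: \<epsilon>_def a1_def field_simps)
  \<comment> \<open>Chosen so that a * s + c <= (1 + c) / 2 < 1 for s <= s0 and a <= a1, which keeps the sine positive.\<close>
  define s0 where "s0 = min (1 / 2) ((1 - c) / (2 * a1))"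
  define s2 where "s2 = s0 / 2"
  define s1 where "s1 = s0 / 4"
  have s0: "0 < s0" "s0 \<le> 1 / 2" "a1 * s0 \<le> (1 - c) / 2"
  proof -
    show "0 < s0" "s0 \<le> 1 / 2" using c \<epsilon> by (auto simp: s0_def)
    have "a1 * s0 \<le> a1 * ((1 - c) / (2 * a1))" using \<epsilon> by (intro mult_left_mono) (auto simp: s0_def)
    then show "a1 * s0 \<le> (1 - c) / 2" using \<epsilon> by simp
  qed
  have s12: "0 < s1" "s1 < s2" "s2 < s0" using s0 by (auto simp: s1_def s2_def)
  have wpos: "w a c s > 0" if "a \<in> {a0..a1}" "s \<in> {s1..s2}" for a s
  proof -
    have "a * s \<le> a1 * s0" using that s12 a0 by (intro mult_mono) auto
    then have "a * s \<le> (1 - c) / 2" using s0(3) by (rule order_trans)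
    then have "a * s + c < 1" using c by (simp add: field_simps)
    moreover have "a * s + c > 0" using that s12 a0 c by (intro add_pos_nonneg mult_pos_pos) auto
    ultimately have "sin (pi * (a * s + c)) > 0" by (intro sin_gt_zero) auto
    moreover have "s / (1 - s) > 0" using that s12 s0 by auto
    ultimately show ?thesis unfolding w_def by (intro mult_pos_pos) auto
  qed
  obtain m where m: "m > 0" "\<And>a s. a \<in> {a0..a1} \<Longrightarrow> s \<in> {s1..s2} \<Longrightarrow> m \<le> w a c s"
  proof -
    let ?K = "{a0..a1} \<times> {s1..s2}"
    have cont: "continuous_on ?K (\<lambda>p. w (fst p) c (snd p))"
      unfolding w_def by (intro continuous_intros) (use s12 s0 in auto)
    have "compact ?K" by (intro compact_Times) auto
    moreover have "?K \<noteq> {}" using s12 \<epsilon> by (auto simp: a1_def)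
    ultimately have "\<exists>p\<in>?K. \<forall>q\<in>?K. w (fst p) c (snd p) \<le> w (fst q) c (snd q)"
      using cont by (rule continuous_attains_inf)
    then obtain p where "p \<in> ?K" "\<forall>q\<in>?K. w (fst p) c (snd p) \<le> w (fst q) c (snd q)" by blast
    then show thesis using wpos by (intro that[of "w (fst p) c (snd p)"]) auto
  qed
  define p where "p = 2 - (a1 + c)"
  have p: "p > -1" using \<epsilon> by (simp add: p_def)
  define G where "G = (LBINT s:?S. (1 - s) powr p)"
  define Q where "Q = a1 / 3 + c / 2 + 1 / 2 * (a1 / 2 + c)\<^sup>2"
  define \<Psi> where "\<Psi> t = m * (s2 - s1) * (exp ((1 - s2) * t) - 1 - (1 - s2) * t) - G * (t\<^sup>2 * exp ((1 - s0) * t)) - exp a1 * Q * t" for t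
  have lower: "exp a * Dser a c t \<ge> \<Psi> t" if a: "a0 \<le> a" "a \<le> a1" and t: "t \<ge> 0" for a t
  proof -
    have a': "a > 0" "a + c < 3" using a a0 \<epsilon> by auto
    define \<phi> where "\<phi> s = exp ((1 - s) * t) - 1 - (1 - s) * t" for s
    have \<phi>0: "\<phi> s \<ge> 0" for s unfolding \<phi>_def by (rule exp_remainder_nonneg)
    have i1: "set_integrable lborel ?S (\<lambda>s. w a c s * \<phi> s)"
      unfolding \<phi>_def by (rule D_integrand_integrable) (use a' c t in auto)
    have ind: "set_integrable lborel ?S (\<lambda>s. indicator {s1..s2} s :: real)"
      by (rule set_integrable_subset[of _ UNIV]) (auto simp: set_integrable_def emeasure_lborel_Icc_eq)
    have i2: "set_integrable lborel ?S (\<lambda>s. m * \<phi> s2 * indicator {s1..s2} s - t\<^sup>2 * exp ((1 - s0) * t) * (1 - s) powr p)"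
      by (intro set_integral_diff(1) set_integrable_mult_right ind one_minus_powr_integrable p)
    have "(LBINT s:?S. m * \<phi> s2 * indicator {s1..s2} s - t\<^sup>2 * exp ((1 - s0) * t) * (1 - s) powr p) \<le> (LBINT s:?S. w a c s * \<phi> s)"
    proof (rule set_integral_mono[OF i2 i1])
      fix s assume "s \<in> ?S"
      then have s: "0 < s" "s < 1" by auto
      have r0: "t\<^sup>2 * exp ((1 - s0) * t) * (1 - s) powr p \<ge> 0" by simp
      show "m * \<phi> s2 * indicator {s1..s2} s - t\<^sup>2 * exp ((1 - s0) * t) * (1 - s) powr p \<le> w a c s * \<phi> s"
      proof (cases "s \<le> s0")
        case True
        have "a * s \<le> a1 * s0" using True a a0 s by (intro mult_mono) auto
        then have w0: "w a c s \<ge> 0" using s s0 c a' by (intro w_nonneg) auto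
        have "m * \<phi> s2 * indicator {s1..s2} s \<le> w a c s * \<phi> s"
        proof (cases "s \<in> {s1..s2}")
          case True
          have "\<phi> s2 \<le> \<phi> s" unfolding \<phi>_def
            using True s s12 s0 t by (intro exp_remainder_mono mult_right_mono) auto
          then have "m * \<phi> s2 \<le> w a c s * \<phi> s"
            using m(2)[of a s] True a m(1) \<phi>0 w0 by (intro mult_mono) auto
          then show ?thesis using True by simp
        next
          case False
          then show ?thesis using w0 \<phi>0 by simp
        qed
        then show ?thesis using r0 by linarith
      next
        case False
        have "\<phi> s \<le> ((1 - s) * t)\<^sup>2 * exp ((1 - s) * t)"
          unfolding \<phi>_def by (rule exp_remainder_le) (use s t in auto)
        also have "\<dots> \<le> ((1 - s) * t)\<^sup>2 * exp ((1 - s0) * t)"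
          using False t by (intro mult_left_mono) (auto intro!: mult_right_mono)
        finally have \<phi>u: "\<phi> s \<le> (1 - s)\<^sup>2 * (t\<^sup>2 * exp ((1 - s0) * t))" by (simp add: power_mult_distrib mult_ac)
        have "\<bar>w a c s * \<phi> s\<bar> \<le> (1 - s) powr (- (a1 + c)) * ((1 - s)\<^sup>2 * (t\<^sup>2 * exp ((1 - s0) * t)))"
          unfolding abs_mult
        proof (rule mult_mono)
          have "\<bar>w a c s\<bar> \<le> (1 - s) powr (- (a + c))" by (rule w_bound) (use a' c s in auto)
          also have "\<dots> \<le> (1 - s) powr (- (a1 + c))" using a s by (intro powr_mono') auto
          finally show "\<bar>w a c s\<bar> \<le> (1 - s) powr (- (a1 + c))" .
          show "\<bar>\<phi> s\<bar> \<le> (1 - s)\<^sup>2 * (t\<^sup>2 * exp ((1 - s0) * t))" using \<phi>0 \<phi>u by simp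
        qed auto
        also have "\<dots> = t\<^sup>2 * exp ((1 - s0) * t) * (1 - s) powr p"
        proof -
          have "(1 - s)\<^sup>2 = (1 - s) powr 2" using s by simp
          moreover have "p = - (a1 + c) + 2" by (simp add: p_def)
          ultimately show ?thesis by (simp only: powr_add mult_ac)
        qed
        finally have "- (t\<^sup>2 * exp ((1 - s0) * t) * (1 - s) powr p) \<le> w a c s * \<phi> s" by linarith
        moreover have "s \<notin> {s1..s2}" using False s12 by auto
        ultimately show ?thesis by simp
      qed
    qed
    also have "(LBINT s:?S. m * \<phi> s2 * indicator {s1..s2} s - t\<^sup>2 * exp ((1 - s0) * t) * (1 - s) powr p)
       = m * \<phi> s2 * (LBINT s:?S. indicator {s1..s2} s) - t\<^sup>2 * exp ((1 - s0) * t) * G"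
      unfolding G_def
      by (subst set_integral_diff(2)) (auto intro!: set_integrable_mult_right ind one_minus_powr_integrable p)
    also have "(LBINT s:?S. indicator {s1..s2} s) = s2 - s1"
    proof -
      have "(LBINT s:?S. indicator {s1..s2} s) = (LINT s|lborel. (indicator {s1..s2} s :: real))"
        unfolding set_lebesgue_integral_def
        by (rule Bochner_Integration.integral_cong) (use s12 s0 in \<open>auto simp: indicator_def\<close>)
      then show ?thesis using s12 by simp
    qed
    finally have I: "m * (s2 - s1) * \<phi> s2 - G * (t\<^sup>2 * exp ((1 - s0) * t)) \<le> (LBINT s:?S. w a c s * \<phi> s)"
      by (simp add: mult_ac)
    have q1: "q1 a c \<ge> 0" using a' c by (simp add: q1_def)
    have q2: "q2 a c \<le> Q" unfolding q2_def Q_def using a a' c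
      by (intro add_mono mult_left_mono power_mono) auto
    have "Q \<ge> 0" using \<epsilon> c by (simp add: Q_def)
    have "exp a * Dser a c t = exp a * (q1 a c + (q1 a c - q2 a c) * t) + (LBINT s:?S. w a c s * \<phi> s)"
    proof -
      have "exp a * (X + exp (- a) * I) = exp a * X + I" for X I :: real
        by (simp add: distrib_left exp_minus)
      then show ?thesis
        unfolding D_eq_Dser[OF a'(1) c(1) a'(2), of t, symmetric] D_def \<phi>_def .
    qed
    moreover have "exp a * (q1 a c + (q1 a c - q2 a c) * t) \<ge> - (exp a1 * Q * t)"
    proof -
      have "(q1 a c - q2 a c) * t \<ge> - Q * t" using q1 q2 t by (intro mult_right_mono) auto
      then have "q1 a c + (q1 a c - q2 a c) * t \<ge> - (Q * t)" using q1 by simp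
      then have "exp a * (q1 a c + (q1 a c - q2 a c) * t) \<ge> exp a * - (Q * t)" by (intro mult_left_mono) auto
      moreover have "exp a * (Q * t) \<le> exp a1 * (Q * t)" using a \<open>Q \<ge> 0\<close> t by (intro mult_right_mono) auto
      ultimately show ?thesis by (simp add: mult.assoc)
    qed
    ultimately show ?thesis using I unfolding \<Psi>_def \<phi>_def by linarith
  qed
  have "((\<lambda>t. \<Psi> t * exp (- ((1 - s2) * t))) \<longlongrightarrow> m * (s2 - s1) * (1 - 0 - (1 - s2) * 0) - G * 0 - exp a1 * Q * 0) at_top"
  proof -
    have k: "1 - s2 > 0" "s0 - s2 > 0" using s12 s0 by auto
    have "((\<lambda>t. m * (s2 - s1) * (1 - t ^ 0 * exp (- ((1 - s2) * t)) - (1 - s2) * (t ^ 1 * exp (- ((1 - s2) * t))))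
        - G * (t ^ 2 * exp (- ((s0 - s2) * t))) - exp a1 * Q * (t ^ 1 * exp (- ((1 - s2) * t))))
        \<longlongrightarrow> m * (s2 - s1) * (1 - 0 - (1 - s2) * 0) - G * 0 - exp a1 * Q * 0) at_top"
      by (intro tendsto_intros power_times_exp_tendsto_0 k)
    moreover have "\<Psi> t * exp (- ((1 - s2) * t)) = m * (s2 - s1) * (1 - t ^ 0 * exp (- ((1 - s2) * t)) - (1 - s2) * (t ^ 1 * exp (- ((1 - s2) * t))))
        - G * (t ^ 2 * exp (- ((s0 - s2) * t))) - exp a1 * Q * (t ^ 1 * exp (- ((1 - s2) * t)))" for t
    proof -
      define e where "e = exp (- ((1 - s2) * t))"
      have e1: "exp ((1 - s2) * t) * e = 1" unfolding e_def by (simp flip: exp_add)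
      have e2: "exp ((1 - s0) * t) * e = exp (- ((s0 - s2) * t))"
        unfolding e_def exp_add[symmetric] by (simp add: algebra_simps)
      have "\<Psi> t * e = m * (s2 - s1) * (exp ((1 - s2) * t) * e - e - (1 - s2) * (t * e)) - G * (t\<^sup>2 * (exp ((1 - s0) * t) * e)) - exp a1 * Q * (t * e)"
        unfolding \<Psi>_def by (simp only: algebra_simps)
      then show ?thesis unfolding e1 e2 by (simp add: e_def)
    qed
    ultimately show ?thesis by (simp only:)
  qed
  moreover have "m * (s2 - s1) > 0" using m s12 by simp
  ultimately have "\<forall>\<^sub>F t in at_top. \<Psi> t * exp (- ((1 - s2) * t)) > 0"
    by (intro order_tendstoD(1)) auto
  then have "\<forall>\<^sub>F t in at_top. \<Psi> t > 0" by eventually_elim (simp add: zero_less_mult_iff)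
  then obtain T where T: "\<And>t. t \<ge> T \<Longrightarrow> \<Psi> t > 0" unfolding eventually_at_top_linorder by blast
  show thesis
  proof (rule that[OF \<epsilon>(1), of "max T 0"])
    fix a t assume "a0 \<le> a" "a \<le> a0 + \<epsilon>" "max T 0 \<le> t"
    then have "exp a * Dser a c t > 0" using lower[of a t] T[of t] by (auto simp: a1_def intro: less_le_trans)
    then show "Dser a c t > 0" by (simp add: zero_less_mult_iff)
  qed simp
qed

section \<open>Order of the zeros\<close>

lemma egf_smooth:
  assumes "tame d"
  shows "(deriv ^^ n) (egf d) x = egf (\<lambda>k. d (k + n)) x" and "smooth_on U (egf d)"
proof -
  have f: "((egf (\<lambda>k. d (k + n))) has_real_derivative egf (\<lambda>k. d (k + Suc n)) x) (at x)" for n x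
    using egf_has_derivative[OF tame_shift[OF assms, of n]] by simp
  show "(deriv ^^ n) (egf d) x = egf (\<lambda>k. d (k + n)) x"
    by (rule iterated_deriv_on_open(1)[where U = UNIV]) (use f in auto)
  have "smooth_on UNIV (egf d)"
    by (rule iterated_deriv_on_open(2)[where f = "\<lambda>n. egf (\<lambda>k. d (k + n))"]) (use f in auto)
  then show "smooth_on U (egf d)" by (auto simp: smooth_on_def)
qed

lemma egf_taylor:
  assumes d: "tame d" and x: "x \<noteq> y" and n: "n > 0"
    and zero: "\<And>k. k < n \<Longrightarrow> egf (\<lambda>j. d (j + k)) y = 0"
  obtains \<xi> where "(x < \<xi> \<and> \<xi> < y) \<or> (y < \<xi> \<and> \<xi> < x)"
    "egf d x = egf (\<lambda>j. d (j + n)) \<xi> / fact n * (x - y) ^ n"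
proof -
  have der: "\<forall>m t. m < n \<and> min x y \<le> t \<and> t \<le> max x y \<longrightarrow> DERIV (egf (\<lambda>j. d (j + m))) t :> egf (\<lambda>j. d (j + Suc m)) t"
    using egf_has_derivative[OF tame_shift[OF d]] by simp
  have "\<exists>t. (if x < y then x < t \<and> t < y else y < t \<and> t < x) \<and>
     egf d x = (\<Sum>m<n. egf (\<lambda>j. d (j + m)) y / fact m * (x - y) ^ m) + egf (\<lambda>j. d (j + n)) t / fact n * (x - y) ^ n"
    by (rule Taylor[OF n _ der]) (use x in auto)
  moreover have "(\<Sum>m<n. egf (\<lambda>j. d (j + m)) y / fact m * (x - y) ^ m) = 0"
    by (rule sum.neutral) (use zero in auto)
  ultimately obtain t where t: "if x < y then x < t \<and> t < y else y < t \<and> t < x"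
    "egf d x = egf (\<lambda>j. d (j + n)) t / fact n * (x - y) ^ n" by auto
  show thesis by (rule that[of t]) (use t in \<open>auto split: if_splits\<close>)
qed

text \<open>If all derivatives vanished at \<open>y\<close>, Taylor's formula at \<open>y\<close> would bound \<open>\<bar>d 0\<bar>\<close> by
\<open>C * exp (2 * y) * (2 * y) ^ n / fact n\<close> for every \<open>n\<close>.\<close>

lemma egf_zero_finite_order:
  assumes d: "tame d" and d0: "d 0 \<noteq> 0" and y: "y > 0"
  shows "\<exists>k. egf (\<lambda>j. d (j + k)) y \<noteq> 0"
proof (rule ccontr)
  assume "\<not> ?thesis"
  then have z: "\<And>k. egf (\<lambda>j. d (j + k)) y = 0" by blast
  obtain C where C: "C \<ge> 0" "\<And>n. \<bar>d n\<bar> \<le> C * 2 ^ n" using tame_bound[OF d] by blast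
  have bound: "\<bar>d 0\<bar> \<le> C * exp (2 * y) * ((2 * y) ^ n / fact n)" if n: "n > 0" for n
  proof -
    obtain \<xi> where \<xi>: "(0 < \<xi> \<and> \<xi> < y) \<or> (y < \<xi> \<and> \<xi> < 0)" "egf d 0 = egf (\<lambda>j. d (j + n)) \<xi> / fact n * (0 - y) ^ n"
      using egf_taylor[OF d _ n, of 0 y] z y by (metis less_irrefl)
    have \<xi>': "\<bar>\<xi>\<bar> \<le> y" using \<xi>(1) y by auto
    have "\<bar>egf (\<lambda>j. d (j + n)) \<xi>\<bar> \<le> (C * 2 ^ n) * exp (2 * \<bar>\<xi>\<bar>)"
      by (rule egf_bound[OF _ tame_shift[OF d]]) (use C(2)[of "_ + n"] in \<open>simp add: power_add mult_ac\<close>)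
    also have "\<dots> \<le> (C * 2 ^ n) * exp (2 * y)" using \<xi>' C by (intro mult_left_mono) auto
    finally have b: "\<bar>egf (\<lambda>j. d (j + n)) \<xi>\<bar> \<le> (C * 2 ^ n) * exp (2 * y)" .
    have "\<bar>d 0\<bar> = \<bar>egf (\<lambda>j. d (j + n)) \<xi>\<bar> / fact n * y ^ n"
      using \<xi>(2) y by (simp add: abs_mult power_abs)
    also have "\<dots> \<le> (C * 2 ^ n) * exp (2 * y) / fact n * y ^ n"
      using b y by (intro mult_right_mono divide_right_mono) auto
    finally show ?thesis by (simp add: power_mult_distrib field_simps)
  qed
  have "(\<lambda>n. (2 * y) ^ n / fact n) \<longlonglongrightarrow> 0"
    using summable_LIMSEQ_zero[OF summable_exp[of "2 * y"]] by (simp add: field_simps)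
  then have "(\<lambda>n. C * exp (2 * y) * ((2 * y) ^ n / fact n)) \<longlonglongrightarrow> C * exp (2 * y) * 0"
    by (intro tendsto_intros)
  then have "\<bar>d 0\<bar> \<le> C * exp (2 * y) * 0"
    by (rule LIMSEQ_le_const) (use bound in \<open>auto intro!: exI[of _ 1]\<close>)
  then show False using d0 by simp
qed

text \<open>By Taylor's formula the function has near \<open>y\<close> the sign of \<open>s * (x - y) ^ m\<close>, where \<open>s\<close> is the sign of the first nonvanishing
derivative; nonnegativity at \<open>y + h\<close> and \<open>y - h\<close> forces \<open>s > 0\<close> and \<open>m\<close> even.\<close>

lemma egf_nonneg_zero_even_order:
  assumes d: "tame d" and d0: "d 0 \<noteq> 0" and y: "y > 0" and zero: "egf d y = 0"
    and nonneg: "\<And>t. t \<ge> 0 \<Longrightarrow> egf d t \<ge> 0"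
  obtains m where "even m" "m \<ge> 2" "\<And>k. k < m \<Longrightarrow> egf (\<lambda>j. d (j + k)) y = 0" "egf (\<lambda>j. d (j + m)) y > 0"
proof -
  define m where "m = (LEAST k. egf (\<lambda>j. d (j + k)) y \<noteq> 0)"
  have mnz: "egf (\<lambda>j. d (j + m)) y \<noteq> 0"
    unfolding m_def using egf_zero_finite_order[OF d d0 y] by (rule LeastI_ex)
  have below: "egf (\<lambda>j. d (j + k)) y = 0" if "k < m" for k
    using not_less_Least[of k "\<lambda>k. egf (\<lambda>j. d (j + k)) y \<noteq> 0"] that by (auto simp: m_def)
  have m0: "m > 0" using mnz zero by (cases m) auto
  define s where "s = sgn (egf (\<lambda>j. d (j + m)) y)"
  have ss: "s * egf (\<lambda>j. d (j + m)) y > 0" using mnz by (simp add: s_def sgn_if)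
  have "isCont (\<lambda>x. s * egf (\<lambda>j. d (j + m)) x) y"
    using DERIV_isCont[OF egf_has_derivative[OF tame_shift[OF d, of m]]] by (intro continuous_intros)
  then obtain e where e: "e > 0" "\<And>x. dist x y < e \<Longrightarrow>
     dist (s * egf (\<lambda>j. d (j + m)) x) (s * egf (\<lambda>j. d (j + m)) y) < s * egf (\<lambda>j. d (j + m)) y"
    using ss unfolding continuous_at_eps_delta by blast
  have near: "s * egf (\<lambda>j. d (j + m)) x > 0" if "\<bar>x - y\<bar> < e" for x
    using e(2)[of x] that by (auto simp: dist_real_def)
  have sign: "0 \<le> s * (x - y) ^ m" if x: "x \<noteq> y" "\<bar>x - y\<bar> < e" "x \<ge> 0" for x
  proof (rule ccontr)
    assume neg: "\<not> 0 \<le> s * (x - y) ^ m"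
    obtain \<xi> where \<xi>: "(x < \<xi> \<and> \<xi> < y) \<or> (y < \<xi> \<and> \<xi> < x)"
      "egf d x = egf (\<lambda>j. d (j + m)) \<xi> / fact m * (x - y) ^ m"
      using egf_taylor[OF d x(1) m0 below] by blast
    have p: "s * egf (\<lambda>j. d (j + m)) \<xi> > 0" using \<xi>(1) x by (intro near) auto
    have "s * s = 1" using mnz by (simp add: s_def sgn_if)
    then have "egf d x = (s * egf (\<lambda>j. d (j + m)) \<xi>) / fact m * (s * (x - y) ^ m)"
      unfolding \<xi>(2) by (simp add: field_simps)
    also have "\<dots> < 0"
    proof (rule mult_pos_neg)
      show "(s * egf (\<lambda>j. d (j + m)) \<xi>) / fact m > 0" using p by (rule divide_pos_pos) simp
      show "s * (x - y) ^ m < 0" using neg by (simp only: not_le)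
    qed
    finally show False using nonneg[OF x(3)] by simp
  qed
  define h where "h = min (e / 2) (y / 2)"
  have h: "h > 0" "h < e" "h < y" using e y by (auto simp: h_def)
  have p1: "0 \<le> s * h ^ m" using sign[of "y + h"] h y by simp
  have p2: "0 \<le> s * (- h) ^ m" using sign[of "y - h"] h y by simp
  have s1: "s > 0"
  proof (rule ccontr)
    assume "\<not> s > 0"
    then have "s < 0" using ss by (cases "s = 0") auto
    then have "s * h ^ m < 0" using h by (intro mult_neg_pos) auto
    then show False using p1 by simp
  qed
  have ev: "even m"
  proof (rule ccontr)
    assume "odd m"
    then have "s * (- h) ^ m = - (s * h ^ m)" by simp
    moreover have "s * h ^ m > 0" using s1 h by simp
    ultimately show False using p2 by simp
  qed
  show thesis
  proof (rule that[OF ev _ below])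
    show "m \<ge> 2" using ev m0 by presburger
    show "egf (\<lambda>j. d (j + m)) y > 0" using ss s1 by (simp add: zero_less_mult_iff)
  qed
qed

section \<open>The extremal parameter\<close>

lemma bernstein_parameters:
  assumes c: "0 \<le> c" "c < 1"
  defines "S \<equiv> {a. a > 0 \<and> bernstein (F a (-c))}"
  shows "S \<noteq> {}" "bdd_above S" "S = {a. a > 0 \<and> (\<forall>t\<ge>0. Dser a c t \<ge> 0)}"
proof -
  have "1 - c \<in> S" using bernstein_small_parameter[OF c] c by (simp add: S_def)
  then show "S \<noteq> {}" by blast
  show "bdd_above S" using bernstein_parameter_bounded c by (intro bdd_aboveI[of _ 10]) (auto simp: S_def)
  show "S = {a. a > 0 \<and> (\<forall>t\<ge>0. Dser a c t \<ge> 0)}"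
    unfolding S_def using bernstein_iff_Dser_nonneg c by auto
qed

lemma A_eq_of_contact:
  assumes c: "0 \<le> c" "c < 1" and a: "a > 0" and nonneg: "\<And>t. t \<ge> 0 \<Longrightarrow> Dser a c t \<ge> 0"
    and t0: "t0 > 0" "Dser a c t0 = 0"
  shows "A (-c) = a"
  unfolding A_def bernstein_parameters(3)[OF c]
proof (rule cSup_eq_maximum)
  fix a' assume a': "a' \<in> {a. a > 0 \<and> (\<forall>t\<ge>0. Dser a c t \<ge> 0)}"
  show "a' \<le> a"
  proof (rule ccontr)
    assume "\<not> a' \<le> a"
    then have "\<exists>t\<in>{0..t0}. Dser a' c t < 0"
      using Dser_negative_after_contact[of a a' c t0] a c t0 nonneg by auto
    then show False using a' by force
  qed
qed (use a nonneg in auto)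

lemma Dser_nonneg_A:
  assumes c: "0 \<le> c" "c < 1" and t: "t \<ge> 0"
  shows "Dser (A (-c)) c t \<ge> 0"
proof -
  define S where "S = {a. a > 0 \<and> bernstein (F a (-c))}"
  have "A (-c) \<in> closure S"
    unfolding A_def S_def by (rule closure_contains_Sup[OF bernstein_parameters(1,2)[OF c]])
  moreover have "closure S \<subseteq> {a. 0 \<le> Dser a c t}"
  proof (rule closure_minimal)
    show "S \<subseteq> {a. 0 \<le> Dser a c t}" using t unfolding S_def bernstein_parameters(3)[OF c] by auto
    show "closed {a. 0 \<le> Dser a c t}"
    proof (rule closed_Collect_le)
      show "continuous_on UNIV (\<lambda>a. Dser a c t)"
        by (rule continuous_at_imp_continuous_on) (blast intro: DERIV_isCont Dser_deriv_a)
    qed simp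
  qed
  ultimately show ?thesis by blast
qed

text \<open>Without a zero the minimum over \<open>[0, T]\<close> is positive, and uniform continuity together with
\<open>Dser_eventually_positive\<close> yields a larger admissible parameter, contradicting the supremum.\<close>

lemma contact_at_A:
  assumes c: "0 \<le> c" "c < 1" and a: "A (-c) > 0" "A (-c) + c < 3"
  shows "\<exists>t>0. Dser (A (-c)) c t = 0"
proof (rule ccontr)
  let ?a = "A (-c)"
  assume no: "\<not> ?thesis"
  have pos: "Dser ?a c t > 0" if "t \<ge> 0" for t
  proof (cases "t = 0")
    case True
    then show ?thesis using a c by (simp add: Dser_0 q1_def)
  next
    case False
    then show ?thesis using Dser_nonneg_A[OF c that] no that by (metis less_le)
  qed
  obtain \<epsilon> T where \<epsilon>: "\<epsilon> > 0" "T \<ge> 0" "\<And>a t. ?a \<le> a \<Longrightarrow> a \<le> ?a + \<epsilon> \<Longrightarrow> t \<ge> T \<Longrightarrow> Dser a c t > 0"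
    using Dser_eventually_positive[OF a(1) c a(2)] by blast
  let ?K = "{?a..?a + \<epsilon>} \<times> {0..T}"
  have cont: "continuous_on ?K (\<lambda>(a, t). Dser a c t)" by (rule Dser_jointly_continuous)
  have "compact {0..T}" "{0..T} \<noteq> {}" using \<epsilon> by auto
  moreover have "continuous_on {0..T} (Dser ?a c)" unfolding Dser_def by (rule egf_continuous[OF tame_dcoeff])
  ultimately have "\<exists>t\<in>{0..T}. \<forall>u\<in>{0..T}. Dser ?a c t \<le> Dser ?a c u" by (rule continuous_attains_inf)
  then obtain \<mu> where \<mu>: "\<mu> > 0" "\<And>u. u \<in> {0..T} \<Longrightarrow> \<mu> \<le> Dser ?a c u" using pos by (metis atLeastAtMost_iff)
  have "uniformly_continuous_on ?K (\<lambda>(a, t). Dser a c t)"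
    by (rule compact_uniformly_continuous[OF cont]) (intro compact_Times compact_Icc)
  then obtain \<delta> where \<delta>: "\<delta> > 0" "\<And>p q. p \<in> ?K \<Longrightarrow> q \<in> ?K \<Longrightarrow> dist q p < \<delta> \<Longrightarrow>
      dist ((\<lambda>(a, t). Dser a c t) q) ((\<lambda>(a, t). Dser a c t) p) < \<mu>"
    unfolding uniformly_continuous_on_def using \<mu>(1) by metis
  define h where "h = min \<epsilon> (\<delta> / 2)"
  have h: "h > 0" "h \<le> \<epsilon>" "h < \<delta>" using \<epsilon> \<delta> by (auto simp: h_def)
  have "Dser (?a + h) c t \<ge> 0" if t: "t \<ge> 0" for t
  proof (cases "t \<ge> T")
    case True
    then show ?thesis using \<epsilon>(3)[of "?a + h" t] h by simp
  next
    case False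
    have "dist (?a + h, t) (?a, t) < \<delta>" using h by (simp add: dist_Pair_Pair dist_real_def)
    then have "dist (Dser (?a + h) c t) (Dser ?a c t) < \<mu>"
      using \<delta>(2)[of "(?a, t)" "(?a + h, t)"] h t False \<epsilon> by auto
    then show ?thesis using \<mu>(2)[of t] t False by (auto simp: dist_real_def)
  qed
  then have "?a + h \<in> {a. a > 0 \<and> bernstein (F a (-c))}"
    unfolding bernstein_parameters(3)[OF c] using a h by auto
  then have "?a + h \<le> ?a"
    unfolding A_def by (rule cSup_upper[OF _ bernstein_parameters(2)[OF c]])
  then show False using h by simp
qed

theorem corollary18:
  fixes a b :: real
  assumes "a > 0" and "-1 < b" and "b \<le> 0" and "a - b < 3"
  shows "(a = A b \<longleftrightarrow> (\<forall>t\<ge>0. D a (-b) t \<ge> 0) \<and> (\<exists>t\<^sub>b>0. D a (-b) t\<^sub>b = 0)) \<and>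
    (a = A b \<longrightarrow> (\<forall>t\<^sub>b>0. D a (-b) t\<^sub>b = 0 \<longrightarrow>
        (\<exists>m. even m \<and> m \<ge> 2 \<and> has_zero_of_order (D a (-b)) t\<^sub>b m) \<and>
        (D a (-b) has_real_derivative 0) (at t\<^sub>b) \<and>
        (\<exists>d\<ge>0. (deriv (D a (-b)) has_real_derivative d) (at t\<^sub>b)) \<and>
        (\<exists>d<0. ((\<lambda>a'. D a' (-b) t\<^sub>b) has_real_derivative d) (at a)) \<and>
        (\<exists>d<0. ((\<lambda>c. D a c t\<^sub>b) has_real_derivative d) (at (-b) within {0..}))))"
proof -
  define c where "c = - b"
  have c: "0 \<le> c" "c < 1" "a + c < 3" and b: "b = - c" using assms by (auto simp: c_def)
  have D: "D a c = Dser a c" using D_eq_Dser[OF assms(1) c(1,3)] by (rule ext)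
  have iff: "a = A (- c) \<longleftrightarrow> (\<forall>t\<ge>0. D a c t \<ge> 0) \<and> (\<exists>t>0. D a c t = 0)"
  proof
    assume eq: "a = A (- c)"
    then show "(\<forall>t\<ge>0. D a c t \<ge> 0) \<and> (\<exists>t>0. D a c t = 0)"
      using Dser_nonneg_A[OF c(1,2)] contact_at_A[OF c(1,2)] assms(1) c(3) unfolding D by simp
  next
    assume "(\<forall>t\<ge>0. D a c t \<ge> 0) \<and> (\<exists>t>0. D a c t = 0)"
    then show "a = A (- c)" using A_eq_of_contact[OF c(1,2) assms(1)] unfolding D by metis
  qed
  have contact: "(\<exists>m. even m \<and> m \<ge> 2 \<and> has_zero_of_order (D a c) t m) \<and>
        (D a c has_real_derivative 0) (at t) \<and>
        (\<exists>d\<ge>0. (deriv (D a c) has_real_derivative d) (at t)) \<and>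
        (\<exists>d<0. ((\<lambda>a'. D a' c t) has_real_derivative d) (at a)) \<and>
        (\<exists>d<0. ((\<lambda>c. D a c t) has_real_derivative d) (at c within {0..}))"
    if eq: "a = A (- c)" and t: "t > 0" and zero: "D a c t = 0" for t
  proof -
    have nonneg: "Dser a c u \<ge> 0" if "u \<ge> 0" for u using Dser_nonneg_A[OF c(1,2) that] eq by simp
    have z: "Dser a c t = 0" using zero by (simp add: D)
    let ?d = "dcoeff a c"
    have d0: "?d 0 \<noteq> 0" using assms(1) c by (simp add: dcoeff_0 q1_def)
    obtain m where m: "even m" "m \<ge> 2" "\<And>k. k < m \<Longrightarrow> egf (\<lambda>j. ?d (j + k)) t = 0" "egf (\<lambda>j. ?d (j + m)) t > 0"
      using egf_nonneg_zero_even_order[OF tame_dcoeff d0 t, folded Dser_def, OF z nonneg] unfolding Dser_def by blast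
    have "has_zero_of_order (D a c) t m"
      unfolding has_zero_of_order_def D Dser_def
      using m(3,4) by (auto simp: egf_smooth[OF tame_dcoeff[of a c]] intro: exI[of _ 1])
    moreover have "(D a c has_real_derivative 0) (at t)"
      using egf_has_derivative[OF tame_dcoeff[of a c], of t] m(3)[of 1] m(2) by (simp add: D Dser_def)
    moreover have "\<exists>d\<ge>0. (deriv (D a c) has_real_derivative d) (at t)"
    proof -
      have "deriv (D a c) = egf (\<lambda>j. ?d (j + 1))"
        using egf_smooth(1)[OF tame_dcoeff[of a c], of 1] by (simp add: D Dser_def fun_eq_iff)
      moreover have "(egf (\<lambda>j. ?d (j + 1)) has_real_derivative egf (\<lambda>j. ?d (j + 2)) t) (at t)"
        using egf_has_derivative[OF tame_shift[OF tame_dcoeff[of a c], of 1], of t] by simp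
      moreover have "egf (\<lambda>j. ?d (j + 2)) t \<ge> 0"
        using m(2) m(3)[of 2] m(4) by (cases "m = 2") auto
      ultimately show ?thesis by metis
    qed
    moreover have "\<exists>d<0. ((\<lambda>a'. D a' c t) has_real_derivative d) (at a)"
    proof -
      have "((\<lambda>a'. D a' c t) has_real_derivative egf (dcoeff_deriv acoeff a c) t) (at a)"
      proof (rule has_field_derivative_transform_within_open[OF Dser_deriv_a])
        show "open {0<..<3 - c}" by simp
        show "a \<in> {0<..<3 - c}" using assms(1) c by simp
        show "Dser a' c t = D a' c t" if "a' \<in> {0<..<3 - c}" for a'
          using D_eq_Dser[of a' c t] that c by simp
      qed
      then show ?thesis using contact_deriv_a[OF assms(1) c(1) t nonneg z] by blast
    qed
    moreover have "\<exists>d<0. ((\<lambda>c. D a c t) has_real_derivative d) (at c within {0..})"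
    proof -
      have "((\<lambda>c. D a c t) has_real_derivative egf (dcoeff_deriv ccoeff a c) t) (at c within {0..})"
      proof (rule has_field_derivative_transform_within[OF has_field_derivative_at_within[OF Dser_deriv_c]])
        show "0 < 3 - a - c" "c \<in> {0..}" using c by auto
        show "Dser a c' t = D a c' t" if "c' \<in> {0..}" "dist c' c < 3 - a - c" for c'
          using D_eq_Dser[of a c' t] that assms(1) by (auto simp: dist_real_def)
      qed
      then show ?thesis using contact_deriv_c[OF assms(1) c(1) t nonneg z] by blast
    qed
    ultimately show ?thesis using m(1,2) by blast
  qed
  show ?thesis unfolding b minus_minus using iff contact by blast
qed

end
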